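(* Let $d=2$, let $\Omega\subset\mathbb{R}^2$ be a bounded regular open set, and let $b:\mathbb{R}^2\to\mathbb{R}^2$ satisfy $$M=\int_{\mathbb{R}^2}|db(x)|\,dx<\infty,\quad \operatorname{supp}|db|\subset\Omega,\quad\|b\|_{L^\infty}\le2,\quad b_1(x)\ge1\ \ \forall x\in\Omega,$$ where $b_1$ is the first component of $b$. Let $X$ be a regular solution of $\partial_tX(t,x)=b(X(t,x))$, $X(0,x)=x$, satisfying $\frac1{C_0}\le\det d_xX(t,x)\le C_0$ for all $t\in[0,T]$, $x\in\mathbb{R}^2$. For $\delta\in\mathbb{R}^2\setminus\{0\}$ let $$Q_\delta(t)=\int_\Omega\log\Big(1+\frac{|X(t,x)-X(t,x+\delta)|}{|\delta|}\Big)\,dx.$$ Then there exists a constant $C$ depending only on $C_0$ such that for all $t\in[0,T]$ and all $\delta$, $$Q_\delta(t)\le|\Omega|\log2+C\,(t+|\delta|)\int_{\mathbb{R}^2}|db(x)|\,dx.$$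
   Context: $d_xX$ denotes the differential of $X$ with respect to $x$; $|db|$ is the total variation measure of the distributional derivative of $b$. *)

theory Defs
  imports "HOL-Analysis.Analysis"
begin

text \<open>Test fields for the distributional derivative of a vector field
  b : R^2 -> R^2 on an open set U: C^1 matrix-valued fields phi : R^2 -> R^(2x2)
  with compact support contained in U and pointwise (Frobenius) norm at most 1.\<close>

definition dtest :: "(real^2) set \<Rightarrow> (real^2 \<Rightarrow> real^2^2) set" where
  "dtest U = {\<phi>. (\<forall>x. \<phi> differentiable (at x))
      \<and> (\<forall>j. continuous_on UNIV (\<lambda>x. frechet_derivative \<phi> (at x) (axis j 1)))
      \<and> compact (closure {x. \<phi> x \<noteq> 0}) \<and> closure {x. \<phi> x \<noteq> 0} \<subseteq> U
      \<and> (\<forall>x. norm (\<phi> x) \<le> 1)}"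

definition mdiv :: "(real^2 \<Rightarrow> real^2^2) \<Rightarrow> real^2 \<Rightarrow> 2 \<Rightarrow> real" where
  "mdiv \<phi> x i = (\<Sum>j\<in>UNIV. (frechet_derivative \<phi> (at x) (axis j 1)) $ i $ j)"

text \<open>Total variation |db|(U) of the distributional derivative of b on the open set U.\<close>
definition dvar :: "(real^2 \<Rightarrow> real^2) \<Rightarrow> (real^2) set \<Rightarrow> ereal" where
  "dvar b U = Sup {ereal (\<Sum>i\<in>UNIV. \<integral>x. b x $ i * mdiv \<phi> x i \<partial>lborel) | \<phi>. \<phi> \<in> dtest U}"

definition dvar_support :: "(real^2 \<Rightarrow> real^2) \<Rightarrow> (real^2) set" where
  "dvar_support b = - \<Union>{U. open U \<and> dvar b U = 0}"

definition regular_open :: "'a::topological_space set \<Rightarrow> bool" where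
  "regular_open S \<longleftrightarrow> interior (closure S) = S"

end

theory Submission
  imports Defs
begin

text \<open>
  Put \<open>E x = X t (x + \<delta>) - X t x - \<delta>\<close>. Since \<open>ln (1 + norm (X t x - X t (x + \<delta>)) / norm \<delta>) \<le>
  ln 2 + norm (E x) / (2 * norm \<delta>)\<close>, it suffices to bound the integral of \<open>norm (E x)\<close> by a
  multiple of \<open>norm \<delta> * (t + norm \<delta>)\<close> times the total variation of \<open>b\<close>. Outside the support of its
  derivative \<open>b\<close> is locally constant, and this forces \<open>b $ 1 \<ge> 1\<close> almost everywhere unless \<open>b\<close> is constant.
  Hence every trajectory is the graph of a function of the first coordinate \<open>h\<close>. Almost all pairs of
  graphs do not cross, because their difference would have to traverse a thin slab in which the
  velocities hardly differ; by continuity all pairs are ordered.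

  Two graphs drift apart at \<open>h\<close> at most by the variation of \<open>b\<close> along the vertical segment between them.
  By Tonelli it remains to bound, for every point \<open>z\<close>, the measure of the \<open>x\<close> whose graph is separated by \<open>z\<close>
  from that of \<open>x + \<delta>\<close>. By order preservation such an \<open>x\<close> starts within distance \<open>3 * norm \<delta>\<close> of the
  backward trajectory of \<open>z\<close>, which is a Lipschitz curve over an interval of length \<open>2 * t\<close>.
  The remaining boundary layers of length \<open>norm \<delta>\<close> in time are controlled by comparing \<open>b\<close> along the flow
  with \<open>b\<close> at the starting point; there the Jacobian bound enters. The Jacobian bound becomes a bound for
  the measure of preimages because \<open>X t\<close> is injective: it stays close to the identity, and all its
  solutions of \<open>X t x = w\<close> have index \<open>1\<close>.
\<close>

section \<open>Lebesgue measure and integral\<close>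

text \<open>Two obstacles shape the argument. First, \<open>b\<close> is only measurable and
  bounded, so its variation along a single vertical segment has no pointwise meaning. The analytic
  input is a translation bound: the integral of \<open>norm (b (z + w) - b z)\<close> is at most
  \<open>norm w\<close> times a multiple of the variation. Variations along segments are replaced by
  mean increments over a length \<open>e\<close>, with \<open>e\<close> sent to \<open>0\<close>
  after integration. The losses on the way carry the density of trajectories on a vertical line, a
  constant in \<open>T\<close> and \<open>C\<close>, but also a spare factor \<open>e\<close>, so
  they leave no trace in the final constant. Second, the a priori facts must be won in a fixed
  order. The bound on \<open>norm b\<close> holds almost everywhere only, so speed bounds for
  trajectories need that \<open>X t\<close> pulls null sets back to null sets. This has to be shown
  without injectivity, since injectivity uses that \<open>X t\<close> stays at bounded distance from
  the identity, which is one of the speed bounds. Only then does the Jacobian bound become a bound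
  for preimages of arbitrary Borel sets.\<close>

lemma abs_fst_le_norm: "\<bar>fst z\<bar> \<le> norm z" for z :: "real \<times> real"
  by (metis norm_fst_le prod.collapse real_norm_def)

lemma abs_snd_le_norm: "\<bar>snd z\<bar> \<le> norm z" for z :: "real \<times> real"
  by (metis norm_snd_le prod.collapse real_norm_def)

lemma borel_measurable_fst [measurable (raw)]:
  fixes f :: "'c \<Rightarrow> 'a::topological_space \<times> 'b::topological_space"
  shows "f \<in> borel_measurable N \<Longrightarrow> (\<lambda>x. fst (f x)) \<in> borel_measurable N"
  by (rule borel_measurable_continuous_on[where f=fst]) (intro continuous_intros)

lemma borel_measurable_snd [measurable (raw)]:
  fixes f :: "'c \<Rightarrow> 'a::topological_space \<times> 'b::topological_space"
  shows "f \<in> borel_measurable N \<Longrightarrow> (\<lambda>x. snd (f x)) \<in> borel_measurable N"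
  by (rule borel_measurable_continuous_on[where f=snd]) (intro continuous_intros)

lemma borel_measurable_vec_nth [measurable (raw)]:
  fixes f :: "'c \<Rightarrow> real^'n"
  shows "f \<in> borel_measurable N \<Longrightarrow> (\<lambda>x. f x $ i) \<in> borel_measurable N"
  by (rule borel_measurable_continuous_on[where f="\<lambda>x. x $ i"]) (intro continuous_intros)

lemma set_integrable_bounded_Icc:
  fixes f :: "real \<Rightarrow> 'a::{banach, second_countable_topology}"
  assumes "f \<in> borel_measurable borel" "\<And>x. norm (f x) \<le> K"
  shows "set_integrable lborel {a..b} f"
  unfolding set_integrable_def
  by (rule integrableI_bounded_set_indicator[where B = K])
     (use assms emeasure_compact_finite[of "{a..b}"] in auto)

lemma set_lebesgue_integral_fst:
  fixes f :: "'c \<Rightarrow> real \<times> real"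
  assumes "set_integrable M A f"
  shows "fst (set_lebesgue_integral M A f) = set_lebesgue_integral M A (\<lambda>x. fst (f x))"
  unfolding set_lebesgue_integral_def
  using integral_bounded_linear[OF bounded_linear_fst assms[unfolded set_integrable_def]] by simp

lemma set_lebesgue_integral_snd:
  fixes f :: "'c \<Rightarrow> real \<times> real"
  assumes "set_integrable M A f"
  shows "snd (set_lebesgue_integral M A f) = set_lebesgue_integral M A (\<lambda>x. snd (f x))"
  unfolding set_lebesgue_integral_def
  using integral_bounded_linear[OF bounded_linear_snd assms[unfolded set_integrable_def]] by simp

lemma set_integral_Icc_diff:
  fixes f :: "real \<Rightarrow> 'a::{banach, second_countable_topology}"
  assumes f: "set_integrable lborel {a..t} f" and "a \<le> s" "s \<le> t"
  shows "(LINT r:{a..t}|lborel. f r) - (LINT r:{a..s}|lborel. f r) = (LINT r:{s..t}|lborel. f r)"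
proof -
  have sub: "set_integrable lborel {s<..t} f" "set_integrable lborel {s..t} f"
    by (rule set_integrable_subset[OF f]; use assms in auto)+
  have "(LINT r:{a..t}|lborel. f r) = (LINT r:({a..s} \<union> {s<..t})|lborel. f r)"
    using assms by (intro arg_cong2[where f = "set_lebesgue_integral lborel"]) auto
  also have "\<dots> = (LINT r:{a..s}|lborel. f r) + (LINT r:{s<..t}|lborel. f r)"
    by (intro set_integral_Un) (use assms in \<open>auto intro: set_integrable_subset[OF f]\<close>)
  also have "(LINT r:{s<..t}|lborel. f r) = (LINT r:{s..t}|lborel. f r)"
    unfolding set_lebesgue_integral_def
    by (rule integral_cong_AE)
       (use AE_lborel_singleton[of s] sub
        in \<open>auto split: split_indicator elim!: eventually_mono simp: set_integrable_def intro: borel_measurable_integrable\<close>)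
  finally show ?thesis by simp
qed

lemma emeasure_open_nonzero:
  fixes A :: "'a::euclidean_space set"
  assumes "open A" "x \<in> A"
  shows "emeasure lborel A \<noteq> 0"
proof
  assume "emeasure lborel A = 0"
  then have "A \<in> null_sets lborel" using assms by (simp add: null_sets_def)
  then have "negligible A" by (simp add: negligible_iff_null_sets null_sets_completionI)
  then show False using open_not_negligible assms by blast
qed

lemma nn_integral_translate:
  fixes a :: "'a::euclidean_space"
  assumes [measurable]: "f \<in> borel_measurable borel"
  shows "(\<integral>\<^sup>+x. f (x + a) \<partial>lborel) = (\<integral>\<^sup>+x. f x \<partial>lborel)"
proof -
  have "(\<integral>\<^sup>+x. f x \<partial>lborel) = (\<integral>\<^sup>+x. f x \<partial>distr lborel borel ((+) a))"
    by (simp only: lborel_distr_plus)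
  also have "\<dots> = (\<integral>\<^sup>+x. f (x + a) \<partial>lborel)" by (subst nn_integral_distr) (auto simp: add.commute)
  finally show ?thesis by simp
qed

lemma AE_translate_lborel:
  fixes a :: "'a::euclidean_space"
  assumes "AE x in lborel. P x"
  shows "AE x in lborel. P (x + a)"
proof -
  have "AE x in distr lborel borel ((+) a). P x"
    using assms by (simp only: lborel_distr_plus)
  from AE_distrD[OF _ this] show ?thesis by (simp add: add.commute)
qed

lemma lborel_integral_translate:
  fixes h :: "'a::euclidean_space \<Rightarrow> real"
  assumes [measurable]: "h \<in> borel_measurable borel"
  shows "(\<integral>z. h (z + w) \<partial>lborel) = (\<integral>z. h z \<partial>lborel)"
proof -
  have "(\<integral>z. h z \<partial>lborel) = (\<integral>z. h z \<partial>distr lborel borel ((+) w))" by (simp only: lborel_distr_plus)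
  also have "\<dots> = (\<integral>z. h (z + w) \<partial>lborel)" by (subst integral_distr) (auto simp: add.commute)
  finally show ?thesis by simp
qed

lemma integrable_bounded_support:
  fixes h :: "'a::euclidean_space \<Rightarrow> real"
  assumes "h \<in> borel_measurable borel" "\<And>z. \<bar>h z\<bar> \<le> B" "bounded S" "\<And>z. z \<notin> S \<Longrightarrow> h z = 0"
  shows "integrable lborel h"
proof -
  obtain r where "\<forall>x\<in>S. norm x \<le> r" using assms(3) by (auto simp: bounded_iff)
  then have r: "z \<in> cball 0 r" if "z \<in> S" for z using that by simp
  have fin: "emeasure lborel (cball (0::'a) r) < \<infinity>" by (rule emeasure_compact_finite) simp
  have "integrable lborel (\<lambda>z. indicator (cball 0 r) z *\<^sub>R h z)"
    by (rule integrableI_bounded_set_indicator[where B = B])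
       (use assms(1,2) fin in simp_all)
  moreover have "(\<lambda>z. indicator (cball 0 r) z *\<^sub>R h z) = h"
  proof
    fix z show "indicator (cball 0 r) z *\<^sub>R h z = h z"
      using assms(4)[of z] r[of z] by (cases "z \<in> S") auto
  qed
  ultimately show ?thesis by (simp only:)
qed

lemma nn_integral_swap_lborel:
  fixes f :: "'a::euclidean_space \<Rightarrow> 'b::euclidean_space \<Rightarrow> ennreal"
  assumes "(\<lambda>p. f (fst p) (snd p)) \<in> borel_measurable borel"
  shows "(\<integral>\<^sup>+x. (\<integral>\<^sup>+y. f x y \<partial>lborel) \<partial>lborel) = (\<integral>\<^sup>+y. (\<integral>\<^sup>+x. f x y \<partial>lborel) \<partial>lborel)"
  by (rule pair_sigma_finite.Fubini'[symmetric])
     (use assms in \<open>auto simp: pair_sigma_finite_def sigma_finite_lborel case_prod_unfold lborel_prod\<close>)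

lemma nn_integral_plane:
  fixes f :: "'a::euclidean_space \<times> 'b::euclidean_space \<Rightarrow> ennreal"
  assumes "f \<in> borel_measurable borel"
  shows "(\<integral>\<^sup>+x. (\<integral>\<^sup>+y. f (x, y) \<partial>lborel) \<partial>lborel) = (\<integral>\<^sup>+z. f z \<partial>lborel)"
  using lborel.nn_integral_fst[of f "lborel :: 'a measure"] assms by (simp add: lborel_prod)

lemma nn_integral_compose_le:
  fixes g :: "'a::euclidean_space \<Rightarrow> 'b::euclidean_space"
  assumes [measurable]: "g \<in> borel_measurable borel" "f \<in> borel_measurable borel"
    and le: "\<And>A. A \<in> sets borel \<Longrightarrow> emeasure lborel (g -` A) \<le> c * emeasure lborel A"
  shows "(\<integral>\<^sup>+x. f (g x) \<partial>lborel) \<le> c * (\<integral>\<^sup>+y. f y \<partial>lborel)"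
proof -
  have "(\<integral>\<^sup>+x. f (g x) \<partial>lborel) = (\<integral>\<^sup>+y. f y \<partial>distr lborel borel g)"
    by (simp add: nn_integral_distr)
  also have "\<dots> \<le> (\<integral>\<^sup>+y. f y \<partial>density lborel (\<lambda>_. c))"
  proof (rule nn_integral_mono_measure)
    show "distr lborel borel g \<le> density lborel (\<lambda>_. c)"
    proof (subst le_measure)
      show "\<forall>A\<in>sets (distr lborel borel g). emeasure (distr lborel borel g) A \<le> emeasure (density lborel (\<lambda>_. c)) A"
        using le by (auto simp: emeasure_distr emeasure_density nn_integral_cmult_indicator)
    qed simp
  qed simp
  also have "\<dots> = c * (\<integral>\<^sup>+y. f y \<partial>lborel)"
    by (subst nn_integral_density) (auto intro: nn_integral_cmult)
  finally show ?thesis .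
qed

lemma AE_witness_open:
  fixes S :: "'a::euclidean_space set"
  assumes "AE x in lborel. P x" "open S" "S \<noteq> {}"
  shows "\<exists>x\<in>S. P x"
proof (rule ccontr)
  assume "\<not> (\<exists>x\<in>S. P x)"
  then have "AE x in lborel. x \<notin> S" using assms(1) by (auto elim: eventually_mono)
  then have "S \<in> null_sets lborel" using assms(2) by (subst AE_iff_null_sets) auto
  then show False using emeasure_open_nonzero[OF assms(2)] assms(3) by (auto simp: null_sets_def)
qed

text \<open>A nonempty open complement would have positive measure. This extends speed bounds from
  almost every starting point to every one.\<close>

lemma AE_closed_imp_all:
  fixes P :: "'a::euclidean_space \<Rightarrow> bool"
  assumes "AE x in lborel. P x" "closed {x. P x}"
  shows "P x"
proof (rule ccontr)
  assume "\<not> P x"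
  then have "- {x. P x} \<noteq> {}" by blast
  from AE_witness_open[OF assms(1) open_Compl[OF assms(2)] this] show False by blast
qed

text \<open>By Lindelof countably many of the balls suffice, so their exceptional null sets can be
  united.\<close>

lemma AE_local:
  fixes W :: "'a::euclidean_space set"
  assumes "\<And>x. x \<in> W \<Longrightarrow> \<exists>\<rho>>0. AE y in lborel. y \<in> ball x \<rho> \<longrightarrow> P y"
  shows "AE y in lborel. y \<in> W \<longrightarrow> P y"
proof -
  define F where "F = {ball x \<rho> | x \<rho>. AE y in lborel. y \<in> ball x \<rho> \<longrightarrow> P y}"
  obtain F' where F': "F' \<subseteq> F" "countable F'" "\<Union>F' = \<Union>F"
    by (rule Lindelof[of F]) (auto simp: F_def)
  have "AE y in lborel. \<forall>S\<in>F'. y \<in> S \<longrightarrow> P y"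
    using F' by (intro AE_ball_countable') (auto simp: F_def)
  moreover have "W \<subseteq> \<Union>F'"
  proof
    fix x assume "x \<in> W"
    then obtain \<rho> where "0 < \<rho>" "AE y in lborel. y \<in> ball x \<rho> \<longrightarrow> P y" using assms by blast
    then show "x \<in> \<Union>F'" unfolding F'(3) by (intro UnionI[of "ball x \<rho>"]) (auto simp: F_def)
  qed
  ultimately show ?thesis by (auto elim!: eventually_mono)
qed

section \<open>Increments of functions of one variable\<close>

text \<open>Between the last point where \<open>u\<close> is at least \<open>e\<close> and the first
  later point where it is at most \<open>- e\<close>, the function stays in the slab and yet falls
  by \<open>2 * e\<close>. So \<open>w\<close> must supply this much while \<open>u\<close> is in
  the slab.\<close>

lemma descent_through_slab:
  fixes u w :: "real \<Rightarrow> real"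
  assumes "h0 \<le> h1" and cont: "continuous_on {h0..h1} u"
    and eq: "\<And>h k. h0 \<le> h \<Longrightarrow> h \<le> k \<Longrightarrow> k \<le> h1 \<Longrightarrow> u k - u h = (LINT r:{h..k}|lborel. w r)"
    and w [measurable]: "w \<in> borel_measurable borel" and wK: "\<And>r. norm (w r) \<le> K"
    and e: "0 < e" "e \<le> u h0" "u h1 \<le> - e"
  shows "ennreal (2 * e) \<le> (\<integral>\<^sup>+h. indicator {h0..h1} h * (indicator {-e..e} (u h) * ennreal \<bar>w h\<bar>) \<partial>lborel)"
proof -
  have cpt: "compact ({a..b} \<inter> u -` S)" if "{a..b} \<subseteq> {h0..h1}" "closed S" for a b S
    using continuous_closed_preimage[OF continuous_on_subset[OF cont that(1)] closed_atLeastAtMost that(2)]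
    by (simp add: compact_eq_bounded_closed bounded_Int)
  have "{h0..h1} \<inter> u -` {e..} \<noteq> {}" using assms(1) e by auto
  from compact_attains_sup[OF cpt[of h0 h1 "{e..}"] this]
  obtain a where a: "h0 \<le> a" "a \<le> h1" "e \<le> u a" "\<And>h. h0 \<le> h \<Longrightarrow> h \<le> h1 \<Longrightarrow> e \<le> u h \<Longrightarrow> h \<le> a"
    by auto
  have "{a..h1} \<inter> u -` {..-e} \<noteq> {}" using a e by auto
  from compact_attains_inf[OF cpt[of a h1 "{..-e}"] this]
  obtain c where c: "a \<le> c" "c \<le> h1" "u c \<le> -e" "\<And>h. a \<le> h \<Longrightarrow> h \<le> h1 \<Longrightarrow> u h \<le> -e \<Longrightarrow> c \<le> h"
    using a by auto
  have in_slab: "u h \<in> {-e..e}" if "a < h" "h < c" for h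
    using a(4)[of h] c(4)[of h] that a c by fastforce
  have int: "set_integrable lborel {a..c} w" by (rule set_integrable_bounded_Icc[OF w wK])
  have "2 * e \<le> u a - u c" using a c by simp
  also have "\<dots> = - (LINT r:{a..c}|lborel. w r)" using eq[of a c] a c by simp
  also have "\<dots> \<le> (LINT r:{a..c}|lborel. norm (w r))"
    using set_integral_norm_bound[OF int] by simp
  finally have "ennreal (2 * e) \<le> ennreal (LINT r:{a..c}|lborel. norm (w r))" by (rule ennreal_leI)
  also have "\<dots> = (\<integral>\<^sup>+r. ennreal (indicator {a..c} r *\<^sub>R norm (w r)) \<partial>lborel)"
    unfolding set_lebesgue_integral_def
    using set_integrable_norm[OF int] by (intro nn_integral_eq_integral[symmetric]) (auto simp: set_integrable_def)
  also have "\<dots> \<le> (\<integral>\<^sup>+h. indicator {h0..h1} h * (indicator {-e..e} (u h) * ennreal \<bar>w h\<bar>) \<partial>lborel)"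
  proof (rule nn_integral_mono_AE)
    show "AE h in lborel. ennreal (indicator {a..c} h *\<^sub>R norm (w h)) \<le> indicator {h0..h1} h * (indicator {-e..e} (u h) * ennreal \<bar>w h\<bar>)"
      using AE_lborel_singleton[of a] AE_lborel_singleton[of c]
    proof eventually_elim
      case (elim h)
      then show ?case using in_slab[of h] a c by (auto split: split_indicator)
    qed
  qed
  finally show ?thesis .
qed

text \<open>The means of \<open>f\<close> over the windows of length \<open>e\<close> to the right
  of \<open>y\<close> and \<open>y'\<close> differ by an integral of increments
  \<open>f (s + e) - f s\<close> over the segment between them; replacing \<open>f y\<close> and
  \<open>f y'\<close> by these means costs the first two terms. After division by \<open>e\<close>
  the last term plays the role of the variation of \<open>f\<close> on the segment.\<close>

lemma steklov_increment:
  fixes f :: "real \<Rightarrow> 'a::{banach, second_countable_topology}"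
  assumes f [measurable]: "f \<in> borel_measurable borel" and K: "\<And>x. norm (f x) \<le> K" and e: "0 \<le> e"
  shows "ennreal (e * norm (f y' - f y)) \<le>
    (\<integral>\<^sup>+s. indicator {0..<e} s * ennreal (norm (f (y + s) - f y)) \<partial>lborel)
    + (\<integral>\<^sup>+s. indicator {0..<e} s * ennreal (norm (f (y' + s) - f y')) \<partial>lborel)
    + (\<integral>\<^sup>+s. indicator {min y y'..max y y'} s * ennreal (norm (f (s + e) - f s)) \<partial>lborel)" (is "?P y y'")
proof -
  have int: "integrable lborel (\<lambda>s. indicator {a..<c} s *\<^sub>R f (s + d))" for a c d
    by (rule integrableI_bounded_set_indicator[where B = K])
       (use K emeasure_bounded_finite[of "{a..<c}"] in auto)
  have int2: "integrable lborel (\<lambda>s. indicator {a..<c} s *\<^sub>R (f (p s) - f (q s)))"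
    if [measurable]: "p \<in> borel_measurable borel" "q \<in> borel_measurable borel" for a c and p q :: "real \<Rightarrow> real"
    by (rule integrableI_bounded_set_indicator[where B = "K + K"])
       (use emeasure_bounded_finite[of "{a..<c}"] norm_triangle_le_diff[OF add_mono[OF K K]] in auto)
  have shift: "(LINT s|lborel. indicator {a..<c} s *\<^sub>R f s) = (LINT s|lborel. indicator {a-d..<c-d} s *\<^sub>R f (s + d))" for a c d
    by (subst lborel_integral_real_affine[where c=1 and t=d])
       (auto simp: add.commute intro!: Bochner_Integration.integral_cong split: split_indicator)
  have "?P y y'" if "y \<le> y'" for y y'
  proof -
    define A where "A y = (LINT s|lborel. indicator {0..<e} s *\<^sub>R (f (y + s) - f y))" for y
    define B where "B = (LINT s|lborel. indicator {y..<y'} s *\<^sub>R (f (s + e) - f s))"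
    have A: "A y = (LINT s|lborel. indicator {y..<y+e} s *\<^sub>R f s) - e *\<^sub>R f y" for y
      using shift[of y "y + e" y] int[of 0 e y] e
      by (simp add: A_def scaleR_diff_right add.commute[of y]
         Bochner_Integration.integral_diff)
    have "(LINT s|lborel. indicator {y'..<y'+e} s *\<^sub>R f s) - (LINT s|lborel. indicator {y..<y+e} s *\<^sub>R f s)
      = (LINT s|lborel. indicator {y'..<y'+e} s *\<^sub>R f s - indicator {y..<y+e} s *\<^sub>R f s)"
      using int[of _ _ 0] by (simp add: Bochner_Integration.integral_diff)
    \<comment> \<open>Whether or not the two windows overlap, their signed difference equals the
      segment shifted by \<open>e\<close> minus the segment itself.\<close>
    also have "\<dots> = (LINT s|lborel. indicator {y+e..<y'+e} s *\<^sub>R f s - indicator {y..<y'} s *\<^sub>R f s)"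
      using that e by (intro Bochner_Integration.integral_cong) (auto split: split_indicator)
    also have "\<dots> = (LINT s|lborel. indicator {y+e..<y'+e} s *\<^sub>R f s) - (LINT s|lborel. indicator {y..<y'} s *\<^sub>R f s)"
      using int[of _ _ 0] by (simp add: Bochner_Integration.integral_diff)
    also have "\<dots> = B"
      using shift[of "y+e" "y'+e" e] int[of y y' e] int[of y y' 0]
      by (simp add: B_def scaleR_diff_right Bochner_Integration.integral_diff)
    finally have "B = (LINT s|lborel. indicator {y'..<y'+e} s *\<^sub>R f s) - (LINT s|lborel. indicator {y..<y+e} s *\<^sub>R f s)" ..
    then have "e *\<^sub>R (f y' - f y) = A y - A y' + B" by (simp add: A scaleR_diff_right)
    then have "e * norm (f y' - f y) = norm (A y - A y' + B)"
      using e by (metis abs_of_nonneg norm_scaleR)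
    also have "\<dots> \<le> norm (A y) + norm (A y') + norm B"
      by (metis add_right_mono norm_triangle_ineq norm_triangle_ineq4 order_trans)
    finally have le: "ennreal (e * norm (f y' - f y)) \<le> ennreal (norm (A y)) + ennreal (norm (A y')) + ennreal (norm B)"
      by (simp add: ennreal_leI flip: ennreal_plus)
    have A_le: "ennreal (norm (A y)) \<le> (\<integral>\<^sup>+s. indicator {0..<e} s * ennreal (norm (f (y + s) - f y)) \<partial>lborel)" for y
      unfolding A_def by (rule order_trans[OF integral_norm_bound_ennreal[OF int2]])
        (auto intro!: nn_integral_mono split: split_indicator)
    have B_le: "ennreal (norm B) \<le> (\<integral>\<^sup>+s. indicator {min y y'..max y y'} s * ennreal (norm (f (s + e) - f s)) \<partial>lborel)"
      unfolding B_def by (rule order_trans[OF integral_norm_bound_ennreal[OF int2]])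
        (auto intro!: nn_integral_mono split: split_indicator)
    show ?thesis
      by (rule order_trans[OF le]) (intro add_mono A_le B_le)
  qed
  from this[of y y'] this[of y' y] show ?thesis
    by (cases "y \<le> y'") (auto simp: norm_minus_commute min.commute max.commute add.commute add.left_commute)
qed

section \<open>Planar flows whose first component increases\<close>

text \<open>The bounds on \<open>b\<close> are required at every point because the field is first
  corrected on a null set. For this reason the integral equation is assumed for almost every
  starting point only, whereas the speed bounds on \<open>X\<close> are closed conditions and can be
  had for all of them.\<close>

locale planar_flow =
  fixes b :: "real \<times> real \<Rightarrow> real \<times> real" and X :: "real \<Rightarrow> real \<times> real \<Rightarrow> real \<times> real"
    and T C M :: real
  assumes T_pos: "0 < T" and C_pos: "0 < C" and M_nonneg: "0 \<le> M"
    and b_meas [measurable]: "b \<in> borel_measurable borel"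
    and b_bound: "norm (b z) \<le> 2" and b_fst: "1 \<le> fst (b z)"
    and b_BV: "(\<integral>\<^sup>+z. norm (b (z + w) - b z) \<partial>lborel) \<le> ennreal (norm w * M)"
    and X_0: "X 0 x = x"
    and X_cont: "s \<in> {0..T} \<Longrightarrow> continuous_on UNIV (X s)"
    and X_lip: "s \<in> {0..T} \<Longrightarrow> t \<in> {0..T} \<Longrightarrow> norm (X t x - X s x) \<le> 2 * \<bar>t - s\<bar>"
    and X_fst: "0 \<le> s \<Longrightarrow> s \<le> t \<Longrightarrow> t \<le> T \<Longrightarrow> t - s \<le> fst (X t x) - fst (X s x)"
    and X_ode: "AE x in lborel. \<forall>t\<in>{0..T}. X t x - x = (LINT s:{0..t}|lborel. b (X s x))"
    and X_area: "s \<in> {0..T} \<Longrightarrow> A \<in> sets borel \<Longrightarrow>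
          emeasure lborel (X s -` A) \<le> ennreal C * emeasure lborel A"
begin

text \<open>Prolonging each trajectory by horizontal motion of unit speed outside \<open>[0, T]\<close> makes it cross
  every vertical line exactly once: the line at \<open>h\<close> at time \<open>tau x h\<close> and height \<open>Y x h\<close>.\<close>

definition clamp_time :: "real \<Rightarrow> real" where
  "clamp_time s = max 0 (min T s)"

definition F :: "real \<Rightarrow> real \<times> real \<Rightarrow> real \<times> real" where
  "F s x = X (clamp_time s) x + (s - clamp_time s, 0)"

lemma clamp_time_in: "clamp_time s \<in> {0..T}"
  using T_pos by (auto simp: clamp_time_def)

lemma clamp_time_eq: "s \<in> {0..T} \<Longrightarrow> clamp_time s = s"
  by (auto simp: clamp_time_def)

lemma clamp_time_mono: "s \<le> t \<Longrightarrow> clamp_time s \<le> clamp_time t \<and> clamp_time t - clamp_time s \<le> t - s"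
  by (auto simp: clamp_time_def)

lemma F_eq: "s \<in> {0..T} \<Longrightarrow> F s x = X s x"
  by (simp add: F_def clamp_time_eq prod_eq_iff)

lemma F_0 [simp]: "F 0 x = x"
  using T_pos by (simp add: F_eq X_0)

lemma F_lip: "norm (F t x - F s x) \<le> 2 * \<bar>t - s\<bar>"
proof -
  have *: "norm (F t x - F s x) \<le> 2 * (t - s)" if "s \<le> t" for s t
  proof -
    have "F t x - F s x = (X (clamp_time t) x - X (clamp_time s) x)
        + ((t - s) - (clamp_time t - clamp_time s), 0)"
      by (simp add: F_def prod_eq_iff)
    then have "norm (F t x - F s x) \<le> norm (X (clamp_time t) x - X (clamp_time s) x)
       + norm ((t - s) - (clamp_time t - clamp_time s), 0::real)"
      by (metis norm_triangle_ineq)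
    also have "\<dots> \<le> 2 * (clamp_time t - clamp_time s) + ((t - s) - (clamp_time t - clamp_time s))"
      using X_lip[OF clamp_time_in[of s] clamp_time_in[of t], of x] clamp_time_mono[OF that]
      by (auto simp: norm_Pair)
    also have "\<dots> \<le> 2 * (t - s)" using clamp_time_mono[OF that] by simp
    finally show ?thesis .
  qed
  show ?thesis using *[of s t] *[of t s] by (cases "s \<le> t") (auto simp: norm_minus_commute)
qed

lemma F_fst: "s \<le> t \<Longrightarrow> t - s \<le> fst (F t x) - fst (F s x)"
  using X_fst[of "clamp_time s" "clamp_time t" x] clamp_time_in[of s] clamp_time_in[of t]
    clamp_time_mono[of s t] by (auto simp: F_def)

lemma F_fst_upper: "\<bar>fst (F t x) - fst (F s x)\<bar> \<le> 2 * \<bar>t - s\<bar>"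
  using F_lip[of t x s] abs_fst_le_norm[of "F t x - F s x"] by simp

lemma F_snd_upper: "\<bar>snd (F t x) - snd (F s x)\<bar> \<le> 2 * \<bar>t - s\<bar>"
  using F_lip[of t x s] abs_snd_le_norm[of "F t x - F s x"] by simp

lemma F_fst_abs: "\<bar>t - s\<bar> \<le> \<bar>fst (F t x) - fst (F s x)\<bar>"
  using F_fst[of s t x] F_fst[of t s x] by linarith

lemma F_cont: "continuous_on UNIV (F s)"
  unfolding F_def by (intro continuous_intros X_cont clamp_time_in)

text \<open>Continuity in \<open>x\<close> at fixed time is combined with a Lipschitz bound in time
  that is uniform in \<open>x\<close>.\<close>

lemma F_cont2: "continuous_on UNIV (\<lambda>p. F (fst p) (snd p))"
proof -
  have "isCont (\<lambda>p. F (fst p) (snd p)) (s, x)" for s x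
    unfolding isCont_def
  proof (rule Lim_transform2)
    have "isCont (F s) x"
      using F_cont[of s] continuous_on_eq_continuous_at open_UNIV by blast
    moreover have "(snd \<longlongrightarrow> x) (at (s, x))" by (auto intro!: tendsto_eq_intros)
    ultimately show "((\<lambda>p. F s (snd p)) \<longlongrightarrow> F (fst (s,x)) (snd (s,x))) (at (s, x))"
      by (simp add: isCont_tendsto_compose)
    have "((\<lambda>p. 2 * \<bar>s - fst p\<bar>) \<longlongrightarrow> 0) (at (s, x))"
      by (auto intro!: tendsto_eq_intros)
    then show "((\<lambda>p. F s (snd p) - F (fst p) (snd p)) \<longlongrightarrow> 0) (at (s, x))"
      by (rule Lim_null_comparison[rotated]) (auto intro!: always_eventually F_lip)
  qed
  then show ?thesis by (auto simp: continuous_on_eq_continuous_at)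
qed

lemma F_meas [measurable (raw)]:
  "f \<in> borel_measurable N \<Longrightarrow> g \<in> borel_measurable N \<Longrightarrow> (\<lambda>y. F (f y) (g y)) \<in> borel_measurable N"
  using borel_measurable_continuous_Pair[OF _ _ F_cont2, of f N g] by auto

lemma ex1_crossing: "\<exists>!s. fst (F s x) = h"
proof -
  define u where "u = \<bar>h - fst (F 0 x)\<bar>"
  have "\<exists>s\<ge>-u. s \<le> u \<and> fst (F s x) = h"
  proof (rule IVT')
    show "fst (F (-u) x) \<le> h" "h \<le> fst (F u x)"
      using F_fst[of "-u" 0 x] F_fst[of 0 u x] by (auto simp: u_def)
    show "continuous_on {-u..u} (\<lambda>s. fst (F s x))"
      by (intro continuous_on_fst continuous_on_compose2[OF F_cont2, of _ "\<lambda>s. (s, x)", simplified] continuous_intros)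
    show "-u \<le> u" by (auto simp: u_def)
  qed
  moreover have "s = t" if "fst (F s x) = h" "fst (F t x) = h" for s t
    using F_fst_abs[of s t x] that by simp
  ultimately show ?thesis by blast
qed

definition tau :: "real \<times> real \<Rightarrow> real \<Rightarrow> real" where
  "tau x h = (THE s. fst (F s x) = h)"

definition Y :: "real \<times> real \<Rightarrow> real \<Rightarrow> real" where
  "Y x h = snd (F (tau x h) x)"

lemma fst_F_tau [simp]: "fst (F (tau x h) x) = h"
  unfolding tau_def by (rule theI'[OF ex1_crossing])

lemma tau_F [simp]: "tau x (fst (F s x)) = s"
  by (metis ex1_crossing fst_F_tau)

lemma Y_F [simp]: "Y x (fst (F s x)) = snd (F s x)"
  by (simp add: Y_def)

lemma tau_start [simp]: "tau x (fst x) = 0"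
  using tau_F[of x 0] by simp

lemma Y_start [simp]: "Y x (fst x) = snd x"
  using Y_F[of x 0] by simp

lemma F_tau: "F (tau x h) x = (h, Y x h)"
  by (simp add: prod_eq_iff Y_def)

lemma tau_diff: "h \<le> k \<Longrightarrow> (k - h) / 2 \<le> tau x k - tau x h \<and> tau x k - tau x h \<le> k - h"
proof -
  assume "h \<le> k"
  then show ?thesis
    using F_fst[of "tau x k" "tau x h" x] F_fst[of "tau x h" "tau x k" x]
      F_fst_upper[of "tau x k" x "tau x h"]
    by (cases "tau x h \<le> tau x k") (simp_all add: abs_if split: if_splits)
qed

lemma tau_lip: "\<bar>tau x k - tau x h\<bar> \<le> \<bar>k - h\<bar>"
  using F_fst_abs[of "tau x k" "tau x h" x] by simp

lemma tau_mono: "tau x h \<le> tau x k \<longleftrightarrow> h \<le> k"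
  using tau_diff[of h k x] tau_diff[of k h x] by (cases "h \<le> k") auto

lemma Y_lip: "\<bar>Y x k - Y x h\<bar> \<le> 2 * \<bar>k - h\<bar>"
  using F_snd_upper[of "tau x k" x "tau x h"] tau_lip[of x k h] by (simp add: Y_def)

lemma tau_nonneg_iff: "0 \<le> tau x h \<longleftrightarrow> fst x \<le> h"
  using tau_mono[of x "fst x" h] by simp

lemma tau_le_iff: "tau x h \<le> t \<longleftrightarrow> h \<le> fst (F t x)"
  using tau_mono[of x h "fst (F t x)"] by simp

lemma tau_cont2: "continuous_on UNIV (\<lambda>p. tau (fst p) (snd p))"
proof -
  have "isCont (\<lambda>p. tau (fst p) (snd p)) (x, h)" for x h
    unfolding isCont_def
  proof (rule LIM_zero_cancel)
    \<comment> \<open>The horizontal distance from the line \<open>snd p\<close> at which the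
      trajectory of \<open>fst p\<close> stands at the old crossing time. As the horizontal speed is
      at least 1, it bounds the change of the crossing time.\<close>
    let ?e = "\<lambda>p. \<bar>snd p - fst (F (tau x h) (fst p))\<bar>"
    have "((\<lambda>p. F (tau x h) (fst p)) \<longlongrightarrow> F (tau x h) x) (at (x, h))"
    proof (rule isCont_tendsto_compose[where g="F (tau x h)"])
      show "isCont (F (tau x h)) x"
        using F_cont[of "tau x h"] continuous_on_eq_continuous_at open_UNIV by blast
    qed (auto intro!: tendsto_eq_intros)
    then have "(?e \<longlongrightarrow> \<bar>h - fst (F (tau x h) x)\<bar>) (at (x, h))"
      by (auto intro!: tendsto_eq_intros)
    then have "(?e \<longlongrightarrow> 0) (at (x, h))" by simp
    then show "((\<lambda>p. tau (fst p) (snd p) - tau (fst (x, h)) (snd (x, h))) \<longlongrightarrow> 0) (at (x, h))"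
    proof (rule Lim_null_comparison[rotated], intro always_eventually allI)
      fix p show "norm (tau (fst p) (snd p) - tau (fst (x, h)) (snd (x, h))) \<le> ?e p"
        using F_fst_abs[of "tau (fst p) (snd p)" "tau x h" "fst p"] by simp
    qed
  qed
  then show ?thesis by (auto simp: continuous_on_eq_continuous_at)
qed

lemma tau_meas [measurable (raw)]:
  "f \<in> borel_measurable N \<Longrightarrow> g \<in> borel_measurable N \<Longrightarrow> (\<lambda>y. tau (f y) (g y)) \<in> borel_measurable N"
  using borel_measurable_continuous_Pair[OF _ _ tau_cont2, of f N g] by auto

lemma Y_meas [measurable (raw)]:
  "f \<in> borel_measurable N \<Longrightarrow> g \<in> borel_measurable N \<Longrightarrow> (\<lambda>y. Y (f y) (g y)) \<in> borel_measurable N"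
  unfolding Y_def
  by (rule borel_measurable_continuous_on[where f=snd]) (intro continuous_intros F_meas tau_meas)+

lemma Y_cont2: "continuous_on UNIV (\<lambda>p. Y (fst p) (snd p))"
  unfolding Y_def
  by (intro continuous_on_snd continuous_on_compose2[OF F_cont2, of _ "\<lambda>p. (tau (fst p) (snd p), fst p)", simplified]
     tau_cont2 continuous_intros)

section \<open>Density of trajectories on a vertical line\<close>

text \<open>A trajectory of speed at most 2 that meets the line at \<open>h\<close> during
  \<open>[0, T]\<close> at a height in \<open>U\<close> spends at least the time \<open>e\<close> in
  the strip of half-width \<open>2 * e\<close> over \<open>U\<close>, once \<open>e\<close> is
  small. The strip has \<open>4 * e\<close> times the measure of \<open>U\<close>, so integrating
  the area bound over time and dividing by \<open>e\<close> gives the factor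
  \<open>4 * T * C\<close>, independent of \<open>e\<close>. Fatou's lemma lets \<open>e\<close>
  tend to \<open>0\<close>.\<close>

lemma line_density_open:
  assumes U: "open U"
  shows "emeasure lborel {x. 0 \<le> tau x h \<and> tau x h \<le> T \<and> Y x h \<in> U} \<le> ennreal (4 * T * C) * emeasure lborel U"
proof -
  let ?S = "{x. 0 \<le> tau x h \<and> tau x h \<le> T \<and> Y x h \<in> U}"
  have [measurable]: "U \<in> sets borel" using U by simp
  define e where "e n = T / (2 * real (Suc n))" for n
  have e_pos: "0 < e n" and e_le: "e n \<le> T / 2" for n
    using T_pos by (auto simp: e_def field_simps)
  have e_lim: "e \<longlonglongrightarrow> 0"
    unfolding e_def using LIMSEQ_Suc[OF lim_const_over_n[of "T/2"]] by simp
  define B where "B n = {h - 2 * e n .. h + 2 * e n} \<times> U" for n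
  have B_meas [measurable]: "B n \<in> sets borel" for n
    unfolding B_def borel_prod[symmetric] by simp
  have B_em: "emeasure lborel (B n) = ennreal (4 * e n) * emeasure lborel U" for n
    unfolding B_def lborel_prod[symmetric] using e_pos[of n]
    by (subst lborel.emeasure_pair_measure_Times) auto
  define g where "g n x = ennreal (1 / e n) * (\<integral>\<^sup>+s. indicator {0..T} s * indicator (B n) (F s x) \<partial>lborel)" for n x
  have [measurable]: "g n \<in> borel_measurable lborel" for n
    unfolding g_def by measurable
  have g_int: "(\<integral>\<^sup>+x. g n x \<partial>lborel) \<le> ennreal (4 * T * C) * emeasure lborel U" for n
  proof -
    have "(\<integral>\<^sup>+x. g n x \<partial>lborel) =
       ennreal (1 / e n) * (\<integral>\<^sup>+x. (\<integral>\<^sup>+s. indicator {0..T} s * indicator (B n) (F s x) \<partial>lborel) \<partial>lborel)"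
      unfolding g_def by (rule nn_integral_cmult) measurable
    also have "(\<integral>\<^sup>+x. (\<integral>\<^sup>+s. indicator {0..T} s * indicator (B n) (F s x) \<partial>lborel) \<partial>lborel)
      = (\<integral>\<^sup>+s. (\<integral>\<^sup>+x. indicator {0..T} s * indicator (B n) (F s x) \<partial>lborel) \<partial>lborel)"
      by (rule pair_sigma_finite.Fubini') (auto simp: pair_sigma_finite_def sigma_finite_lborel)
    also have "\<dots> \<le> (\<integral>\<^sup>+s. ennreal C * emeasure lborel (B n) * indicator {0..T} s \<partial>lborel)"
    proof (rule nn_integral_mono)
      fix s :: real
      show "(\<integral>\<^sup>+x. indicator {0..T} s * indicator (B n) (F s x) \<partial>lborel) \<le> ennreal C * emeasure lborel (B n) * indicator {0..T} s"
      proof (cases "s \<in> {0..T}")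
        case True
        have "X s -` B n \<in> sets borel"
          using measurable_sets_borel[OF borel_measurable_continuous_onI[OF X_cont[OF True]] B_meas[of n]] by simp
        then have "(\<integral>\<^sup>+x. indicator {0..T} s * indicator (B n) (F s x) \<partial>lborel) = emeasure lborel (X s -` B n)"
          using True by (simp add: F_eq flip: nn_integral_indicator) (simp add: indicator_def)
        then show ?thesis using X_area[OF True B_meas[of n]] True by simp
      qed simp
    qed
    also have "\<dots> = ennreal C * emeasure lborel (B n) * ennreal T"
      using T_pos by (subst nn_integral_cmult_indicator) auto
    finally have "(\<integral>\<^sup>+x. g n x \<partial>lborel) \<le> ennreal (1 / e n) * (ennreal C * emeasure lborel (B n) * ennreal T)"
      by (simp add: mult_left_mono)
    also have "\<dots> = ennreal (1 / e n) * ennreal (4 * e n) * ennreal (T * C) * emeasure lborel U"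
      using T_pos C_pos by (simp add: B_em ennreal_mult mult_ac)
    also have "ennreal (1 / e n) * ennreal (4 * e n) = 4"
      using e_pos[of n] by (simp add: ennreal_mult[symmetric])
    also have "4 * ennreal (T * C) = ennreal (4 * T * C)"
      using T_pos C_pos by (simp add: ennreal_mult mult_ac)
    finally show ?thesis .
  qed
  have S_le: "indicator ?S x \<le> liminf (\<lambda>n. g n x)" for x
  proof (cases "x \<in> ?S")
    case True
    then obtain r where r: "0 < r" "ball (Y x h) r \<subseteq> U"
      using U open_contains_ball by blast
    have "\<forall>\<^sub>F n in sequentially. e n < r / 2"
      using order_tendstoD(2)[OF e_lim, of "r/2"] r by simp
    then have "\<forall>\<^sub>F n in sequentially. 1 \<le> g n x"
    proof (rule eventually_mono)
      fix n assume n: "e n < r / 2"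
      \<comment> \<open>The time window lies on the side of the crossing time that stays inside
        \<open>[0, T]\<close>, where the area bound is available; \<open>e n <= T / 2\<close> makes
        room for it.\<close>
      define I where "I = (if tau x h \<le> T / 2 then {tau x h .. tau x h + e n} else {tau x h - e n .. tau x h})"
      have I: "I \<subseteq> {0..T}" "emeasure lborel I = e n" "\<And>s. s \<in> I \<Longrightarrow> \<bar>s - tau x h\<bar> \<le> e n" "I \<in> sets borel"
        using True e_pos[of n] e_le[of n] by (auto simp: I_def split: if_splits)
      have "ennreal (e n) = (\<integral>\<^sup>+s. indicator I s \<partial>lborel)" using I by simp
      also have "\<dots> \<le> (\<integral>\<^sup>+s. indicator {0..T} s * indicator (B n) (F s x) \<partial>lborel)"
      proof (rule nn_integral_mono)
        fix s
        show "indicator I s \<le> (indicator {0..T} s * indicator (B n) (F s x) :: ennreal)"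
        proof (cases "s \<in> I")
          case sI: True
          have "\<bar>fst (F s x) - h\<bar> \<le> 2 * e n" "\<bar>snd (F s x) - Y x h\<bar> \<le> 2 * e n"
            using F_fst_upper[of s x "tau x h"] F_snd_upper[of s x "tau x h"] I(3)[OF sI]
            by (auto simp: F_tau)
          then have "fst (F s x) \<in> {h - 2 * e n .. h + 2 * e n}" "snd (F s x) \<in> ball (Y x h) r"
            using n by (auto simp: dist_real_def)
          then have "F s x \<in> B n" using r by (auto simp: B_def mem_Times_iff)
          then show ?thesis using sI I(1) by (auto split: split_indicator)
        qed simp
      qed
      finally have "ennreal (1 / e n) * ennreal (e n) \<le> g n x"
        unfolding g_def by (intro mult_left_mono) auto
      then show "1 \<le> g n x" using e_pos[of n] by (simp add: ennreal_mult[symmetric])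
    qed
    then have "1 \<le> liminf (\<lambda>n. g n x)" by (rule Liminf_bounded)
    then show ?thesis using True by simp
  qed simp
  have "emeasure lborel ?S = (\<integral>\<^sup>+x. indicator ?S x \<partial>lborel)"
    by (rule nn_integral_indicator[symmetric]) measurable
  also have "\<dots> \<le> (\<integral>\<^sup>+x. liminf (\<lambda>n. g n x) \<partial>lborel)"
    by (intro nn_integral_mono S_le)
  also have "\<dots> \<le> liminf (\<lambda>n. \<integral>\<^sup>+x. g n x \<partial>lborel)"
    by (rule nn_integral_liminf) measurable
  also have "\<dots> \<le> ennreal (4 * T * C) * emeasure lborel U"
    by (rule order_trans[OF Liminf_mono[where g = "\<lambda>_. ennreal (4 * T * C) * emeasure lborel U"]])
       (auto simp: g_int Liminf_const)
  finally show ?thesis .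
qed

text \<open>Outer regularity reduces the claim to an open superset whose excess measure is as small
  as desired.\<close>

lemma line_density_borel:
  assumes A [measurable]: "A \<in> sets borel"
  shows "emeasure lborel {x. 0 \<le> tau x h \<and> tau x h \<le> T \<and> Y x h \<in> A} \<le> ennreal (4 * T * C) * emeasure lborel A"
proof (cases "emeasure lborel A = \<infinity>")
  case True
  then show ?thesis using T_pos C_pos by (simp add: ennreal_mult_top)
next
  case False
  show ?thesis
  proof (rule ennreal_le_epsilon)
    fix e :: real assume e: "0 < e"
    define d where "d = e / (4 * T * C)"
    have d: "0 < d" using e T_pos C_pos by (simp add: d_def)
    obtain U where U: "open U" "A \<subseteq> U" "emeasure lborel (U - A) < d"
      using outer_regular_lborel[OF A d] .
    have [measurable]: "U \<in> sets borel" using U by simp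
    have "emeasure lborel {x. 0 \<le> tau x h \<and> tau x h \<le> T \<and> Y x h \<in> A}
       \<le> emeasure lborel {x. 0 \<le> tau x h \<and> tau x h \<le> T \<and> Y x h \<in> U}"
      using U by (intro emeasure_mono) auto
    also have "\<dots> \<le> ennreal (4 * T * C) * emeasure lborel U" by (rule line_density_open[OF U(1)])
    also have "emeasure lborel U = emeasure lborel A + emeasure lborel (U - A)"
      using U by (subst plus_emeasure) (auto intro: arg_cong[where f="emeasure lborel"])
    also have "ennreal (4 * T * C) * \<dots> \<le> ennreal (4 * T * C) * (emeasure lborel A + ennreal d)"
      using U by (intro mult_left_mono add_left_mono) auto
    also have "\<dots> = ennreal (4 * T * C) * emeasure lborel A + ennreal e"
      using T_pos C_pos d by (simp add: distrib_left ennreal_mult[symmetric] d_def)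
    finally show "emeasure lborel {x. 0 \<le> tau x h \<and> tau x h \<le> T \<and> Y x h \<in> A} \<le>
      ennreal (4 * T * C) * emeasure lborel A + ennreal e" .
  qed
qed

lemma line_density:
  assumes f [measurable]: "f \<in> borel_measurable borel"
  shows "(\<integral>\<^sup>+x. indicator {0..T} (tau x h) * f (Y x h) \<partial>lborel) \<le> ennreal (4 * T * C) * (\<integral>\<^sup>+y. f y \<partial>lborel)"
proof -
  have Ym [measurable]: "(\<lambda>x. Y x h) \<in> borel_measurable borel" by measurable
  let ?N = "distr (density lborel (\<lambda>x. indicator {0..T} (tau x h))) borel (\<lambda>x. Y x h)"
  have "(\<integral>\<^sup>+x. indicator {0..T} (tau x h) * f (Y x h) \<partial>lborel) = (\<integral>\<^sup>+y. f y \<partial>?N)"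
    by (simp add: nn_integral_distr nn_integral_density)
  also have "\<dots> \<le> (\<integral>\<^sup>+y. f y \<partial>density lborel (\<lambda>_. ennreal (4 * T * C)))"
  proof (rule nn_integral_mono_measure)
    show "?N \<le> density lborel (\<lambda>_. ennreal (4 * T * C))"
    proof (subst le_measure)
      show "\<forall>A\<in>sets ?N. emeasure ?N A \<le> emeasure (density lborel (\<lambda>_. ennreal (4 * T * C))) A"
      proof
        fix A assume "A \<in> sets ?N"
        then have [measurable]: "A \<in> sets borel" by simp
        have "emeasure ?N A = emeasure (density lborel (\<lambda>x. indicator {0..T} (tau x h))) ((\<lambda>x. Y x h) -` A)"
          by (subst emeasure_distr) auto
        also have "\<dots> = (\<integral>\<^sup>+x. indicator {0..T} (tau x h) * indicator ((\<lambda>x. Y x h) -` A) x \<partial>lborel)"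
          using measurable_sets_borel[OF Ym, of A] by (intro emeasure_density) auto
        also have "\<dots> = (\<integral>\<^sup>+x. indicator {x. 0 \<le> tau x h \<and> tau x h \<le> T \<and> Y x h \<in> A} x \<partial>lborel)"
          by (intro nn_integral_cong) (auto split: split_indicator)
        also have "\<dots> = emeasure lborel {x. 0 \<le> tau x h \<and> tau x h \<le> T \<and> Y x h \<in> A}"
          by (rule nn_integral_indicator) measurable
        also have "\<dots> \<le> ennreal (4 * T * C) * emeasure lborel A" by (rule line_density_borel) simp
        also have "\<dots> = emeasure (density lborel (\<lambda>_. ennreal (4 * T * C))) A"
          by (subst emeasure_density) (auto simp: nn_integral_cmult_indicator)
        finally show "emeasure ?N A \<le> emeasure (density lborel (\<lambda>_. ennreal (4 * T * C))) A" .
      qed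
    qed simp
  qed simp
  also have "\<dots> = ennreal (4 * T * C) * (\<integral>\<^sup>+y. f y \<partial>lborel)"
    by (subst nn_integral_density) (auto intro: nn_integral_cmult)
  finally show ?thesis .
qed

lemma AE_avoids_point: "AE x in lborel. \<not> (0 \<le> tau x h \<and> tau x h \<le> T \<and> Y x h = y)"
proof (rule AE_I')
  have "emeasure lborel {x. 0 \<le> tau x h \<and> tau x h \<le> T \<and> Y x h \<in> {y}} \<le> 0"
    using line_density_borel[of "{y}" h] by simp
  moreover have "{x. 0 \<le> tau x h \<and> tau x h \<le> T \<and> Y x h \<in> {y}} \<in> sets lborel" by measurable
  ultimately show "{x. 0 \<le> tau x h \<and> tau x h \<le> T \<and> Y x h \<in> {y}} \<in> null_sets lborel"
    by (auto simp: null_sets_def)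
qed auto

section \<open>The equation of the graphs\<close>

definition good :: "real \<times> real \<Rightarrow> bool" where
  "good x \<longleftrightarrow> (\<forall>t\<in>{0..T}. X t x - x = (LINT s:{0..t}|lborel. b (X s x)))"

lemma AE_good: "AE x in lborel. good x"
  unfolding good_def by (rule X_ode)

lemma b_fst_abs: "\<bar>fst (b z)\<bar> \<le> 2" and b_snd_abs: "\<bar>snd (b z)\<bar> \<le> 2"
  using abs_fst_le_norm[of "b z"] abs_snd_le_norm[of "b z"] b_bound[of z] by auto

text \<open>In terms of \<open>h\<close> the trajectories solve the equation with right-hand side \<open>Gb\<close> for the pair
  \<open>(tau, Y)\<close>.\<close>

definition Gb :: "real \<times> real \<Rightarrow> real \<times> real" where
  "Gb z = (1 / fst (b z), snd (b z) / fst (b z))"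

lemma Gb_meas [measurable]: "Gb \<in> borel_measurable borel"
  unfolding Gb_def by measurable

lemma Gb_bound: "norm (Gb z) \<le> 3"
proof -
  have "\<bar>1 / fst (b z)\<bar> \<le> 1" "\<bar>snd (b z) / fst (b z)\<bar> \<le> 2"
    using b_fst[of z] b_snd_abs[of z] mult_left_mono[OF b_fst[of z], of 2] by (auto simp: abs_divide divide_le_eq)
  moreover have "norm (Gb z) \<le> \<bar>1 / fst (b z)\<bar> + \<bar>snd (b z) / fst (b z)\<bar>"
    unfolding Gb_def using norm_Pair_le[of "1 / fst (b z)" "snd (b z) / fst (b z)"] by simp
  ultimately show ?thesis by linarith
qed

text \<open>As \<open>fst b\<close> is at least 1 and \<open>snd b\<close> at most 2 in modulus, the
  difference of first components enters with weight \<open>1 + 2\<close> and that of second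
  components with weight 1; each is at most the norm.\<close>

lemma Gb_diff: "norm (Gb z - Gb w) \<le> 4 * norm (b z - b w)"
proof -
  let ?p = "fst (b z)" and ?q = "fst (b w)" and ?r = "snd (b z)" and ?s = "snd (b w)"
  have pq: "1 \<le> ?p" "1 \<le> ?q" "1 \<le> ?p * ?q" and s: "\<bar>?s\<bar> \<le> 2" "\<bar>?s\<bar> \<le> 2 * ?q"
    using b_fst[of z] b_fst[of w] b_snd_abs[of w] mult_mono[of 1 ?p 1 ?q] by auto
  have 1: "\<bar>1 / ?p - 1 / ?q\<bar> \<le> \<bar>?p - ?q\<bar>"
  proof -
    have "\<bar>1 / ?p - 1 / ?q\<bar> = \<bar>?p - ?q\<bar> / (?p * ?q)"
      using pq by (simp add: divide_simps abs_if split: if_splits)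
    also have "\<dots> \<le> \<bar>?p - ?q\<bar> / 1" using pq by (intro divide_left_mono) auto
    finally show ?thesis by simp
  qed
  have "?r / ?p - ?s / ?q = (?r - ?s) / ?p + ?s * (1 / ?p - 1 / ?q)"
    using pq by (simp add: field_simps)
  then have "\<bar>?r / ?p - ?s / ?q\<bar> \<le> \<bar>(?r - ?s) / ?p\<bar> + \<bar>?s\<bar> * \<bar>1 / ?p - 1 / ?q\<bar>"
    by (metis abs_mult abs_triangle_ineq)
  also have "\<dots> \<le> \<bar>?r - ?s\<bar> + 2 * \<bar>?p - ?q\<bar>"
  proof (rule add_mono)
    show "\<bar>(?r - ?s) / ?p\<bar> \<le> \<bar>?r - ?s\<bar>"
      using pq divide_left_mono[of 1 ?p "\<bar>?r - ?s\<bar>"] by (simp add: abs_divide)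
    show "\<bar>?s\<bar> * \<bar>1 / ?p - 1 / ?q\<bar> \<le> 2 * \<bar>?p - ?q\<bar>" using 1 s by (intro mult_mono) auto
  qed
  finally have 2: "\<bar>?r / ?p - ?s / ?q\<bar> \<le> \<bar>?r - ?s\<bar> + 2 * \<bar>?p - ?q\<bar>" .
  have "norm (Gb z - Gb w) \<le> \<bar>1 / ?p - 1 / ?q\<bar> + \<bar>?r / ?p - ?s / ?q\<bar>"
    unfolding Gb_def diff_Pair using norm_Pair_le[of "1 / ?p - 1 / ?q" "?r / ?p - ?s / ?q"] by simp
  also have "\<dots> \<le> 3 * \<bar>?p - ?q\<bar> + \<bar>?r - ?s\<bar>" using 1 2 by simp
  also have "\<dots> \<le> 4 * norm (b z - b w)"
    using abs_fst_le_norm[of "b z - b w"] abs_snd_le_norm[of "b z - b w"] by simp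
  finally show ?thesis .
qed

lemma b_F_integrable: "set_integrable lborel {s..t} (\<lambda>r. b (F r x))"
  by (rule set_integrable_bounded_Icc[where K=2]) (auto simp: b_bound)

lemma good_increment:
  assumes "good x" "0 \<le> s" "s \<le> t" "t \<le> T"
  shows "F t x - F s x = (LINT r:{s..t}|lborel. b (F r x))"
proof -
  have *: "F u x - x = (LINT r:{0..u}|lborel. b (F r x))" if "u \<in> {0..T}" for u
  proof -
    have "(LINT r:{0..u}|lborel. b (F r x)) = (LINT r:{0..u}|lborel. b (X r x))"
      using that by (intro set_lebesgue_integral_cong) (auto simp: F_eq)
    then show ?thesis using assms(1) that unfolding good_def by (simp add: F_eq)
  qed
  have "F t x - F s x = (F t x - x) - (F s x - x)" by simp
  also have "\<dots> = (LINT r:{s..t}|lborel. b (F r x))"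
    using *[of s] *[of t] assms set_integral_Icc_diff[OF b_F_integrable, of 0 s t x] by simp
  finally show ?thesis .
qed

lemma fst_F_increment:
  assumes "good x" "0 \<le> s" "s \<le> t" "t \<le> T"
  shows "fst (F t x) - fst (F s x) = (LINT r:{s..t}|lborel. fst (b (F r x)))"
  using arg_cong[OF good_increment[OF assms], of fst] by (simp add: set_lebesgue_integral_fst b_F_integrable)

lemma snd_F_increment:
  assumes "good x" "0 \<le> s" "s \<le> t" "t \<le> T"
  shows "snd (F t x) - snd (F s x) = (LINT r:{s..t}|lborel. snd (b (F r x)))"
  using arg_cong[OF good_increment[OF assms], of snd] by (simp add: set_lebesgue_integral_snd b_F_integrable)

text \<open>The derivative of \<open>h\<close> with respect to time, by which the Lebesgue measure in \<open>h\<close> is pulled back.\<close>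

definition speed :: "real \<times> real \<Rightarrow> real \<Rightarrow> real" where
  "speed x s = (if s \<in> {0..T} then fst (b (F s x)) else 1)"

lemma speed_meas [measurable]: "speed x \<in> borel_measurable borel"
  unfolding speed_def by measurable

text \<open>The identity is additive over adjacent intervals, so it suffices to check it before
  \<open>0\<close>, inside \<open>[0, T]\<close> and after \<open>T\<close>; in the outer ranges the
  prolonged trajectory has horizontal speed 1.\<close>

lemma nn_integral_speed:
  assumes x: "good x" and "s \<le> t"
  shows "(\<integral>\<^sup>+r. ennreal (speed x r) * indicator {s..t} r \<partial>lborel) = ennreal (fst (F t x) - fst (F s x))"
proof -
  define P where "P s t \<longleftrightarrow> (\<integral>\<^sup>+r. ennreal (speed x r) * indicator {s..t} r \<partial>lborel) = ennreal (fst (F t x) - fst (F s x))" for s t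
  have P_refl: "P s s" for s
  proof -
    have "(\<integral>\<^sup>+r. ennreal (speed x r) * indicator {s..s} r \<partial>lborel) = (\<integral>\<^sup>+r. 0 \<partial>(lborel::real measure))"
      by (rule nn_integral_cong_AE, rule eventually_mono[OF AE_lborel_singleton[of s]]) auto
    then show ?thesis by (simp add: P_def)
  qed
  have P_trans: "P s u" if "P s t" "P t u" "s \<le> t" "t \<le> u" for s t u
  proof -
    have "(\<integral>\<^sup>+r. ennreal (speed x r) * indicator {s..u} r \<partial>lborel)
      = (\<integral>\<^sup>+r. ennreal (speed x r) * indicator {s..t} r + ennreal (speed x r) * indicator {t..u} r \<partial>lborel)"
      by (rule nn_integral_cong_AE) (use that AE_lborel_singleton[of t] in \<open>auto split: split_indicator elim!: eventually_mono\<close>)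
    also have "\<dots> = ennreal (fst (F t x) - fst (F s x)) + ennreal (fst (F u x) - fst (F t x))"
      using that(1,2) unfolding P_def by (subst nn_integral_add) auto
    also have "\<dots> = ennreal (fst (F u x) - fst (F s x))"
      using F_fst[of s t x] F_fst[of t u x] that by (subst ennreal_plus[symmetric]) auto
    finally show ?thesis by (simp add: P_def)
  qed
  have P_out: "P s t" if "s \<le> t" "t \<le> 0 \<or> T \<le> s" for s t
  proof -
    have "(\<integral>\<^sup>+r. ennreal (speed x r) * indicator {s..t} r \<partial>lborel) = (\<integral>\<^sup>+r. indicator {s..t} r \<partial>lborel)"
      using that T_pos AE_lborel_singleton[of 0] AE_lborel_singleton[of T]
      by (intro nn_integral_cong_AE) (auto simp: speed_def split: split_indicator elim!: eventually_elim2)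
    also have "\<dots> = ennreal (t - s)" using that by simp
    also have "t - s = fst (F t x) - fst (F s x)"
      using that T_pos by (auto simp: F_def clamp_time_def)
    finally show ?thesis by (simp add: P_def)
  qed
  have P_in: "P s t" if "0 \<le> s" "s \<le> t" "t \<le> T" for s t
  proof -
    have "(\<integral>\<^sup>+r. ennreal (speed x r) * indicator {s..t} r \<partial>lborel) = (\<integral>\<^sup>+r. ennreal (indicator {s..t} r *\<^sub>R fst (b (F r x))) \<partial>lborel)"
      using that by (intro nn_integral_cong) (auto simp: speed_def split: split_indicator)
    also have "\<dots> = ennreal (LINT r:{s..t}|lborel. fst (b (F r x)))"
      unfolding set_lebesgue_integral_def
    proof (rule nn_integral_eq_integral)
      show "integrable lborel (\<lambda>r. indicator {s..t} r *\<^sub>R fst (b (F r x)))"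
        using set_integrable_bounded_Icc[of "\<lambda>r. fst (b (F r x))" 2 s t]
        by (simp add: set_integrable_def b_fst_abs)
      show "AE r in lborel. 0 \<le> indicator {s..t} r *\<^sub>R fst (b (F r x))"
        by (auto simp: order_trans[OF zero_le_one b_fst])
    qed
    finally show ?thesis using fst_F_increment[OF x that] by (simp add: P_def)
  qed
  define p where "p = max s (min t 0)"
  define q where "q = max p (min t T)"
  have ord: "s \<le> p" "p \<le> q" "q \<le> t" using assms(2) by (auto simp: p_def q_def)
  have "s = p \<or> p \<le> 0" "p = q \<or> 0 \<le> p \<and> q \<le> T" "q = t \<or> T \<le> q"
    using assms(2) T_pos by (auto simp: p_def q_def max_def min_def)
  then have "P s p" "P p q" "P q t"
    using P_refl P_out P_in ord by metis+
  then have "P s t" using P_trans ord by (meson order_trans)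
  then show ?thesis by (simp add: P_def)
qed

text \<open>The substitution \<open>h = fst (F s x)\<close>. Since the first coordinate increases
  strictly, an interval in \<open>h\<close> pulls back to an interval of times, on which
  \<open>speed\<close> integrates to the gain in \<open>h\<close>. Thanks to the prolongation this
  is an identity of measures on the whole line.\<close>

lemma lborel_eq_distr:
  assumes x: "good x"
  shows "distr (density lborel (\<lambda>s. ennreal (speed x s))) borel (\<lambda>s. fst (F s x)) = lborel"
proof (rule lborel_eqI[symmetric])
  fix l u :: real assume lu: "\<And>b. b \<in> Basis \<Longrightarrow> l \<bullet> b \<le> u \<bullet> b"
  then have lu: "l \<le> u" by simp
  have [measurable]: "(\<lambda>s. fst (F s x)) \<in> borel_measurable borel" by measurable
  have eq: "(\<lambda>s. fst (F s x)) -` {l<..<u} = {tau x l<..<tau x u}"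
    using tau_mono[of x l] tau_mono[of x _ u] tau_mono[of x u] tau_mono[of x _ l]
    by (auto simp: not_le[symmetric]) (metis fst_F_tau tau_F)+
  have "emeasure (distr (density lborel (\<lambda>s. ennreal (speed x s))) borel (\<lambda>s. fst (F s x))) (box l u)
     = emeasure (density lborel (\<lambda>s. ennreal (speed x s))) {tau x l<..<tau x u}"
    by (subst emeasure_distr) (auto simp: box_real eq)
  also have "\<dots> = (\<integral>\<^sup>+s. ennreal (speed x s) * indicator {tau x l<..<tau x u} s \<partial>lborel)"
    by (subst emeasure_density) auto
  also have "\<dots> = (\<integral>\<^sup>+s. ennreal (speed x s) * indicator {tau x l..tau x u} s \<partial>lborel)"
    using AE_lborel_singleton[of "tau x l"] AE_lborel_singleton[of "tau x u"]
    by (intro nn_integral_cong_AE) (auto split: split_indicator elim!: eventually_elim2)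
  also have "\<dots> = ennreal (u - l)"
    using lu tau_mono[of x l u] by (subst nn_integral_speed[OF x]) auto
  finally show "emeasure (distr (density lborel (\<lambda>s. ennreal (speed x s))) borel (\<lambda>s. fst (F s x))) (box l u)
    = ennreal (\<Prod>b\<in>Basis. (u - l) \<bullet> b)" by simp
qed simp

text \<open>In the substitution the factor \<open>speed\<close> cancels the denominators of
  \<open>Gb\<close> and leaves the time integrand \<open>(1, snd (b (F s x)))\<close>.\<close>

lemma curve_equation:
  assumes x: "good x" and h: "0 \<le> tau x h0" "h0 \<le> h1" "tau x h1 \<le> T"
  shows "(tau x h1 - tau x h0, Y x h1 - Y x h0) = (LINT h:{h0..h1}|lborel. Gb (h, Y x h))"
proof -
  let ?s = "tau x h0" and ?t = "tau x h1"
  have st: "?s \<le> ?t" using h by (simp add: tau_mono)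
  have [measurable]: "(\<lambda>s. fst (F s x)) \<in> borel_measurable borel" by measurable
  have iff: "fst (F s x) \<in> {h0..h1} \<longleftrightarrow> s \<in> {?s..?t}" for s
    using tau_mono[of x h0 "fst (F s x)"] tau_mono[of x "fst (F s x)" h1] by simp
  have "(LINT h:{h0..h1}|lborel. Gb (h, Y x h))
     = (LINT h|distr (density lborel (\<lambda>s. ennreal (speed x s))) borel (\<lambda>s. fst (F s x)). indicator {h0..h1} h *\<^sub>R Gb (h, Y x h))"
    unfolding lborel_eq_distr[OF x] set_lebesgue_integral_def ..
  also have "\<dots> = (LINT s|density lborel (\<lambda>s. ennreal (speed x s)). indicator {h0..h1} (fst (F s x)) *\<^sub>R Gb (F s x))"
    by (subst integral_distr) (auto simp: case_prod_unfold)
  also have "\<dots> = (LINT s|lborel. speed x s *\<^sub>R (indicator {h0..h1} (fst (F s x)) *\<^sub>R Gb (F s x)))"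
    by (rule integral_density) (auto simp: speed_def order_trans[OF zero_le_one b_fst])
  also have "\<dots> = (LINT s:{?s..?t}|lborel. (1::real, snd (b (F s x))))"
    unfolding set_lebesgue_integral_def
  proof (rule Bochner_Integration.integral_cong[OF refl])
    fix s
    show "speed x s *\<^sub>R (indicator {h0..h1} (fst (F s x)) *\<^sub>R Gb (F s x)) = indicator {?s..?t} s *\<^sub>R (1::real, snd (b (F s x)))"
      using iff[of s] h b_fst[of "F s x"] by (auto simp: speed_def Gb_def split: split_indicator)
  qed
  finally have eq: "(LINT h:{h0..h1}|lborel. Gb (h, Y x h)) = (LINT s:{?s..?t}|lborel. (1::real, snd (b (F s x))))" .
  have int: "set_integrable lborel {?s..?t} (\<lambda>s. (1::real, snd (b (F s x))))"
    by (rule set_integrable_bounded_Icc[where K = 3])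
       (auto intro!: order_trans[OF norm_Pair_le] b_snd_abs)
  have one: "(LINT s:{?s..?t}|lborel. (1::real)) = ?t - ?s"
    using st by (simp add: set_lebesgue_integral_def)
  show ?thesis
    unfolding eq prod_eq_iff set_lebesgue_integral_fst[OF int] set_lebesgue_integral_snd[OF int]
    using snd_F_increment[OF x h(1) st h(3)] st one by (simp add: Y_def)
qed

section \<open>Preservation of the vertical order\<close>

text \<open>One factor \<open>e\<close> comes from the width \<open>2 * e\<close> of the slab, the
  other from the translation bound for vertical shifts of size at most \<open>e\<close>; the
  remaining 4 is the constant of \<open>Gb_diff\<close>.\<close>

lemma Gb_near_diagonal:
  assumes "0 \<le> e"
  shows "(\<integral>\<^sup>+h. (\<integral>\<^sup>+y. (\<integral>\<^sup>+y'. indicator {-e..e} (y' - y) * ennreal (norm (Gb (h, y') - Gb (h, y))) \<partial>lborel) \<partial>lborel) \<partial>lborel)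
    \<le> ennreal (8 * M * e\<^sup>2)"
proof -
  have "(\<integral>\<^sup>+h. (\<integral>\<^sup>+y. (\<integral>\<^sup>+y'. indicator {-e..e} (y' - y) * ennreal (norm (Gb (h, y') - Gb (h, y))) \<partial>lborel) \<partial>lborel) \<partial>lborel)
    = (\<integral>\<^sup>+h. (\<integral>\<^sup>+y. (\<integral>\<^sup>+w. indicator {-e..e} w * ennreal (norm (Gb (h, w + y) - Gb (h, y))) \<partial>lborel) \<partial>lborel) \<partial>lborel)"
  proof (rule nn_integral_cong, rule nn_integral_cong)
    fix h y :: real
    show "(\<integral>\<^sup>+y'. indicator {-e..e} (y' - y) * ennreal (norm (Gb (h, y') - Gb (h, y))) \<partial>lborel)
      = (\<integral>\<^sup>+w. indicator {-e..e} w * ennreal (norm (Gb (h, w + y) - Gb (h, y))) \<partial>lborel)"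
      using nn_integral_translate[of "\<lambda>y'. indicator {-e..e} (y' - y) * ennreal (norm (Gb (h, y') - Gb (h, y)))" y]
      by simp
  qed
  also have "\<dots> = (\<integral>\<^sup>+h. (\<integral>\<^sup>+w. (\<integral>\<^sup>+y. indicator {-e..e} w * ennreal (norm (Gb (h, w + y) - Gb (h, y))) \<partial>lborel) \<partial>lborel) \<partial>lborel)"
    by (subst nn_integral_swap_lborel) (auto simp: borel_prod[symmetric])
  also have "\<dots> = (\<integral>\<^sup>+w. (\<integral>\<^sup>+h. (\<integral>\<^sup>+y. indicator {-e..e} w * ennreal (norm (Gb (h, w + y) - Gb (h, y))) \<partial>lborel) \<partial>lborel) \<partial>lborel)"
    by (rule nn_integral_swap_lborel) measurable
  also have "\<dots> = (\<integral>\<^sup>+w. (\<integral>\<^sup>+z. indicator {-e..e} w * ennreal (norm (Gb (z + (0, w)) - Gb z)) \<partial>lborel) \<partial>lborel)"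
    by (subst nn_integral_plane[symmetric]) (auto simp: add.commute)
  also have "\<dots> \<le> (\<integral>\<^sup>+w. ennreal (4 * (e * M)) * indicator {-e..e} w \<partial>(lborel::real measure))"
  proof (rule nn_integral_mono)
    fix w :: real
    show "(\<integral>\<^sup>+z. indicator {-e..e} w * ennreal (norm (Gb (z + (0, w)) - Gb z)) \<partial>lborel) \<le> ennreal (4 * (e * M)) * indicator {-e..e} w"
    proof (cases "w \<in> {-e..e}")
      case True
      have "(\<integral>\<^sup>+z. ennreal (norm (Gb (z + (0, w)) - Gb z)) \<partial>lborel) \<le> (\<integral>\<^sup>+z. 4 * ennreal (norm (b (z + (0, w)) - b z)) \<partial>lborel)"
      proof (rule nn_integral_mono)
        fix z :: "real \<times> real"
        show "ennreal (norm (Gb (z + (0, w)) - Gb z)) \<le> 4 * ennreal (norm (b (z + (0, w)) - b z))"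
          using ennreal_leI[OF Gb_diff[of "z + (0, w)" z]] by (simp add: ennreal_mult')
      qed
      also have "\<dots> = 4 * (\<integral>\<^sup>+z. ennreal (norm (b (z + (0, w)) - b z)) \<partial>lborel)"
        by (rule nn_integral_cmult) measurable
      also have "\<dots> \<le> 4 * ennreal (norm (0::real, w) * M)" by (intro mult_left_mono b_BV) auto
      also have "\<dots> \<le> 4 * ennreal (e * M)" using True M_nonneg by (intro mult_left_mono ennreal_leI mult_right_mono) auto
      finally show ?thesis using True by (simp add: ennreal_mult')
    qed simp
  qed
  also have "\<dots> = ennreal (4 * (e * M)) * ennreal (2 * e)"
    using assms by (subst nn_integral_cmult_indicator) auto
  also have "\<dots> = ennreal (8 * M * e\<^sup>2)"
    using assms M_nonneg by (simp add: ennreal_mult[symmetric] power2_eq_square mult_ac)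
  finally show ?thesis .
qed

text \<open>Every crossing pair of graphs pays at least \<open>2 * e\<close> in the slab, while
  \<open>Gb_near_diagonal\<close> makes the total payment quadratic in \<open>e\<close>. The time
  indicators are kept because \<open>line_density\<close> counts only meetings with a line during
  \<open>[0, T]\<close>.\<close>

lemma good_pair_separation:
  assumes "good x" "good x'" and h: "h0 \<le> h1" "0 \<le> tau x h0" "tau x h1 \<le> T" "0 \<le> tau x' h0" "tau x' h1 \<le> T"
    and e: "0 < e" "e \<le> Y x' h0 - Y x h0" "Y x' h1 - Y x h1 \<le> - e"
  shows "ennreal (2 * e) \<le> (\<integral>\<^sup>+h. indicator {0..T} (tau x h) * (indicator {0..T} (tau x' h) *
     (indicator {-e..e} (Y x' h - Y x h) * ennreal (norm (Gb (h, Y x' h) - Gb (h, Y x h))))) \<partial>lborel)"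
proof -
  define w where "w h = snd (Gb (h, Y x' h)) - snd (Gb (h, Y x h))" for h
  have [measurable]: "(\<lambda>h. Gb (h, Y x h)) \<in> borel_measurable borel" for x
    by measurable
  have int: "set_integrable lborel {h..k} (\<lambda>h. Gb (h, Y x h))" for h k x
    by (rule set_integrable_bounded_Icc[where K=3]) (auto simp: Gb_bound)
  have inc: "Y x k - Y x h = (LINT r:{h..k}|lborel. snd (Gb (r, Y x r)))"
    if "good x" "0 \<le> tau x h0" "tau x h1 \<le> T" "h0 \<le> h" "h \<le> k" "k \<le> h1" for x h k
    using arg_cong[OF curve_equation[of x h k], of snd] that tau_mono[of x h0 h] tau_mono[of x k h1]
    by (simp add: set_lebesgue_integral_snd[OF int])
  have snd_bound: "\<bar>snd (Gb z)\<bar> \<le> 3" for z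
    using Gb_bound[of z] abs_snd_le_norm[of "Gb z"] by simp
  have int': "set_integrable lborel {h..k} (\<lambda>h. snd (Gb (h, Y x h)))" for h k x
    by (rule set_integrable_bounded_Icc[where K=3]) (auto simp: snd_bound)
  have "ennreal (2 * e) \<le> (\<integral>\<^sup>+h. indicator {h0..h1} h * (indicator {-e..e} (Y x' h - Y x h) * ennreal \<bar>w h\<bar>) \<partial>lborel)"
  proof (rule descent_through_slab[where K=6])
    show "continuous_on {h0..h1} (\<lambda>h. Y x' h - Y x h)"
      by (intro continuous_intros continuous_on_compose2[OF Y_cont2, of _ "\<lambda>h. (_, h)", simplified])
    show "Y x' k - Y x k - (Y x' h - Y x h) = (LINT r:{h..k}|lborel. w r)" if "h0 \<le> h" "h \<le> k" "k \<le> h1" for h k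
      using inc[of x h k] inc[of x' h k] that assms unfolding w_def
      by (subst set_integral_diff[OF int' int']) simp
    show "norm (w r) \<le> 6" for r
      using snd_bound[of "(r, Y x' r)"] snd_bound[of "(r, Y x r)"] unfolding w_def by simp
    show "w \<in> borel_measurable borel" unfolding w_def by measurable
  qed (use assms in auto)
  also have "\<dots> \<le> (\<integral>\<^sup>+h. indicator {0..T} (tau x h) * (indicator {0..T} (tau x' h) *
     (indicator {-e..e} (Y x' h - Y x h) * ennreal (norm (Gb (h, Y x' h) - Gb (h, Y x h))))) \<partial>lborel)"
  proof (rule nn_integral_mono)
    fix r
    have "\<bar>w r\<bar> \<le> norm (Gb (r, Y x' r) - Gb (r, Y x r))"
      using abs_snd_le_norm[of "Gb (r, Y x' r) - Gb (r, Y x r)"] by (simp add: w_def)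
    moreover have "tau x r \<in> {0..T}" "tau x' r \<in> {0..T}" if "r \<in> {h0..h1}"
      using that h tau_mono[of x h0 r] tau_mono[of x r h1] tau_mono[of x' h0 r] tau_mono[of x' r h1] by auto
    ultimately show "indicator {h0..h1} r * (indicator {-e..e} (Y x' r - Y x r) * ennreal \<bar>w r\<bar>) \<le> indicator {0..T} (tau x r) * (indicator {0..T} (tau x' r) *
     (indicator {-e..e} (Y x' r - Y x r) * ennreal (norm (Gb (r, Y x' r) - Gb (r, Y x r)))))"
      by (auto split: split_indicator intro!: ennreal_leI)
  qed
  finally show ?thesis .
qed

lemma pair_line_density:
  assumes [measurable]: "(\<lambda>p. k (fst p) (snd p)) \<in> borel_measurable borel"
  shows "(\<integral>\<^sup>+x. (\<integral>\<^sup>+x'. indicator {0..T} (tau x h) * (indicator {0..T} (tau x' h) * k (Y x h) (Y x' h)) \<partial>lborel) \<partial>lborel)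
    \<le> ennreal (4 * T * C) * (ennreal (4 * T * C) * (\<integral>\<^sup>+y. (\<integral>\<^sup>+y'. k y y' \<partial>lborel) \<partial>lborel))"
proof -
  have km: "(\<lambda>x. k (f x) (g x)) \<in> borel_measurable N"
    if "f \<in> borel_measurable N" "g \<in> borel_measurable N" for f g N
    using measurable_compose[OF borel_measurable_Pair[OF that] assms] by simp
  note [measurable (raw)] = km
  have "(\<integral>\<^sup>+x. (\<integral>\<^sup>+x'. indicator {0..T} (tau x h) * (indicator {0..T} (tau x' h) * k (Y x h) (Y x' h)) \<partial>lborel) \<partial>lborel)
    = (\<integral>\<^sup>+x. indicator {0..T} (tau x h) * (\<integral>\<^sup>+x'. indicator {0..T} (tau x' h) * k (Y x h) (Y x' h) \<partial>lborel) \<partial>lborel)"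
    by (intro nn_integral_cong nn_integral_cmult) measurable
  also have "\<dots> \<le> (\<integral>\<^sup>+x. indicator {0..T} (tau x h) * (ennreal (4 * T * C) * (\<integral>\<^sup>+y'. k (Y x h) y' \<partial>lborel)) \<partial>lborel)"
    by (intro nn_integral_mono mult_left_mono line_density) auto
  also have "\<dots> \<le> ennreal (4 * T * C) * (\<integral>\<^sup>+y. ennreal (4 * T * C) * (\<integral>\<^sup>+y'. k y y' \<partial>lborel) \<partial>lborel)"
    by (rule line_density) measurable
  also have "\<dots> = ennreal (4 * T * C) * (ennreal (4 * T * C) * (\<integral>\<^sup>+y. (\<integral>\<^sup>+y'. k y y' \<partial>lborel) \<partial>lborel))"
    by (subst nn_integral_cmult) auto
  finally show ?thesis .
qed

text \<open>If two graphs crossed, then so would an open set of pairs of graphs, each pair passing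
  through the slab of width \<open>2 * e\<close> around the diagonal; the velocities differ little there.\<close>

lemma order_preserved_strict:
  assumes h: "h0 \<le> h1" "0 < tau x h0" "tau x h1 < T" "0 < tau x' h0" "tau x' h1 < T"
    and less: "Y x h0 < Y x' h0"
  shows "Y x h1 \<le> Y x' h1"
proof (rule ccontr)
  assume "\<not> Y x h1 \<le> Y x' h1"
  then have gr: "Y x' h1 < Y x h1" by simp
  \<comment> \<open>Half of the smaller gap: the pair \<open>(x, x')\<close> then satisfies strict
    inequalities, hence an open set \<open>W\<close> of pairs does, and every \<open>e <= c\<close>
    is an admissible slab for all pairs in \<open>W\<close>.\<close>
  define c where "c = min (Y x' h0 - Y x h0) (Y x h1 - Y x' h1) / 2"
  have c: "0 < c" "c < Y x' h0 - Y x h0" "Y x' h1 - Y x h1 < - c"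
    using less gr by (auto simp: c_def min_def field_simps)
  define W where "W = {p. 0 < tau (fst p) h0 \<and> tau (fst p) h1 < T \<and> 0 < tau (snd p) h0 \<and> tau (snd p) h1 < T \<and>
      c < Y (snd p) h0 - Y (fst p) h0 \<and> Y (snd p) h1 - Y (fst p) h1 < - c}"
  have "open W" unfolding W_def
    by (intro open_Collect_conj open_Collect_less continuous_intros
        continuous_on_compose2[OF tau_cont2, of _ "\<lambda>p. (_ p, _)", simplified]
        continuous_on_compose2[OF Y_cont2, of _ "\<lambda>p. (_ p, _)", simplified])
  moreover have "(x, x') \<in> W" using h c by (simp add: W_def)
  ultimately obtain A A' where A: "open A" "open A'" "x \<in> A" "x' \<in> A'" "A \<times> A' \<subseteq> W"
    by (metis open_prod_elim mem_Sigma_iff)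
  have [measurable]: "A \<in> sets borel" "A' \<in> sets borel" using A by auto
  define K where "K = 4 * T * C"
  have K: "0 < K" using T_pos C_pos by (simp add: K_def)
  let ?k = "\<lambda>e h y y'. indicator {-e..e} (y' - y) * ennreal (norm (Gb (h, y') - Gb (h, y)))"
  \<comment> \<open>The lower bound \<open>2 * e\<close> is integrated over the pairs from
    \<open>A\<close> and \<open>A'\<close>; with \<open>h\<close> moved outermost,
    \<open>pair_line_density\<close> passes to pairs of heights on each line. Dividing the quadratic
    bound by \<open>2 * e\<close> leaves a factor \<open>e\<close>.\<close>
  have small: "emeasure lborel A * emeasure lborel A' \<le> ennreal (4 * K * K * M * e)" if e: "0 < e" "e \<le> c" for e
  proof -
    have "ennreal (2 * e) * (emeasure lborel A * emeasure lborel A')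
       = (\<integral>\<^sup>+x. (\<integral>\<^sup>+x'. ennreal (2 * e) * (indicator A x * indicator A' x') \<partial>lborel) \<partial>lborel)"
      by (simp add: nn_integral_cmult nn_integral_multc mult.assoc[symmetric])
    also have "\<dots> \<le> (\<integral>\<^sup>+x. (\<integral>\<^sup>+x'. (\<integral>\<^sup>+h. indicator {0..T} (tau x h) * (indicator {0..T} (tau x' h) * ?k e h (Y x h) (Y x' h)) \<partial>lborel) \<partial>lborel) \<partial>lborel)"
    proof (rule nn_integral_mono_AE, use AE_good in eventually_elim, rule nn_integral_mono_AE, use AE_good in eventually_elim)
      fix x x' assume good: "good x" "good x'"
      show "ennreal (2 * e) * (indicator A x * indicator A' x') \<le>
         (\<integral>\<^sup>+h. indicator {0..T} (tau x h) * (indicator {0..T} (tau x' h) * ?k e h (Y x h) (Y x' h)) \<partial>lborel)"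
      proof (cases "x \<in> A \<and> x' \<in> A'")
        case True
        then have "(x, x') \<in> W" using A by auto
        then have "ennreal (2 * e) \<le> (\<integral>\<^sup>+h. indicator {0..T} (tau x h) * (indicator {0..T} (tau x' h) * ?k e h (Y x h) (Y x' h)) \<partial>lborel)"
          using e h by (intro good_pair_separation[OF good, of h0 h1]) (auto simp: W_def)
        then show ?thesis using True by simp
      qed auto
    qed
    also have "\<dots> = (\<integral>\<^sup>+x. (\<integral>\<^sup>+h. (\<integral>\<^sup>+x'. indicator {0..T} (tau x h) * (indicator {0..T} (tau x' h) * ?k e h (Y x h) (Y x' h)) \<partial>lborel) \<partial>lborel) \<partial>lborel)"
      by (intro nn_integral_cong nn_integral_swap_lborel) measurable
    also have "\<dots> = (\<integral>\<^sup>+h. (\<integral>\<^sup>+x. (\<integral>\<^sup>+x'. indicator {0..T} (tau x h) * (indicator {0..T} (tau x' h) * ?k e h (Y x h) (Y x' h)) \<partial>lborel) \<partial>lborel) \<partial>lborel)"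
      by (rule nn_integral_swap_lborel) measurable
    also have "\<dots> \<le> (\<integral>\<^sup>+h. ennreal K * (ennreal K * (\<integral>\<^sup>+y. (\<integral>\<^sup>+y'. ?k e h y y' \<partial>lborel) \<partial>lborel)) \<partial>lborel)"
      unfolding K_def by (intro nn_integral_mono pair_line_density) measurable
    also have "\<dots> = ennreal K * (ennreal K * (\<integral>\<^sup>+h. (\<integral>\<^sup>+y. (\<integral>\<^sup>+y'. ?k e h y y' \<partial>lborel) \<partial>lborel) \<partial>lborel))"
      by (subst nn_integral_cmult; (subst nn_integral_cmult)?) measurable
    also have "\<dots> \<le> ennreal K * (ennreal K * ennreal (8 * M * e\<^sup>2))"
      using e by (intro mult_left_mono Gb_near_diagonal) auto
    also have "\<dots> = ennreal (2 * e) * ennreal (4 * K * K * M * e)"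
      using e K M_nonneg by (simp add: ennreal_mult[symmetric] power2_eq_square mult_ac)
    finally show ?thesis
      using e by (subst (asm) ennreal_mult_le_mult_iff) auto
  qed
  have "emeasure lborel A * emeasure lborel A' \<le> 0"
  proof (rule ennreal_le_epsilon)
    fix r :: real assume r: "0 < r"
    define e where "e = min c (r / (4 * K * K * M + 1))"
    have den: "0 < 4 * K * K * M + 1" using K M_nonneg by (simp add: add_nonneg_pos)
    have e: "0 < e" "e \<le> c" using c r den by (auto simp: e_def)
    have "e * (4 * K * K * M) \<le> e * (4 * K * K * M + 1)" using e by (intro mult_left_mono) auto
    also have "\<dots> \<le> r / (4 * K * K * M + 1) * (4 * K * K * M + 1)"
      using den by (intro mult_right_mono) (auto simp: e_def)
    also have "\<dots> = r" using den by simp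
    finally have "4 * K * K * M * e \<le> r" by (simp add: mult_ac)
    then show "emeasure lborel A * emeasure lborel A' \<le> 0 + ennreal r"
      using small[OF e] by (simp add: order_trans[OF _ ennreal_leI])
  qed
  moreover have "emeasure lborel A \<noteq> 0" "emeasure lborel A' \<noteq> 0"
    using A emeasure_open_nonzero by blast+
  ultimately show False by simp
qed

text \<open>The strict version needs room at both ends of \<open>[0, T]\<close>, to have an open set
  of pairs. Moving \<open>h0\<close> and \<open>h1\<close> inwards by \<open>r\<close> creates it
  and changes each gap by at most \<open>4 * r\<close>, while the gaps are at least
  \<open>8 * r\<close>.\<close>

lemma order_preserved:
  assumes h: "h0 \<le> h1" "0 \<le> tau x h0" "tau x h1 \<le> T" "0 \<le> tau x' h0" "tau x' h1 \<le> T"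
    and less: "Y x h0 < Y x' h0"
  shows "Y x h1 \<le> Y x' h1"
proof (rule ccontr)
  assume "\<not> Y x h1 \<le> Y x' h1"
  then have gr: "Y x' h1 < Y x h1" by simp
  then have lt: "h0 < h1" using h less by (cases "h0 = h1") auto
  define r where "r = min (h1 - h0) (min (Y x' h0 - Y x h0) (Y x h1 - Y x' h1)) / 8"
  have r: "0 < r" "8 * r \<le> h1 - h0" "8 * r \<le> Y x' h0 - Y x h0" "8 * r \<le> Y x h1 - Y x' h1"
    using lt less gr by (auto simp: r_def)
  have "Y x (h1 - r) \<le> Y x' (h1 - r)"
  proof (rule order_preserved_strict[of "h0 + r"])
    show "h0 + r \<le> h1 - r" using r by simp
    show "0 < tau x (h0 + r)" "0 < tau x' (h0 + r)" "tau x (h1 - r) < T" "tau x' (h1 - r) < T"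
      using h r tau_diff[of h0 "h0 + r"] tau_diff[of "h1 - r" h1] by (smt (verit) half_gt_zero)+
    show "Y x (h0 + r) < Y x' (h0 + r)"
      using r Y_lip[of x "h0 + r" h0] Y_lip[of x' "h0 + r" h0] by (simp add: abs_le_iff)
  qed
  then show False
    using r Y_lip[of x "h1 - r" h1] Y_lip[of x' "h1 - r" h1] by (simp add: abs_le_iff)
qed

section \<open>Starting points whose graphs are separated by a given point\<close>

text \<open>The flow moves points by at most \<open>2 * T\<close> in this time, so \<open>y\<close>
  going to \<open>z + (y - F T y)\<close> maps the ball of that radius about \<open>z\<close> into
  itself, and Brouwer's theorem applies. This provides trajectories that arrive at a prescribed
  point.\<close>

lemma F_T_surj: "\<exists>x. F T x = z"
proof -
  have "\<exists>y\<in>cball z (2 * T). F T y = z"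
  proof (rule brouwer_surjective[of "cball z (2 * T)" "F T" "{z}"])
    fix x y assume "x \<in> {z}"
    then show "x + (y - F T y) \<in> cball z (2 * T)"
      using F_lip[of T y 0] T_pos by (simp add: dist_norm algebra_simps)
  qed (use T_pos F_cont continuous_on_subset in \<open>auto intro: continuous_on_subset[OF F_cont]\<close>)
  then show ?thesis by blast
qed

text \<open>The curve \<open>c\<close> follows the flow backwards from \<open>z\<close> for the time \<open>2 * T\<close>. Two trajectories are
  glued at the point \<open>(m, k)\<close>, because the flow itself is only defined up to time \<open>T\<close>.\<close>

lemma backward_curve:
  obtains c m k where
    "\<And>h h'. \<bar>c h - c h'\<bar> \<le> 2 * \<bar>h - h'\<bar>"
    "\<And>x. fst z - 2 * T \<le> fst x \<Longrightarrow> 0 \<le> tau x (fst z) \<Longrightarrow> tau x (fst z) \<le> T \<Longrightarrow>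
      \<not> (0 \<le> tau x m \<and> tau x m \<le> T \<and> Y x m = k) \<Longrightarrow> Y x (fst z) \<noteq> snd z \<Longrightarrow>
      (c (fst x) < snd x \<longrightarrow> snd z < Y x (fst z)) \<and> (snd x < c (fst x) \<longrightarrow> Y x (fst z) < snd z)"
proof -
  \<comment> \<open>The first coordinate gains at least \<open>T\<close> from \<open>q\<close> to
    \<open>p\<close> and again from \<open>p\<close> to \<open>z\<close>. The two legs thus reach
    back to \<open>fst z - 2 * T\<close>, the farthest abscissa from which the line of
    \<open>z\<close> can be reached in time \<open>T\<close>.\<close>
  obtain p where p: "F T p = z" using F_T_surj by blast
  obtain q where q: "F T q = p" using F_T_surj by blast
  define m where "m = fst p"
  define c where "c h = (if m \<le> h then Y p h else Y q h)" for h
  have pz: "tau p (fst z) = T" "Y p (fst z) = snd z" "tau p m = 0" "Y p m = snd p"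
    unfolding m_def using p by (metis tau_F Y_F tau_start Y_start)+
  have qm: "tau q m = T" "Y q m = snd p"
    unfolding m_def using q by (metis tau_F Y_F)+
  have mz: "m \<le> fst z" using pz T_pos tau_mono[of p m "fst z"] by simp
  have qz: "fst q \<le> fst z - 2 * T"
    using F_fst[of 0 T p] F_fst[of 0 T q] T_pos p q by simp
  have *: "\<bar>c h - c h'\<bar> \<le> 2 * (h' - h)" if "h \<le> h'" for h h'
    using Y_lip[of p h h'] Y_lip[of q h h'] Y_lip[of q h m] Y_lip[of p m h'] pz qm that
    by (auto simp: c_def)
  have lip: "\<bar>c h - c h'\<bar> \<le> 2 * \<bar>h - h'\<bar>" for h h'
    using *[of h h'] *[of h' h] by (cases "h \<le> h'") (auto simp: abs_minus_commute)
  show ?thesis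
  proof (rule that[of c m "snd p", OF lip])
    fix x assume x: "fst z - 2 * T \<le> fst x" "0 \<le> tau x (fst z)" "tau x (fst z) \<le> T"
      "\<not> (0 \<le> tau x m \<and> tau x m \<le> T \<and> Y x m = snd p)" "Y x (fst z) \<noteq> snd z"
    have xz: "fst x \<le> fst z" using x(2) by (simp add: tau_nonneg_iff)
    have p_side: "(Y p h < Y x h \<longrightarrow> snd z < Y x (fst z)) \<and> (Y x h < Y p h \<longrightarrow> Y x (fst z) < snd z)"
      if "m \<le> h" "fst x \<le> h" "h \<le> fst z" for h
    proof -
      have "0 \<le> tau p h" "0 \<le> tau x h" using that by (simp_all add: tau_nonneg_iff m_def)
      then show ?thesis
        using order_preserved[of h "fst z" p x] order_preserved[of h "fst z" x p] that(3) x(3,5) pz(1,2)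
        by (simp add: less_le)
    qed
    show "(c (fst x) < snd x \<longrightarrow> snd z < Y x (fst z)) \<and> (snd x < c (fst x) \<longrightarrow> Y x (fst z) < snd z)"
    proof (cases "m \<le> fst x")
      case True
      then show ?thesis using p_side[of "fst x"] xz by (simp add: c_def)
    next
      case False
      have q0: "0 \<le> tau q (fst x)" using qz x(1) by (simp add: tau_nonneg_iff)
      have xT: "tau x m \<le> T" using x(3) mz tau_mono[of x m "fst z"] by simp
      have "0 \<le> tau x m" using False by (simp add: tau_nonneg_iff)
      \<comment> \<open>Order is preserved only weakly: a graph that merges into the gluing point
        could leave it on either side. The hypothesis on \<open>k\<close> excludes this.\<close>
      then have "Y x m \<noteq> snd p" using x(4) xT by simp
      then have "(Y q (fst x) < snd x \<longrightarrow> Y p m < Y x m) \<and> (snd x < Y q (fst x) \<longrightarrow> Y x m < Y p m)"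
        using order_preserved[of "fst x" m q x] order_preserved[of "fst x" m x q] False q0 xT qm pz(4)
        by (simp add: less_le)
      then show ?thesis using p_side[of m] mz False by (simp add: c_def)
    qed
  qed
qed

definition separates :: "real \<times> real \<Rightarrow> real \<times> real \<Rightarrow> real \<times> real \<Rightarrow> bool" where
  "separates d z x \<longleftrightarrow> tau x (fst z) \<in> {0..T} \<and> tau (x + d) (fst z) \<in> {0..T} \<and>
     snd z \<in> {min (Y x (fst z)) (Y (x + d) (fst z)) .. max (Y x (fst z)) (Y (x + d) (fst z))}"

lemma separates_meas [measurable (raw)]:
  assumes [measurable]: "f \<in> borel_measurable N" "g \<in> borel_measurable N"
  shows "Measurable.pred N (\<lambda>y. separates d (f y) (g y))"
  unfolding separates_def atLeastAtMost_iff by measurable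

lemma emeasure_separates: "emeasure lborel {x. separates d z x} \<le> ennreal (12 * T * norm d)"
proof -
  obtain c m k where c: "\<And>h h'. \<bar>c h - c h'\<bar> \<le> 2 * \<bar>h - h'\<bar>" and
    ord: "\<And>x. fst z - 2 * T \<le> fst x \<Longrightarrow> 0 \<le> tau x (fst z) \<Longrightarrow> tau x (fst z) \<le> T \<Longrightarrow>
      \<not> (0 \<le> tau x m \<and> tau x m \<le> T \<and> Y x m = k) \<Longrightarrow> Y x (fst z) \<noteq> snd z \<Longrightarrow>
      (c (fst x) < snd x \<longrightarrow> snd z < Y x (fst z)) \<and> (snd x < c (fst x) \<longrightarrow> Y x (fst z) < snd z)"
    by (rule backward_curve[of z]) blast
  have "continuous_on UNIV c"
  proof (rule continuous_on_iff[THEN iffD2], safe)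
    fix x e :: real assume "0 < e"
    then show "\<exists>d>0. \<forall>x'\<in>UNIV. dist x' x < d \<longrightarrow> dist (c x') (c x) < e"
      using c by (intro exI[of _ "e / 2"]) (force simp: dist_real_def intro: le_less_trans[OF c])
  qed
  then have [measurable]: "c \<in> borel_measurable borel" by (rule borel_measurable_continuous_onI)
  define R where "R = {x::real\<times>real. fst x \<in> {fst z - 2 * T .. fst z} \<and> snd x \<in> {c (fst x) - 3 * norm d .. c (fst x) + 3 * norm d}}"
  have [measurable]: "R \<in> sets borel" unfolding R_def atLeastAtMost_iff by measurable
  \<comment> \<open>Excludes graphs through the gluing point and through \<open>z\<close> itself;
    each exclusion costs a null set of starting points.\<close>
  define ok where "ok x \<longleftrightarrow> \<not> (0 \<le> tau x m \<and> tau x m \<le> T \<and> Y x m = k) \<and>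
     \<not> (0 \<le> tau x (fst z) \<and> tau x (fst z) \<le> T \<and> Y x (fst z) = snd z)" for x
  have ok: "AE x in lborel. ok x"
    unfolding ok_def using AE_avoids_point[of m k] AE_avoids_point[of "fst z" "snd z"] by eventually_elim auto
  have range: "fst z - 2 * T \<le> fst x" if "tau x (fst z) \<in> {0..T}" for x
    using that F_fst_upper[of "tau x (fst z)" x 0] by (auto simp: abs_le_iff)
  have "AE x in lborel. separates d z x \<longrightarrow> x \<in> R"
    using ok AE_translate_lborel[OF ok, of d]
  proof eventually_elim
    case (elim x)
    show ?case
    proof
      assume b: "separates d z x"
      then have t: "tau x (fst z) \<in> {0..T}" "tau (x + d) (fst z) \<in> {0..T}" by (auto simp: separates_def)
      have side: "(c (fst y) < snd y \<longrightarrow> snd z < Y y (fst z)) \<and> (snd y < c (fst y) \<longrightarrow> Y y (fst z) < snd z)"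
        if "ok y" "tau y (fst z) \<in> {0..T}" for y
        by (rule ord) (use that range[OF that(2)] in \<open>auto simp: ok_def\<close>)
      have "min (Y x (fst z)) (Y (x + d) (fst z)) \<le> snd z" "snd z \<le> max (Y x (fst z)) (Y (x + d) (fst z))"
        using b by (simp_all add: separates_def)
      \<comment> \<open>If \<open>x\<close> and \<open>x + d\<close> started strictly on the same
        side of \<open>c\<close>, both graphs would pass \<open>z\<close> strictly on that side. So
        they start on opposite sides or on \<open>c\<close>, and the slope bound 2 for
        \<open>c\<close> turns this into a bound for the vertical distance of \<open>x\<close> from
        \<open>c\<close>.\<close>
      then have "\<not> (c (fst x) < snd x \<and> c (fst (x + d)) < snd (x + d))"
        "\<not> (snd x < c (fst x) \<and> snd (x + d) < c (fst (x + d)))"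
        using side[OF elim(1) t(1)] side[OF elim(2) t(2)] by linarith+
      then have "\<bar>snd x - c (fst x)\<bar> \<le> \<bar>snd d\<bar> + 2 * \<bar>fst d\<bar>"
        using c[of "fst x" "fst (x + d)"] by (simp add: abs_le_iff not_less) linarith
      also have "\<dots> \<le> 3 * norm d"
        using abs_fst_le_norm[of d] abs_snd_le_norm[of d] by linarith
      finally show "x \<in> R" using range t by (auto simp: R_def tau_nonneg_iff)
    qed
  qed
  moreover have "{x. separates d z x} \<in> sets lborel" by measurable
  ultimately have "emeasure lborel {x. separates d z x} \<le> emeasure lborel R"
    by (intro emeasure_mono_AE) auto
  also have "\<dots> = (\<integral>\<^sup>+x. indicator R x \<partial>lborel)" by simp
  also have "\<dots> = (\<integral>\<^sup>+h. (\<integral>\<^sup>+y. indicator R (h, y) \<partial>lborel) \<partial>lborel)"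
    by (rule nn_integral_plane[symmetric]) measurable
  also have "\<dots> = (\<integral>\<^sup>+h. ennreal (6 * norm d) * indicator {fst z - 2 * T .. fst z} h \<partial>lborel)"
  proof (rule nn_integral_cong)
    fix h :: real
    have "(\<integral>\<^sup>+y. indicator R (h, y) \<partial>lborel) = (\<integral>\<^sup>+y. indicator {fst z - 2 * T .. fst z} h *
       indicator {c h - 3 * norm d .. c h + 3 * norm d} y \<partial>lborel)"
      by (intro nn_integral_cong) (auto simp: R_def split: split_indicator)
    then show "(\<integral>\<^sup>+y. indicator R (h, y) \<partial>lborel) = ennreal (6 * norm d) * indicator {fst z - 2 * T .. fst z} h"
      by (simp add: nn_integral_cmult mult.commute)
  qed
  also have "\<dots> = ennreal (12 * T * norm d)"
    using T_pos by (subst nn_integral_cmult_indicator) (auto simp: ennreal_mult[symmetric] mult_ac)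
  finally show ?thesis .
qed

section \<open>Drift between neighbouring graphs\<close>

text \<open>On each vertical line \<open>steklov_increment\<close> splits \<open>e\<close> times the
  integrand into three terms. The two averaging errors contribute at most
  \<open>K * e * e * M\<close> each, by \<open>line_density\<close>. In the third, Tonelli
  integrates first over the starting points, with \<open>emeasure_separates\<close>, and then over
  \<open>z\<close>, with the translation bound; the result is \<open>e\<close> times the asserted
  bound. Dividing by \<open>e\<close> and letting it tend to \<open>0\<close> removes
  \<open>K\<close>.\<close>

lemma nn_integral_graph_gap_b:
  "(\<integral>\<^sup>+x. (\<integral>\<^sup>+h. indicator {0..T} (tau x h) * indicator {0..T} (tau (x + d) h) *
      ennreal (norm (b (h, Y (x + d) h) - b (h, Y x h))) \<partial>lborel) \<partial>lborel) \<le> ennreal (12 * T * norm d * M)"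
    (is "?J \<le> _")
proof -
  define K where "K = 4 * T * C"
  have K: "0 < K" using T_pos C_pos by (simp add: K_def)
  let ?I = "\<lambda>x h. indicator {0..T} (tau x h) :: ennreal"
  let ?A = "\<lambda>e h y. (\<integral>\<^sup>+s. indicator {0..<e} s * ennreal (norm (b (h, y + s) - b (h, y))) \<partial>lborel)"
  let ?B = "\<lambda>e z. ennreal (norm (b (z + (0, e)) - b z))"
  have A_int: "(\<integral>\<^sup>+h. (\<integral>\<^sup>+y. ?A e h y \<partial>lborel) \<partial>lborel) \<le> ennreal (e * e * M)" if "0 < e" for e
  proof -
    have "(\<integral>\<^sup>+h. (\<integral>\<^sup>+y. ?A e h y \<partial>lborel) \<partial>lborel) = (\<integral>\<^sup>+z. ?A e (fst z) (snd z) \<partial>lborel)"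
      by (subst nn_integral_plane[symmetric]) auto
    also have "\<dots> = (\<integral>\<^sup>+s. (\<integral>\<^sup>+z. indicator {0..<e} s * ?B s z \<partial>lborel) \<partial>lborel)"
      by (subst nn_integral_swap_lborel) (auto simp: plus_prod_def)
    also have "\<dots> \<le> (\<integral>\<^sup>+s. ennreal (e * M) * indicator {0..<e} s \<partial>(lborel::real measure))"
    proof (rule nn_integral_mono)
      fix s :: real
      show "(\<integral>\<^sup>+z. indicator {0..<e} s * ?B s z \<partial>lborel) \<le> ennreal (e * M) * indicator {0..<e} s"
        using M_nonneg by (auto split: split_indicator intro!: order_trans[OF b_BV] ennreal_leI mult_right_mono)
    qed
    also have "\<dots> = ennreal (e * e * M)"
      using that M_nonneg by (subst nn_integral_cmult_indicator) (auto simp: ennreal_mult[symmetric] mult_ac)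
    finally show ?thesis .
  qed
  have gap: "(\<integral>\<^sup>+x. (\<integral>\<^sup>+h. ?I (x + a) h * ?A e h (Y (x + a) h) \<partial>lborel) \<partial>lborel) \<le> ennreal (K * e * e * M)" if "0 < e" for a e
  proof -
    have "(\<integral>\<^sup>+x. (\<integral>\<^sup>+h. ?I (x + a) h * ?A e h (Y (x + a) h) \<partial>lborel) \<partial>lborel) = (\<integral>\<^sup>+h. (\<integral>\<^sup>+x. ?I (x + a) h * ?A e h (Y (x + a) h) \<partial>lborel) \<partial>lborel)"
      by (rule nn_integral_swap_lborel) measurable
    also have "\<dots> = (\<integral>\<^sup>+h. (\<integral>\<^sup>+x. ?I x h * ?A e h (Y x h) \<partial>lborel) \<partial>lborel)"
      by (intro nn_integral_cong nn_integral_translate) measurable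
    also have "\<dots> \<le> (\<integral>\<^sup>+h. ennreal K * (\<integral>\<^sup>+y. ?A e h y \<partial>lborel) \<partial>lborel)"
      unfolding K_def by (intro nn_integral_mono line_density) measurable
    also have "\<dots> = ennreal K * (\<integral>\<^sup>+h. (\<integral>\<^sup>+y. ?A e h y \<partial>lborel) \<partial>lborel)"
      by (rule nn_integral_cmult) measurable
    also have "\<dots> \<le> ennreal K * ennreal (e * e * M)" by (intro mult_left_mono A_int that) auto
    finally show ?thesis using K M_nonneg that by (simp add: ennreal_mult[symmetric] mult_ac)
  qed
  have mid: "(\<integral>\<^sup>+x. (\<integral>\<^sup>+h. (\<integral>\<^sup>+s. of_bool (separates d (h, s) x) * ?B e (h, s) \<partial>lborel) \<partial>lborel) \<partial>lborel)
    \<le> ennreal (12 * T * norm d * (e * M))" if "0 < e" for e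
  proof -
    have "(\<integral>\<^sup>+x. (\<integral>\<^sup>+h. (\<integral>\<^sup>+s. of_bool (separates d (h, s) x) * ?B e (h, s) \<partial>lborel) \<partial>lborel) \<partial>lborel)
      = (\<integral>\<^sup>+x. (\<integral>\<^sup>+z. of_bool (separates d z x) * ?B e z \<partial>lborel) \<partial>lborel)"
      by (intro nn_integral_cong nn_integral_plane) measurable
    also have "\<dots> = (\<integral>\<^sup>+z. (\<integral>\<^sup>+x. of_bool (separates d z x) * ?B e z \<partial>lborel) \<partial>lborel)"
      by (rule nn_integral_swap_lborel) measurable
    also have "\<dots> = (\<integral>\<^sup>+z. emeasure lborel {x. separates d z x} * ?B e z \<partial>lborel)"
    proof (rule nn_integral_cong)
      fix z :: "real \<times> real"
      have [measurable]: "{x. separates d z x} \<in> sets borel" by measurable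
      have "(\<integral>\<^sup>+x. of_bool (separates d z x) * ?B e z \<partial>lborel) = (\<integral>\<^sup>+x. indicator {x. separates d z x} x * ?B e z \<partial>lborel)"
        by (intro nn_integral_cong) (auto split: split_indicator)
      also have "\<dots> = emeasure lborel {x. separates d z x} * ?B e z"
        by (subst nn_integral_multc) auto
      finally show "(\<integral>\<^sup>+x. of_bool (separates d z x) * ?B e z \<partial>lborel) = emeasure lborel {x. separates d z x} * ?B e z" .
    qed
    also have "\<dots> \<le> (\<integral>\<^sup>+z. ennreal (12 * T * norm d) * ?B e z \<partial>lborel)"
      by (intro nn_integral_mono mult_right_mono emeasure_separates) auto
    also have "\<dots> = ennreal (12 * T * norm d) * (\<integral>\<^sup>+z. ?B e z \<partial>lborel)" by (rule nn_integral_cmult) measurable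
    also have "\<dots> \<le> ennreal (12 * T * norm d) * ennreal (norm (0::real, e) * M)"
      by (intro mult_left_mono b_BV) auto
    finally show ?thesis using T_pos M_nonneg that by (simp add: ennreal_mult[symmetric])
  qed
  have "?J \<le> ennreal (12 * T * norm d * M) + ennreal r" if r: "0 < r" for r
  proof -
    \<comment> \<open>Makes the leftover \<open>e * (2 * K * M)\<close> at most \<open>r\<close>;
      the \<open>+ 1\<close> keeps the denominator positive when \<open>M = 0\<close>.\<close>
    define e where "e = r / (2 * K * M + 1)"
    have den: "0 < 2 * K * M + 1" using K M_nonneg by (simp add: add_nonneg_pos)
    have e: "0 < e" using den r by (simp add: e_def)
    have "e * (2 * K * M) \<le> e * (2 * K * M + 1)" using e by (intro mult_left_mono) auto
    then have er: "e * (2 * K * M) \<le> r" using den by (simp add: e_def)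
    have "ennreal e * ?J = (\<integral>\<^sup>+x. (\<integral>\<^sup>+h. ennreal e * (?I x h * ?I (x + d) h *
       ennreal (norm (b (h, Y (x + d) h) - b (h, Y x h)))) \<partial>lborel) \<partial>lborel)"
      by (simp add: nn_integral_cmult)
    also have "\<dots> = (\<integral>\<^sup>+x. (\<integral>\<^sup>+h. ?I x h * ?I (x + d) h *
       ennreal (e * norm (b (h, Y (x + d) h) - b (h, Y x h))) \<partial>lborel) \<partial>lborel)"
      using e by (intro nn_integral_cong) (simp add: ennreal_mult mult_ac)
    also have "\<dots> \<le> (\<integral>\<^sup>+x. (\<integral>\<^sup>+h. ?I (x + 0) h * ?A e h (Y (x + 0) h) + ?I (x + d) h * ?A e h (Y (x + d) h)
       + (\<integral>\<^sup>+s. of_bool (separates d (h, s) x) * ?B e (h, s) \<partial>lborel) \<partial>lborel) \<partial>lborel)"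
    proof (rule nn_integral_mono, rule nn_integral_mono)
      fix x :: "real \<times> real" and h :: real
      have "ennreal (e * norm (b (h, Y (x + d) h) - b (h, Y x h))) \<le> ?A e h (Y x h) + ?A e h (Y (x + d) h)
        + (\<integral>\<^sup>+s. indicator {min (Y x h) (Y (x + d) h)..max (Y x h) (Y (x + d) h)} s * ennreal (norm (b (h, s + e) - b (h, s))) \<partial>lborel)"
        by (rule steklov_increment[where K=2 and f="\<lambda>y. b (h, y)"]) (use e b_bound in auto)
      then show "?I x h * ?I (x + d) h * ennreal (e * norm (b (h, Y (x + d) h) - b (h, Y x h)))
        \<le> ?I (x + 0) h * ?A e h (Y (x + 0) h) + ?I (x + d) h * ?A e h (Y (x + d) h)
       + (\<integral>\<^sup>+s. of_bool (separates d (h, s) x) * ?B e (h, s) \<partial>lborel)"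
        by (auto simp: separates_def indicator_def split: if_splits)
    qed
    also have "\<dots> = (\<integral>\<^sup>+x. (\<integral>\<^sup>+h. ?I (x + 0) h * ?A e h (Y (x + 0) h) \<partial>lborel) \<partial>lborel)
      + (\<integral>\<^sup>+x. (\<integral>\<^sup>+h. ?I (x + d) h * ?A e h (Y (x + d) h) \<partial>lborel) \<partial>lborel)
      + (\<integral>\<^sup>+x. (\<integral>\<^sup>+h. (\<integral>\<^sup>+s. of_bool (separates d (h, s) x) * ?B e (h, s) \<partial>lborel) \<partial>lborel) \<partial>lborel)"
      by (simp add: nn_integral_add)
    also have "\<dots> \<le> ennreal (K * e * e * M) + ennreal (K * e * e * M) + ennreal (12 * T * norm d * (e * M))"
      by (intro add_mono gap mid e)
    also have "\<dots> = ennreal e * ennreal (12 * T * norm d * M + e * (2 * K * M))"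
      using e K M_nonneg T_pos by (simp add: ennreal_mult[symmetric] ennreal_plus[symmetric] algebra_simps del: ennreal_plus)
    also have "\<dots> \<le> ennreal e * ennreal (12 * T * norm d * M + r)"
      using er by (intro mult_left_mono ennreal_leI add_left_mono) auto
    finally have "?J \<le> ennreal (12 * T * norm d * M + r)"
      using e by (subst (asm) ennreal_mult_le_mult_iff) auto
    then show ?thesis using M_nonneg T_pos r by simp
  qed
  then show ?thesis by (rule ennreal_le_epsilon)
qed

definition gap :: "real \<times> real \<Rightarrow> real \<times> real \<Rightarrow> ennreal" where
  "gap d x = (\<integral>\<^sup>+h. indicator {0..T} (tau x h) * indicator {0..T} (tau (x + d) h) *
      ennreal (norm (Gb (h, Y (x + d) h) - Gb (h, Y x h))) \<partial>lborel)"

lemma gap_meas [measurable]: "gap d \<in> borel_measurable borel"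
  unfolding gap_def by measurable

lemma nn_integral_gap: "(\<integral>\<^sup>+x. gap d x \<partial>lborel) \<le> ennreal (48 * T * norm d * M)"
proof -
  have "(\<integral>\<^sup>+x. gap d x \<partial>lborel) \<le> (\<integral>\<^sup>+x. (\<integral>\<^sup>+h. 4 * (indicator {0..T} (tau x h) * indicator {0..T} (tau (x + d) h) *
      ennreal (norm (b (h, Y (x + d) h) - b (h, Y x h)))) \<partial>lborel) \<partial>lborel)"
    unfolding gap_def
  proof (rule nn_integral_mono, rule nn_integral_mono)
    fix x :: "real \<times> real" and h :: real
    have "ennreal (norm (Gb (h, Y (x + d) h) - Gb (h, Y x h))) \<le> 4 * ennreal (norm (b (h, Y (x + d) h) - b (h, Y x h)))"
      using ennreal_leI[OF Gb_diff[of "(h, Y (x + d) h)" "(h, Y x h)"]] by (simp add: ennreal_mult')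
    then show "indicator {0..T} (tau x h) * indicator {0..T} (tau (x + d) h) *
      ennreal (norm (Gb (h, Y (x + d) h) - Gb (h, Y x h))) \<le> 4 * (indicator {0..T} (tau x h) * indicator {0..T} (tau (x + d) h) *
      ennreal (norm (b (h, Y (x + d) h) - b (h, Y x h))))"
      by (auto split: split_indicator)
  qed
  also have "\<dots> = 4 * (\<integral>\<^sup>+x. (\<integral>\<^sup>+h. indicator {0..T} (tau x h) * indicator {0..T} (tau (x + d) h) *
      ennreal (norm (b (h, Y (x + d) h) - b (h, Y x h))) \<partial>lborel) \<partial>lborel)"
    by (simp add: nn_integral_cmult)
  also have "\<dots> \<le> 4 * ennreal (12 * T * norm d * M)"
    by (intro mult_left_mono nn_integral_graph_gap_b) auto
  also have "\<dots> = ennreal (48 * T * norm d * M)"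
    using T_pos M_nonneg by (simp add: ennreal_mult'[symmetric] flip: ennreal_numeral)
  finally show ?thesis .
qed

section \<open>Oscillation of the field along short stretches of the flow\<close>

definition box_osc :: "real \<Rightarrow> real \<times> real \<Rightarrow> ennreal" where
  "box_osc r z = (\<integral>\<^sup>+w. indicator ({-r..r} \<times> {-r..r}) w * ennreal (norm (b (z + w) - b z)) \<partial>lborel)"

lemma square_borel [measurable]: "{-r..r} \<times> {-r..r} \<in> sets (borel :: (real \<times> real) measure)"
  by (simp add: borel_prod[symmetric])

lemma emeasure_square: "0 \<le> r \<Longrightarrow> emeasure lborel ({-r..r} \<times> {-r..r} :: (real \<times> real) set) = ennreal (4 * r\<^sup>2)"
  by (simp add: lborel_prod[symmetric] lborel.emeasure_pair_measure_Times ennreal_mult[symmetric] power2_eq_square)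

lemma box_osc_meas [measurable]: "box_osc r \<in> borel_measurable borel"
  unfolding box_osc_def by measurable

lemma nn_integral_box_osc:
  assumes "0 \<le> r"
  shows "(\<integral>\<^sup>+z. box_osc r z \<partial>lborel) \<le> ennreal (8 * r ^ 3 * M)"
proof -
  have "(\<integral>\<^sup>+z. box_osc r z \<partial>lborel)
    = (\<integral>\<^sup>+w. (\<integral>\<^sup>+z. indicator ({-r..r} \<times> {-r..r}) w * ennreal (norm (b (z + w) - b z)) \<partial>lborel) \<partial>lborel)"
    unfolding box_osc_def by (rule nn_integral_swap_lborel) measurable
  also have "\<dots> \<le> (\<integral>\<^sup>+w. ennreal (2 * r * M) * indicator ({-r..r} \<times> {-r..r}) w \<partial>(lborel :: (real \<times> real) measure))"
  proof (rule nn_integral_mono)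
    fix w :: "real \<times> real"
    show "(\<integral>\<^sup>+z. indicator ({-r..r} \<times> {-r..r}) w * ennreal (norm (b (z + w) - b z)) \<partial>lborel)
      \<le> ennreal (2 * r * M) * indicator ({-r..r} \<times> {-r..r}) w"
    proof (cases "w \<in> {-r..r} \<times> {-r..r}")
      case True
      then have "norm w \<le> 2 * r"
        using norm_Pair_le[of "fst w" "snd w"] by (auto simp: mem_Times_iff abs_le_iff)
      then have "norm w * M \<le> 2 * r * M" using M_nonneg by (intro mult_right_mono) auto
      then show ?thesis using True order_trans[OF b_BV[of w] ennreal_leI] by simp
    qed simp
  qed
  also have "\<dots> = ennreal (2 * r * M) * ennreal (4 * r\<^sup>2)"
    using assms by (subst nn_integral_cmult_indicator) (auto simp: emeasure_square)
  also have "\<dots> = ennreal (8 * r ^ 3 * M)"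
    using assms M_nonneg by (simp add: ennreal_mult[symmetric] power2_eq_square power3_eq_cube mult_ac)
  finally show ?thesis .
qed

text \<open>The displacement varies with \<open>x\<close>, so the translation bound does not apply
  directly. Instead \<open>b (g x)\<close> and \<open>b x\<close> are both compared with
  \<open>b (x + w)\<close> for \<open>w\<close> in the square of half-side \<open>r\<close>; these
  points also lie in the square of half-side \<open>2 * r\<close> about \<open>g x\<close>. The area
  bound integrates the oscillation at \<open>g x\<close>, whence \<open>C + 1\<close>, and
  \<open>8 * (2 * r) ^ 3 * M / (4 * r ^ 2) = 16 * r * M\<close>.\<close>

lemma nn_integral_displaced_b:
  assumes r: "0 < r" and g [measurable]: "g \<in> borel_measurable borel" and near: "\<And>x. norm (g x - x) \<le> r"
    and area: "\<And>A. A \<in> sets borel \<Longrightarrow> emeasure lborel (g -` A) \<le> ennreal C * emeasure lborel A"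
  shows "(\<integral>\<^sup>+x. norm (b (g x) - b x) \<partial>lborel) \<le> ennreal (16 * (C + 1) * r * M)"
proof -
  let ?Q = "\<lambda>r::real. {-r..r} \<times> {-r..r}"
  have pt: "ennreal (4 * r\<^sup>2) * ennreal (norm (b (g x) - b x)) \<le> box_osc (2 * r) (g x) + box_osc (2 * r) x" for x
  proof -
    have "ennreal (4 * r\<^sup>2) * ennreal (norm (b (g x) - b x)) = (\<integral>\<^sup>+w. ennreal (norm (b (g x) - b x)) * indicator (?Q r) w \<partial>lborel)"
      using r by (subst nn_integral_cmult_indicator) (auto simp: emeasure_square mult.commute)
    also have "\<dots> \<le> (\<integral>\<^sup>+w. indicator (?Q r) w * ennreal (norm (b (x + w) - b (g x))) + indicator (?Q (2 * r)) w * ennreal (norm (b (x + w) - b x)) \<partial>lborel)"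
    proof (rule nn_integral_mono)
      fix w
      have "norm (b (g x) - b x) \<le> norm (b (x + w) - b (g x)) + norm (b (x + w) - b x)"
        using norm_triangle_ineq[of "b (g x) - b (x + w)" "b (x + w) - b x"] by (simp add: norm_minus_commute)
      then have "ennreal (norm (b (g x) - b x)) \<le> ennreal (norm (b (x + w) - b (g x))) + ennreal (norm (b (x + w) - b x))"
        by (simp add: ennreal_leI flip: ennreal_plus)
      moreover have "?Q r \<subseteq> ?Q (2 * r)" using r by auto
      ultimately show "ennreal (norm (b (g x) - b x)) * indicator (?Q r) w \<le> indicator (?Q r) w * ennreal (norm (b (x + w) - b (g x))) + indicator (?Q (2 * r)) w * ennreal (norm (b (x + w) - b x))"
        by (auto split: split_indicator)
    qed
    also have "\<dots> = (\<integral>\<^sup>+w. indicator (?Q r) w * ennreal (norm (b (x + w) - b (g x))) \<partial>lborel) + box_osc (2 * r) x"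
      unfolding box_osc_def by (rule nn_integral_add) measurable
    also have "(\<integral>\<^sup>+w. indicator (?Q r) w * ennreal (norm (b (x + w) - b (g x))) \<partial>lborel)
      = (\<integral>\<^sup>+w. indicator (?Q r) (w + (g x - x)) * ennreal (norm (b (x + (w + (g x - x))) - b (g x))) \<partial>lborel)"
      by (rule nn_integral_translate[symmetric]) measurable
    also have "\<dots> \<le> box_osc (2 * r) (g x)"
      unfolding box_osc_def
    proof (rule nn_integral_mono)
      fix w
      have "\<bar>fst (g x) - fst x\<bar> \<le> r" "\<bar>snd (g x) - snd x\<bar> \<le> r"
        using near[of x] abs_fst_le_norm[of "g x - x"] abs_snd_le_norm[of "g x - x"] by auto
      then have "w + (g x - x) \<in> ?Q r \<Longrightarrow> w \<in> ?Q (2 * r)" by (auto simp: mem_Times_iff)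
      moreover have "x + (w + (g x - x)) = g x + w" by simp
      ultimately show "indicator (?Q r) (w + (g x - x)) * ennreal (norm (b (x + (w + (g x - x))) - b (g x)))
        \<le> indicator (?Q (2 * r)) w * ennreal (norm (b (g x + w) - b (g x)))"
        by (simp only:) (auto split: split_indicator)
    qed
    finally show ?thesis by (simp add: add_right_mono)
  qed
  have "ennreal (4 * r\<^sup>2) * (\<integral>\<^sup>+x. norm (b (g x) - b x) \<partial>lborel) = (\<integral>\<^sup>+x. ennreal (4 * r\<^sup>2) * ennreal (norm (b (g x) - b x)) \<partial>lborel)"
    by (rule nn_integral_cmult[symmetric]) measurable
  also have "\<dots> \<le> (\<integral>\<^sup>+x. box_osc (2 * r) (g x) + box_osc (2 * r) x \<partial>lborel)"
    by (intro nn_integral_mono pt)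
  also have "\<dots> = (\<integral>\<^sup>+x. box_osc (2 * r) (g x) \<partial>lborel) + (\<integral>\<^sup>+x. box_osc (2 * r) x \<partial>lborel)"
    by (rule nn_integral_add) measurable
  also have "\<dots> \<le> ennreal C * (\<integral>\<^sup>+x. box_osc (2 * r) x \<partial>lborel) + (\<integral>\<^sup>+x. box_osc (2 * r) x \<partial>lborel)"
    by (rule add_right_mono, rule nn_integral_compose_le) (auto intro: area)
  also have "\<dots> \<le> ennreal C * ennreal (8 * (2 * r) ^ 3 * M) + ennreal (8 * (2 * r) ^ 3 * M)"
    using r by (intro add_mono mult_left_mono nn_integral_box_osc) auto
  also have "\<dots> = ennreal (4 * r\<^sup>2) * ennreal (16 * (C + 1) * r * M)"
    using r C_pos M_nonneg
    by (simp add: ennreal_mult[symmetric] ennreal_plus[symmetric] power2_eq_square power3_eq_cube algebra_simps del: ennreal_plus)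
  finally show ?thesis
    using r by (subst (asm) ennreal_mult_le_mult_iff) auto
qed

lemma nn_integral_b_along_flow:
  assumes "s \<in> {0..T}"
  shows "(\<integral>\<^sup>+x. norm (b (F s x) - b x) \<partial>lborel) \<le> ennreal (32 * (C + 1) * T * M)"
proof -
  have "(\<integral>\<^sup>+x. norm (b (F s x) - b x) \<partial>lborel) \<le> ennreal (16 * (C + 1) * (2 * T) * M)"
  proof (rule nn_integral_displaced_b)
    show "norm (F s x - x) \<le> 2 * T" for x
      using F_lip[of s x 0] assms by simp
    show "emeasure lborel (F s -` A) \<le> ennreal C * emeasure lborel A" if "A \<in> sets borel" for A
      using X_area[OF assms that] F_eq[OF assms] by (simp add: vimage_def)
  qed (use T_pos in auto)
  then show ?thesis by (simp add: mult_ac)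
qed

lemma nn_integral_b_shifted:
  assumes "s \<in> {0..T}"
  shows "(\<integral>\<^sup>+x. norm (b (F s (x + d)) - b x) \<partial>lborel) \<le> ennreal (32 * (C + 1) * T * M + norm d * M)"
proof -
  have "(\<integral>\<^sup>+x. norm (b (F s (x + d)) - b x) \<partial>lborel) \<le> (\<integral>\<^sup>+x. ennreal (norm (b (F s (x + d)) - b (x + d))) + ennreal (norm (b (x + d) - b x)) \<partial>lborel)"
  proof (rule nn_integral_mono)
    fix x
    have "norm (b (F s (x + d)) - b x) \<le> norm (b (F s (x + d)) - b (x + d)) + norm (b (x + d) - b x)"
      using norm_triangle_ineq[of "b (F s (x + d)) - b (x + d)" "b (x + d) - b x"] by simp
    then show "ennreal (norm (b (F s (x + d)) - b x)) \<le> ennreal (norm (b (F s (x + d)) - b (x + d))) + ennreal (norm (b (x + d) - b x))"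
      by (simp add: ennreal_leI flip: ennreal_plus)
  qed
  also have "\<dots> = (\<integral>\<^sup>+x. ennreal (norm (b (F s (x + d)) - b (x + d))) \<partial>lborel) + (\<integral>\<^sup>+x. ennreal (norm (b (x + d) - b x)) \<partial>lborel)"
    by (rule nn_integral_add) measurable
  also have "(\<integral>\<^sup>+x. ennreal (norm (b (F s (x + d)) - b (x + d))) \<partial>lborel) = (\<integral>\<^sup>+x. ennreal (norm (b (F s x) - b x)) \<partial>lborel)"
    by (rule nn_integral_translate) measurable
  also have "\<dots> + (\<integral>\<^sup>+x. ennreal (norm (b (x + d) - b x)) \<partial>lborel) \<le> ennreal (32 * (C + 1) * T * M) + ennreal (norm d * M)"
    by (intro add_mono nn_integral_b_along_flow b_BV assms)
  also have "\<dots> = ennreal (32 * (C + 1) * T * M + norm d * M)"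
    using T_pos C_pos M_nonneg by (simp add: ennreal_plus[symmetric] del: ennreal_plus)
  finally show ?thesis .
qed

text \<open>The vector \<open>c\<close> will be \<open>b x\<close> for the trajectory of
  \<open>x\<close> and for that of \<open>x + d\<close> alike, so that the two uniform motions can
  be subtracted from each other.\<close>

definition osc :: "real \<Rightarrow> real \<Rightarrow> real \<times> real \<Rightarrow> real \<times> real \<Rightarrow> ennreal" where
  "osc s t y c = (\<integral>\<^sup>+r. indicator {s..t} r * ennreal (norm (b (F r y) - c)) \<partial>lborel)"

lemma osc_mono: "s' \<le> s \<Longrightarrow> t \<le> t' \<Longrightarrow> osc s t y c \<le> osc s' t' y c"
  unfolding osc_def by (intro nn_integral_mono mult_right_mono) (auto split: split_indicator)

lemma osc_le:
  assumes "norm c \<le> 2" "s \<le> t"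
  shows "osc s t y c \<le> ennreal (4 * (t - s))"
proof -
  have "norm (b (F r y) - c) \<le> 4" for r
    using norm_triangle_ineq4[of "b (F r y)" c] b_bound[of "F r y"] assms by simp
  then have "osc s t y c \<le> (\<integral>\<^sup>+r. 4 * indicator {s..t} r \<partial>(lborel :: real measure))"
    unfolding osc_def by (intro nn_integral_mono) (auto split: split_indicator simp flip: ennreal_numeral intro!: ennreal_leI)
  also have "\<dots> = ennreal 4 * ennreal (t - s)"
    using assms by (subst nn_integral_cmult_indicator) auto
  also have "\<dots> = ennreal (4 * (t - s))"
    by (rule ennreal_mult[symmetric]) (use assms in auto)
  finally show ?thesis .
qed

lemma osc_split:
  shows "osc s t y c \<le> osc s r y c + osc r t y c"
proof -
  have "osc s t y c \<le> (\<integral>\<^sup>+q. indicator {s..r} q * ennreal (norm (b (F q y) - c)) + indicator {r..t} q * ennreal (norm (b (F q y) - c)) \<partial>lborel)"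
    unfolding osc_def by (intro nn_integral_mono) (auto split: split_indicator)
  also have "\<dots> = osc s r y c + osc r t y c"
    unfolding osc_def by (rule nn_integral_add) measurable
  finally show ?thesis .
qed

lemma F_increment_osc:
  assumes "good y" "0 \<le> s" "s \<le> t" "t \<le> T"
  shows "ennreal (norm (F t y - F s y - (t - s) *\<^sub>R c)) \<le> osc s t y c"
proof -
  have m: "(\<lambda>r. b (F r y) - c) \<in> borel_measurable borel" by measurable
  have "norm (b (F r y) - c) \<le> 2 + norm c" for r
    using norm_triangle_ineq4[of "b (F r y)" c] b_bound[of "F r y"] by simp
  note int = set_integrable_bounded_Icc[OF m this]
  have cint: "set_integrable lborel {s..t} (\<lambda>r. c)"
    by (rule set_integrable_bounded_Icc[of _ "norm c"]) auto
  have "F t y - F s y - (t - s) *\<^sub>R c = (LINT r:{s..t}|lborel. b (F r y)) - (LINT r:{s..t}|lborel. c)"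
    using good_increment[OF assms] assms by (simp add: set_lebesgue_integral_def)
  also have "\<dots> = (LINT r:{s..t}|lborel. b (F r y) - c)"
    by (rule set_integral_diff(2)[OF b_F_integrable cint, symmetric])
  finally have "ennreal (norm (F t y - F s y - (t - s) *\<^sub>R c)) \<le> (\<integral>\<^sup>+r. ennreal (norm (indicator {s..t} r *\<^sub>R (b (F r y) - c))) \<partial>lborel)"
    unfolding set_lebesgue_integral_def
    using integral_norm_bound_ennreal[OF int[unfolded set_integrable_def]] by simp
  also have "\<dots> = osc s t y c"
    unfolding osc_def by (intro nn_integral_cong) (auto split: split_indicator)
  finally show ?thesis .
qed

lemma nn_integral_osc:
  assumes "0 \<le> s" "s \<le> t" "t \<le> T"
  shows "(\<integral>\<^sup>+x. osc s t (x + d) (b x) \<partial>lborel) \<le> ennreal ((t - s) * (32 * (C + 1) * T * M + norm d * M))"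
proof -
  have "(\<integral>\<^sup>+x. osc s t (x + d) (b x) \<partial>lborel)
    = (\<integral>\<^sup>+r. (\<integral>\<^sup>+x. indicator {s..t} r * ennreal (norm (b (F r (x + d)) - b x)) \<partial>lborel) \<partial>lborel)"
    unfolding osc_def by (rule nn_integral_swap_lborel) measurable
  also have "\<dots> \<le> (\<integral>\<^sup>+r. ennreal (32 * (C + 1) * T * M + norm d * M) * indicator {s..t} r \<partial>(lborel :: real measure))"
  proof (rule nn_integral_mono)
    fix r
    show "(\<integral>\<^sup>+x. indicator {s..t} r * ennreal (norm (b (F r (x + d)) - b x)) \<partial>lborel)
      \<le> ennreal (32 * (C + 1) * T * M + norm d * M) * indicator {s..t} r"
      using nn_integral_b_shifted[of r d] assms by (cases "r \<in> {s..t}") simp_all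
  qed
  also have "\<dots> = ennreal ((t - s) * (32 * (C + 1) * T * M + norm d * M))"
    using assms T_pos C_pos M_nonneg
    by (subst nn_integral_cmult_indicator) (auto simp: ennreal_mult'' mult.commute simp del: ennreal_plus)
  finally show ?thesis .
qed

section \<open>The displacement estimate\<close>

text \<open>The graphs are compared between \<open>h = fst (x + d)\<close> and the smaller final
  abscissa \<open>m\<close>; there \<open>gap\<close> controls the differences both of elapsed times
  and of height gains. Before that, \<open>x\<close> needs at most the time \<open>fst d\<close> to
  reach \<open>h\<close>, and after \<open>m\<close> at most one of the two trajectories has time
  left. In these layers the motion is replaced by uniform motion with velocity
  \<open>b x\<close>.\<close>

lemma displacement_pointwise:
  assumes good: "good x" "good (x + d)" and d: "0 \<le> fst d" "norm d < T"
  shows "ennreal (norm (F T (x + d) - F T x - d))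
    \<le> 7 * gap d x + osc (T - fst d) T (x + d) (b x) + osc 0 (fst d) x (b x)"
proof -
  define x' where "x' = x + d"
  define c where "c = b x"
  define h where "h = fst x'"
  define m where "m = min (fst (F T x)) (fst (F T x'))"
  define A where "A = (LINT h:{h..m}|lborel. norm (Gb (h, Y x' h) - Gb (h, Y x h)))"
  define a where "a = tau x m"
  define a' where "a' = tau x' m"
  define s where "s = tau x h"
  have dT: "fst d < T" using d abs_fst_le_norm[of d] by simp
  have c2: "norm c \<le> 2" by (simp add: c_def b_bound)
  have FT: "fst x + T \<le> fst (F T x)" "h + T \<le> fst (F T x')"
    using F_fst[of 0 T x] F_fst[of 0 T x'] T_pos by (auto simp: h_def)
  have hm: "h \<le> m" using FT dT T_pos by (auto simp: m_def h_def x'_def)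
  have s: "0 \<le> s" "s \<le> fst d"
    using tau_diff[of "fst x" h x] d by (auto simp: s_def h_def x'_def)
  have aT: "a \<le> T" "a' \<le> T" by (auto simp: a_def a'_def tau_le_iff m_def)
  have a0: "s \<le> a" "0 \<le> a'" using hm by (auto simp: a_def s_def a'_def tau_mono tau_nonneg_iff h_def)
  have aa': "a = T \<or> a' = T" by (cases "fst (F T x) \<le> fst (F T x')") (auto simp: a_def a'_def m_def)
  have Gint: "set_integrable lborel {h..m} (\<lambda>h. Gb (h, Y y h))" for y
    by (rule set_integrable_bounded_Icc[where K=3]) (auto simp: Gb_bound)
  define q where "q = (Y x' m - snd x') - (Y x m - Y x h)"
  have "(a' - (a - s), q) = (LINT h:{h..m}|lborel. Gb (h, Y x' h)) - (LINT h:{h..m}|lborel. Gb (h, Y x h))"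
  proof -
    have "(a - s, Y x m - Y x h) = (LINT h:{h..m}|lborel. Gb (h, Y x h))"
      using curve_equation[OF good(1), of h m] hm s(1) aT(1) by (simp add: a_def s_def)
    moreover have "(a', Y x' m - snd x') = (LINT h:{h..m}|lborel. Gb (h, Y x' h))"
      using curve_equation[OF good(2)[folded x'_def], of h m] hm aT(2) by (simp add: a'_def h_def)
    moreover have "(a' - (a - s), q) = (a', Y x' m - snd x') - (a - s, Y x m - Y x h)" by (simp add: q_def)
    ultimately show ?thesis by simp
  qed
  also have "\<dots> = (LINT h:{h..m}|lborel. Gb (h, Y x' h) - Gb (h, Y x h))"
    by (rule set_integral_diff(2)[OF Gint Gint, symmetric])
  finally have "norm (a' - (a - s), q) \<le> A"
    unfolding A_def using set_integral_norm_bound[OF set_integral_diff(1)[OF Gint Gint]] by simp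
  then have A: "\<bar>a' - (a - s)\<bar> \<le> A" "\<bar>q\<bar> \<le> A" "0 \<le> A"
    using abs_fst_le_norm[of "(a' - (a - s), q)"] abs_snd_le_norm[of "(a' - (a - s), q)"] by auto
  have A_gap: "ennreal A \<le> gap d x"
  proof -
    have "ennreal A = (\<integral>\<^sup>+k. ennreal (indicator {h..m} k *\<^sub>R norm (Gb (k, Y x' k) - Gb (k, Y x k))) \<partial>lborel)"
      unfolding A_def set_lebesgue_integral_def
      using set_integrable_norm[OF set_integral_diff(1)[OF Gint Gint]]
      by (intro nn_integral_eq_integral[symmetric]) (auto simp: set_integrable_def)
    also have "\<dots> \<le> gap d x"
      unfolding gap_def
    proof (rule nn_integral_mono)
      fix k
      have "tau x k \<in> {0..T}" "tau (x + d) k \<in> {0..T}" if "k \<in> {h..m}"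
        using that s a0 aT tau_mono[of x h k] tau_mono[of x k m] tau_mono[of x' k m]
        by (auto simp: a_def a'_def s_def h_def x'_def tau_nonneg_iff)
      then show "ennreal (indicator {h..m} k *\<^sub>R norm (Gb (k, Y x' k) - Gb (k, Y x k)))
       \<le> indicator {0..T} (tau x k) * indicator {0..T} (tau (x + d) k) * ennreal (norm (Gb (k, Y (x + d) k) - Gb (k, Y x k)))"
        by (auto simp: x'_def split: split_indicator)
    qed
    finally show ?thesis .
  qed
  define R where "R = F T x - F a x - (T - a) *\<^sub>R c"
  define R' where "R' = F T x' - F a' x' - (T - a') *\<^sub>R c"
  define R0 where "R0 = F s x - x - s *\<^sub>R c"
  \<comment> \<open>The trajectories are cut at \<open>m\<close>, and that of \<open>x\<close> also
    at \<open>h\<close>. The uniform motions over the times \<open>s\<close>, \<open>T - a\<close>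
    and \<open>T - a'\<close> combine to \<open>(a - s - a') *\<^sub>R c\<close>, which is small
    because the elapsed times between \<open>h\<close> and \<open>m\<close> nearly agree.\<close>
  have "F T x' - F T x - d = R' - R - R0 + ((a - s - a') *\<^sub>R c + (0, q))"
  proof -
    have "F a x = (m, Y x m)" "F a' x' = (m, Y x' m)" "F s x = (h, Y x h)"
      by (simp_all add: a_def a'_def s_def F_tau)
    then have pts: "F a x - F a' x' - F s x + (0, q) = - x'"
      by (simp add: q_def h_def prod_eq_iff)
    have times: "(a - s - a') *\<^sub>R c = (T - a') *\<^sub>R c - (T - a) *\<^sub>R c - s *\<^sub>R c"
      by (simp flip: scaleR_left_diff_distrib)
    have "R' - R - R0 + ((a - s - a') *\<^sub>R c + (0, q)) = F T x' - F T x + x + (F a x - F a' x' - F s x + (0, q))"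
      unfolding times R_def R'_def R0_def by simp
    also have "\<dots> = F T x' - F T x - d" unfolding pts by (simp add: x'_def)
    finally show ?thesis ..
  qed
  then have "norm (F T x' - F T x - d) \<le> norm R' + norm R + norm R0 + (norm ((a - s - a') *\<^sub>R c) + norm (0::real, q))"
    using norm_triangle_ineq[of "R' - R - R0" "(a - s - a') *\<^sub>R c + (0, q)"]
      norm_triangle_ineq[of "(a - s - a') *\<^sub>R c" "(0, q)"]
      norm_triangle_ineq4[of "R' - R" R0] norm_triangle_ineq4[of R' R] by simp
  also have "norm ((a - s - a') *\<^sub>R c) \<le> A * 2"
    using A c2 by (simp add: mult_mono abs_minus_commute)
  also have "norm (0::real, q) \<le> A" using A by simp
  finally have "norm (F T x' - F T x - d) \<le> norm R' + norm R + norm R0 + 3 * A" by simp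
  then have 1: "ennreal (norm (F T x' - F T x - d)) \<le> ennreal (norm R') + ennreal (norm R) + ennreal (norm R0) + 3 * ennreal A"
    using A by (simp add: ennreal_leI ennreal_mult'[symmetric] flip: ennreal_plus ennreal_numeral)
  have R: "ennreal (norm R) \<le> osc a T x c" unfolding R_def
    using a0 s aT good by (intro F_increment_osc) auto
  have R': "ennreal (norm R') \<le> osc a' T x' c" unfolding R'_def
    using a0 aT good by (intro F_increment_osc) (auto simp: x'_def)
  have R0: "ennreal (norm R0) \<le> osc 0 (fst d) x c"
    using F_increment_osc[OF good(1) order_refl s(1), of c] a0 aT s
    by (auto simp: R0_def intro: order_trans osc_mono)
  \<comment> \<open>One of the two remainders vanishes. If \<open>a = T\<close>, then
    \<open>x'\<close> has at most \<open>s + A\<close> of time left: \<open>fst d\<close>, which is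
    at least \<open>s\<close>, stays as an oscillation term, and the excess \<open>A\<close> costs
    at most 4 per unit of time. If \<open>a' = T\<close>, then \<open>x\<close> has at most
    \<open>A\<close> left.\<close>
  have 2: "ennreal (norm R') + ennreal (norm R) \<le> osc (T - fst d) T x' c + 4 * ennreal A"
  proof (cases "a = T")
    case True
    have "osc a' T x' c \<le> osc (T - fst d) T x' c + 4 * ennreal A"
    proof (cases "T - fst d \<le> a'")
      case True
      then show ?thesis by (intro order_trans[OF osc_mono[of "T - fst d" a' T T]]) auto
    next
      case False
      have "osc a' T x' c \<le> osc a' (T - fst d) x' c + osc (T - fst d) T x' c" by (rule osc_split)
      also have "osc a' (T - fst d) x' c \<le> ennreal (4 * (T - fst d - a'))"
        using False by (intro osc_le c2) auto
      also have "\<dots> \<le> ennreal (4 * A)" using A s True by (intro ennreal_leI) auto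
      finally show ?thesis by (simp add: ennreal_mult' add.commute)
    qed
    moreover have "R = 0" using True by (simp add: R_def)
    ultimately show ?thesis using R' by (auto intro: order_trans)
  next
    case False
    then have "a' = T" using aa' by simp
    then have "R' = 0" by (simp add: R'_def)
    moreover have "ennreal (norm R) \<le> ennreal (4 * (T - a))"
      by (rule order_trans[OF R osc_le[OF c2 aT(1)]])
    moreover have "ennreal (4 * (T - a)) \<le> ennreal (4 * A)"
      using A s \<open>a' = T\<close> by (intro ennreal_leI) auto
    ultimately show ?thesis by (auto simp: ennreal_mult' intro: order_trans add_increasing)
  qed
  have "ennreal (norm (F T x' - F T x - d)) \<le> (osc (T - fst d) T x' c + 4 * ennreal A) + osc 0 (fst d) x c + 3 * ennreal A"
    by (rule order_trans[OF 1]) (intro add_mono 2 R0 order_refl)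
  \<comment> \<open>The 7 is 4 for the excess time and 3 for the discrepancies of time, weighted by
    \<open>norm c <= 2\<close>, and of height.\<close>
  also have "\<dots> = 7 * ennreal A + osc (T - fst d) T x' c + osc 0 (fst d) x c"
  proof -
    have seven: "7 * ennreal A = 4 * ennreal A + 3 * ennreal A" by (simp flip: distrib_right)
    show ?thesis unfolding seven by (simp only: add_ac)
  qed
  also have "\<dots> \<le> 7 * gap d x + osc (T - fst d) T x' c + osc 0 (fst d) x c"
    by (intro add_right_mono mult_left_mono A_gap) auto
  finally show ?thesis by (simp add: x'_def c_def)
qed

text \<open>When \<open>T <= norm d\<close>, comparing both motions over all of
  \<open>[0, T]\<close> with uniform motion at velocity \<open>b x\<close> already has the right
  size. The constant collects \<open>7 * 48\<close> from \<open>gap\<close>,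
  \<open>2 * 32 * (C + 1)\<close> from the two layers, and 1 from the shift of the field by
  \<open>d\<close>.\<close>

lemma nn_integral_displacement_forward:
  assumes d: "0 \<le> fst d"
  shows "(\<integral>\<^sup>+x. norm (F T (x + d) - F T x - d) \<partial>lborel) \<le> ennreal ((401 + 64 * C) * norm d * (T + norm d) * M)"
proof (cases "norm d < T")
  case True
  have dT: "fst d \<le> T" "fst d \<le> norm d" using d True abs_fst_le_norm[of d] by auto
  have "(\<integral>\<^sup>+x. norm (F T (x + d) - F T x - d) \<partial>lborel) \<le>
     (\<integral>\<^sup>+x. 7 * gap d x + osc (T - fst d) T (x + d) (b x) + osc 0 (fst d) (x + 0) (b x) \<partial>lborel)"
    using AE_good AE_translate_lborel[OF AE_good, of d]
    by (intro nn_integral_mono_AE, eventually_elim) (use d True displacement_pointwise in simp)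
  also have "\<dots> = 7 * (\<integral>\<^sup>+x. gap d x \<partial>lborel) + (\<integral>\<^sup>+x. osc (T - fst d) T (x + d) (b x) \<partial>lborel) + (\<integral>\<^sup>+x. osc 0 (fst d) (x + 0) (b x) \<partial>lborel)"
    unfolding osc_def by (simp add: nn_integral_add nn_integral_cmult)
  also have "\<dots> \<le> 7 * ennreal (48 * T * norm d * M) + ennreal ((T - (T - fst d)) * (32 * (C + 1) * T * M + norm d * M))
     + ennreal ((fst d - 0) * (32 * (C + 1) * T * M + norm (0 :: real \<times> real) * M))"
    using d dT by (intro add_mono mult_left_mono nn_integral_gap nn_integral_osc) auto
  also have "\<dots> = ennreal (336 * T * norm d * M + fst d * (64 * (C + 1) * T * M + norm d * M))"
    using d T_pos C_pos M_nonneg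
    by (simp add: ennreal_mult'[symmetric] ennreal_plus[symmetric] del: ennreal_plus flip: ennreal_numeral) (simp add: algebra_simps)
  also have "\<dots> \<le> ennreal ((401 + 64 * C) * norm d * (T + norm d) * M)"
  proof (rule ennreal_leI)
    have "fst d * (64 * (C + 1) * T * M + norm d * M) \<le> norm d * (64 * (C + 1) * T * M + norm d * M)"
      using dT T_pos C_pos M_nonneg by (intro mult_right_mono) auto
    moreover have "0 \<le> norm d * norm d * M * (400 + 64 * C)" "0 \<le> T * norm d * M"
      using T_pos C_pos M_nonneg by auto
    ultimately show "336 * T * norm d * M + fst d * (64 * (C + 1) * T * M + norm d * M) \<le> (401 + 64 * C) * norm d * (T + norm d) * M"
      by (simp add: algebra_simps)
  qed
  finally show ?thesis .
next
  case False
  have "(\<integral>\<^sup>+x. norm (F T (x + d) - F T x - d) \<partial>lborel) \<le>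
     (\<integral>\<^sup>+x. osc 0 T (x + d) (b x) + osc 0 T (x + 0) (b x) \<partial>lborel)"
    using AE_good AE_translate_lborel[OF AE_good, of d]
  proof (intro nn_integral_mono_AE, eventually_elim)
    fix x assume good: "good x" "good (x + d)"
    have "F T (x + d) - F T x - d = (F T (x + d) - F 0 (x + d) - (T - 0) *\<^sub>R b x) - (F T x - F 0 x - (T - 0) *\<^sub>R b x)"
      by simp
    then have "norm (F T (x + d) - F T x - d) \<le> norm (F T (x + d) - F 0 (x + d) - (T - 0) *\<^sub>R b x) + norm (F T x - F 0 x - (T - 0) *\<^sub>R b x)"
      by (metis norm_triangle_ineq4)
    then have "ennreal (norm (F T (x + d) - F T x - d)) \<le> ennreal (norm (F T (x + d) - F 0 (x + d) - (T - 0) *\<^sub>R b x)) + ennreal (norm (F T x - F 0 x - (T - 0) *\<^sub>R b x))"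
      by (simp add: ennreal_leI flip: ennreal_plus)
    also have "\<dots> \<le> osc 0 T (x + d) (b x) + osc 0 T x (b x)"
      using good T_pos by (intro add_mono F_increment_osc) auto
    finally show "ennreal (norm (F T (x + d) - F T x - d)) \<le> osc 0 T (x + d) (b x) + osc 0 T (x + 0) (b x)" by simp
  qed
  also have "\<dots> = (\<integral>\<^sup>+x. osc 0 T (x + d) (b x) \<partial>lborel) + (\<integral>\<^sup>+x. osc 0 T (x + 0) (b x) \<partial>lborel)"
    unfolding osc_def by (simp add: nn_integral_add)
  also have "\<dots> \<le> ennreal ((T - 0) * (32 * (C + 1) * T * M + norm d * M)) + ennreal ((T - 0) * (32 * (C + 1) * T * M + norm (0 :: real \<times> real) * M))"
    using T_pos by (intro add_mono nn_integral_osc) auto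
  also have "\<dots> = ennreal (T * (64 * (C + 1) * T * M + norm d * M))"
    using T_pos C_pos M_nonneg
    by (simp add: ennreal_plus[symmetric] del: ennreal_plus) (simp add: algebra_simps)
  also have "\<dots> \<le> ennreal ((401 + 64 * C) * norm d * (T + norm d) * M)"
  proof (rule ennreal_leI)
    have "T * (64 * (C + 1) * T * M + norm d * M) \<le> norm d * (64 * (C + 1) * T * M + norm d * M)"
      using False T_pos C_pos M_nonneg by (intro mult_right_mono) auto
    moreover have "0 \<le> norm d * norm d * M * (400 + 64 * C)" "0 \<le> T * norm d * M"
      using T_pos C_pos M_nonneg by auto
    ultimately show "T * (64 * (C + 1) * T * M + norm d * M) \<le> (401 + 64 * C) * norm d * (T + norm d) * M"
      by (simp add: algebra_simps)
  qed
  finally show ?thesis .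
qed

theorem nn_integral_displacement:
  "(\<integral>\<^sup>+x. norm (X T (x + d) - X T x - d) \<partial>lborel) \<le> ennreal ((401 + 64 * C) * norm d * (T + norm d) * M)"
proof -
  have F_X: "F T = X T" using T_pos F_eq[of T] by auto
  have "(\<integral>\<^sup>+x. norm (F T (x + d) - F T x - d) \<partial>lborel) \<le> ennreal ((401 + 64 * C) * norm d * (T + norm d) * M)"
  proof (cases "0 \<le> fst d")
    case False
    \<comment> \<open>For \<open>fst d < 0\<close> the two starting points exchange their roles:
      \<open>x\<close> is \<open>x + d\<close> shifted by \<open>- d\<close>, and the integral is
      translation invariant.\<close>
    have "(\<integral>\<^sup>+x. norm (F T (x + d) - F T x - d) \<partial>lborel) = (\<integral>\<^sup>+x. norm (F T ((x + d) + (- d)) - F T (x + d) - (- d)) \<partial>lborel)"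
    proof (rule nn_integral_cong)
      fix x
      show "ennreal (norm (F T (x + d) - F T x - d)) = ennreal (norm (F T ((x + d) + (- d)) - F T (x + d) - (- d)))"
        using norm_minus_cancel[of "F T (x + d) - F T x - d"] by (simp add: algebra_simps)
    qed
    also have "\<dots> = (\<integral>\<^sup>+x. norm (F T (x + (- d)) - F T x - (- d)) \<partial>lborel)"
      by (rule nn_integral_translate[where f="\<lambda>x. ennreal (norm (F T (x + (- d)) - F T x - (- d)))"]) measurable
    also have "\<dots> \<le> ennreal ((401 + 64 * C) * norm (- d) * (T + norm (- d)) * M)"
      using False by (intro nn_integral_displacement_forward) simp
    finally show ?thesis by simp
  qed (rule nn_integral_displacement_forward)
  then show ?thesis by (simp add: F_X)
qed

end

section \<open>Injectivity of maps with positive Jacobian\<close>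

text \<open>At a simple zero, \<open>f z / (z - a)\<close> stays in an open half-plane missing \<open>0\<close>; all that is
  needed of the topological index is contained in this property.\<close>

definition simple_zero :: "(complex \<Rightarrow> complex) \<Rightarrow> complex \<Rightarrow> bool" where
  "simple_zero f a \<longleftrightarrow> f a = 0 \<and> (\<exists>\<alpha> \<kappa> r. \<alpha> \<noteq> 0 \<and> \<kappa> < 1 \<and> 0 < r \<and>
     (\<forall>z. z \<noteq> a \<longrightarrow> norm (z - a) < r \<longrightarrow> norm (f z / (\<alpha> * (z - a)) - 1) \<le> \<kappa>))"

text \<open>Near \<open>a\<close> the factor \<open>1 / (z - c)\<close> is almost the constant
  \<open>1 / (a - c)\<close>, which is absorbed into \<open>\<alpha>\<close>; a small enough
  neighbourhood keeps the deviation below 1.\<close>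

lemma simple_zero_divide:
  assumes f: "simple_zero f a" and ne: "a \<noteq> c" and e: "0 < e"
    and g: "\<And>z. norm (z - a) < e \<Longrightarrow> g z = f z / (z - c)"
  shows "simple_zero g a"
proof -
  obtain \<alpha> \<kappa> r where *: "f a = 0" "\<alpha> \<noteq> 0" "\<kappa> < 1" "0 < r"
    "\<And>z. z \<noteq> a \<Longrightarrow> norm (z - a) < r \<Longrightarrow> norm (f z / (\<alpha> * (z - a)) - 1) \<le> \<kappa>"
    using f unfolding simple_zero_def by blast
  \<comment> \<open>With this choice \<open>\<kappa> + 2 * \<eta>\<close> is the midpoint between
    \<open>\<kappa>\<close> and 1.\<close>
  define \<eta> where "\<eta> = (1 - \<kappa>) / 4"
  have \<eta>: "0 < \<eta>" using * by (simp add: \<eta>_def)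
  have "((\<lambda>z. (a - c) / (z - c)) \<longlongrightarrow> (a - c) / (a - c)) (at a)"
    using ne by (intro tendsto_intros) auto
  then have "((\<lambda>z. (a - c) / (z - c)) \<longlongrightarrow> 1) (at a)" using ne by simp
  from LIM_D[OF this \<eta>] obtain s where s: "0 < s"
    "\<And>z. z \<noteq> a \<Longrightarrow> norm (z - a) < s \<Longrightarrow> norm ((a - c) / (z - c) - 1) < \<eta>" by auto
  define t where "t = min (min r s) (min e (norm (a - c)))"
  have t: "0 < t" using * s e ne by (simp add: t_def)
  have "norm (g z / (\<alpha> / (a - c) * (z - a)) - 1) \<le> \<kappa> + 2 * \<eta>" if z: "z \<noteq> a" "norm (z - a) < t" for z
  proof -
    define u where "u = f z / (\<alpha> * (z - a))"
    define v where "v = (a - c) / (z - c)"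
    have zc: "z \<noteq> c" using z by (auto simp: t_def norm_minus_commute)
    have u: "norm (u - 1) \<le> \<kappa>" and v: "norm (v - 1) < \<eta>"
      using *(5)[of z] s(2)[of z] z by (auto simp: u_def v_def t_def)
    have "g z / (\<alpha> / (a - c) * (z - a)) = u * v"
      using g[of z] z ne zc * by (simp add: u_def v_def t_def divide_simps)
    also have "u * v - 1 = (u - 1) + (u - 1) * (v - 1) + (v - 1)" by (simp add: algebra_simps)
    finally have "norm (g z / (\<alpha> / (a - c) * (z - a)) - 1) \<le> norm (u - 1) + norm (u - 1) * norm (v - 1) + norm (v - 1)"
      by (metis (no_types, lifting) norm_mult norm_triangle_le norm_triangle_ineq add_right_mono)
    also have "\<dots> \<le> \<kappa> + 1 * \<eta> + \<eta>"
      using u v * by (intro add_mono mult_mono) auto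
    finally show ?thesis by simp
  qed
  moreover have "\<kappa> + 2 * \<eta> < 1" using * by (simp add: \<eta>_def field_simps)
  moreover have "g a = 0" using g[of a] e * by simp
  moreover have "\<alpha> / (a - c) \<noteq> 0" using * ne by simp
  ultimately show ?thesis unfolding simple_zero_def using t by blast
qed

text \<open>The quotient \<open>f z / (z - a)\<close> need not have a limit at \<open>a\<close>. It
  is \<open>\<alpha> * (1 + u z)\<close> with \<open>norm (u z) < 1\<close> near \<open>a\<close>;
  damping \<open>u\<close> by a factor that grows from 0 at \<open>a\<close> to 1 at distance
  \<open>s\<close> gives a continuous function without zeros near \<open>a\<close> that agrees with
  the quotient farther out.\<close>

lemma divide_out_simple_zero:
  assumes cont: "continuous_on UNIV f" and f: "simple_zero f a" and e: "0 < e"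
  obtains g where "continuous_on UNIV g" "g a \<noteq> 0"
    "\<And>z. z \<noteq> a \<Longrightarrow> g z = 0 \<longleftrightarrow> f z = 0"
    "\<And>z. e \<le> norm (z - a) \<Longrightarrow> g z = f z / (z - a)"
proof -
  obtain \<alpha> \<kappa> r where *: "f a = 0" "\<alpha> \<noteq> 0" "\<kappa> < 1" "0 < r"
    "\<And>z. z \<noteq> a \<Longrightarrow> norm (z - a) < r \<Longrightarrow> norm (f z / (\<alpha> * (z - a)) - 1) \<le> \<kappa>"
    using f unfolding simple_zero_def by blast
  define s where "s = min (r / 2) e"
  have s: "0 < s" "s < r" "s \<le> e" using * e by (auto simp: s_def min_def)
  define u where "u z = f z / (\<alpha> * (z - a)) - 1" for z
  define m where "m z = min 1 (norm (z - a) / s)" for z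
  define g where "g z = \<alpha> * (1 + of_real (m z) * u z)" for z
  have u_cont: "continuous_on (- {a}) u"
    unfolding u_def using *(2) by (intro continuous_intros continuous_on_subset[OF cont]) auto
  have "isCont g z" for z
  proof (cases "z = a")
    case False
    have "continuous_on (- {a}) g"
      unfolding g_def m_def using s by (intro continuous_intros u_cont) auto
    then show ?thesis using False by (simp add: continuous_on_eq_continuous_at open_Compl)
  next
    case True
    have "((\<lambda>z. of_real (m z) * u z) \<longlongrightarrow> 0) (at a)"
    proof (rule Lim_null_comparison)
      have "\<forall>\<^sub>F z in at a. z \<noteq> a \<and> norm (z - a) < r"
        using *(4) by (auto simp: eventually_at dist_norm)
      then show "\<forall>\<^sub>F z in at a. norm (of_real (m z) * u z) \<le> norm (z - a) / s"
      proof eventually_elim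
        case (elim z)
        have "norm (of_real (m z) * u z) \<le> (norm (z - a) / s) * 1"
          unfolding norm_mult using *(5)[of z] *(3) elim s
          by (intro mult_mono) (auto simp: m_def u_def)
        then show ?case by simp
      qed
      show "((\<lambda>z. norm (z - a) / s) \<longlongrightarrow> 0) (at a)"
        using s by (auto intro!: tendsto_eq_intros)
    qed
    then have "(g \<longlongrightarrow> \<alpha> * (1 + 0)) (at a)" unfolding g_def by (intro tendsto_intros)
    then show ?thesis using True by (simp add: isCont_def g_def m_def)
  qed
  then have g_cont: "continuous_on UNIV g" by (simp add: continuous_on_eq_continuous_at)
  have g_a: "g a \<noteq> 0" using * by (simp add: g_def m_def)
  have far: "g z = f z / (z - a)" if "s \<le> norm (z - a)" for z
  proof -
    have "m z = 1" using that s by (simp add: m_def)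
    then show ?thesis using * by (simp add: g_def u_def)
  qed
  have near: "g z \<noteq> 0" "f z \<noteq> 0" if "z \<noteq> a" "norm (z - a) < r" for z
  proof -
    have u: "norm (u z) < 1" using *(5)[OF that] *(3) by (simp add: u_def)
    then have "norm (of_real (m z) * u z) < 1"
      unfolding norm_mult using s by (auto simp: m_def intro!: mult_left_le_one_le[THEN le_less_trans])
    then have "1 + of_real (m z) * u z \<noteq> 0"
      by (metis add.inverse_unique less_irrefl norm_minus_cancel norm_one)
    then show "g z \<noteq> 0" using * by (simp add: g_def)
    show "f z \<noteq> 0" using u by (auto simp: u_def)
  qed
  have "g z = 0 \<longleftrightarrow> f z = 0" if "z \<noteq> a" for z
    using near[of z] far[of z] that s by (cases "norm (z - a) < r") auto
  then show ?thesis
    using s(3) far by (intro that[OF g_cont g_a]) (blast, force)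
qed

text \<open>A winding number argument. Along the circle the difference \<open>q\<close> between the
  supposed logarithm and the obvious one has imaginary part in a discrete set, so this part is
  constant; but over a full turn the obvious logarithm gains \<open>2 * pi * m\<close> in its
  imaginary part.\<close>

lemma no_logarithm_of_power:
  fixes k :: "complex \<Rightarrow> complex"
  assumes R: "0 < R" and m: "0 < m" and k: "continuous_on (sphere 0 R) k"
    and eq: "\<And>z. norm z = R \<Longrightarrow> z ^ m = exp (k z)"
  shows False
proof -
  define q where "q t = k (of_real R * exp (\<i> * of_real t)) - \<i> * of_real (real m * t) - of_real (real m * ln R)" for t
  have q_cont: "continuous_on {0..2*pi} (\<lambda>t. Im (q t) / (2 * pi))"
    unfolding q_def using R
    by (intro continuous_intros continuous_on_compose2[OF k]) (auto simp: norm_mult)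
  have "Im (q t) / (2 * pi) \<in> \<int>" for t
  proof -
    have "exp (q t) = exp (k (of_real R * exp (\<i> * of_real t))) / exp (\<i> * of_real (real m * t)) / exp (of_real (real m * ln R))"
      by (simp add: q_def exp_diff)
    also have "exp (k (of_real R * exp (\<i> * of_real t))) = (of_real R * exp (\<i> * of_real t)) ^ m"
      using R by (subst eq) (auto simp: norm_mult)
    also have "\<dots> = of_real R ^ m * exp (\<i> * of_real (real m * t))"
      by (simp add: power_mult_distrib exp_of_nat_mult[symmetric] mult_ac)
    also have "complex_of_real R ^ m = exp (of_real (real m * ln R))"
      using R by (simp add: exp_of_real exp_of_nat_mult flip: of_real_power)
    finally have "exp (q t) = 1" by simp
    then obtain n :: int where "Im (q t) = of_int (2 * n) * pi" by (auto simp: exp_eq_1)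
    then have "Im (q t) / (2 * pi) = of_int n" by simp
    then show ?thesis by simp
  qed
  note ints = this
  have "(\<lambda>t. Im (q t) / (2 * pi)) constant_on {0..2*pi}"
  proof (rule continuous_discrete_range_constant[OF _ q_cont])
    fix t
    show "\<exists>e>0. \<forall>y. y \<in> {0..2*pi} \<and> Im (q y) / (2 * pi) \<noteq> Im (q t) / (2 * pi) \<longrightarrow>
        e \<le> norm (Im (q y) / (2 * pi) - Im (q t) / (2 * pi))"
    proof (intro exI[of _ 1] conjI allI impI)
      fix y assume y: "y \<in> {0..2*pi} \<and> Im (q y) / (2 * pi) \<noteq> Im (q t) / (2 * pi)"
      show "1 \<le> norm (Im (q y) / (2 * pi) - Im (q t) / (2 * pi))"
        unfolding real_norm_def
        by (rule Ints_nonzero_abs_ge1[OF Ints_diff[OF ints[of y] ints[of t]]]) (use y in linarith)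
    qed simp
  qed simp
  then have "Im (q (2 * pi)) / (2 * pi) = Im (q 0) / (2 * pi)"
    unfolding constant_on_def by (metis atLeastAtMost_iff order_refl pi_ge_zero zero_le_mult_iff zero_le_numeral)
  then have "Im (q (2 * pi)) = Im (q 0)" by simp
  moreover have "exp (\<i> * of_real (2 * pi)) = 1" by (simp add: exp_eq_1)
  ultimately show False using m by (simp add: q_def)
qed

text \<open>A second zero close to \<open>a\<close> would make
  \<open>f z / (\<alpha> * (z - a)) - 1\<close> equal to \<open>- 1\<close>, whose norm exceeds
  \<open>\<kappa>\<close>. So zeros are isolated, and they form a compact set.\<close>

lemma finite_simple_zeros:
  assumes cont: "continuous_on UNIV f" and bdd: "bounded {z. f z = 0}"
    and simple: "\<And>a. f a = 0 \<Longrightarrow> simple_zero f a"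
  shows "finite {z. f z = 0}"
proof (rule ccontr)
  assume inf: "infinite {z. f z = 0}"
  have "closed {z. f z = 0}" using continuous_closed_preimage_constant[OF cont closed_UNIV, of 0] by simp
  then have "compact {z. f z = 0}" using bdd by (simp add: compact_eq_bounded_closed)
  then obtain a where a: "f a = 0" "a islimpt {z. f z = 0}"
    using inf unfolding compact_eq_Bolzano_Weierstrass by blast
  obtain \<alpha> \<kappa> r where *: "\<alpha> \<noteq> 0" "\<kappa> < 1" "0 < r"
    "\<And>z. z \<noteq> a \<Longrightarrow> norm (z - a) < r \<Longrightarrow> norm (f z / (\<alpha> * (z - a)) - 1) \<le> \<kappa>"
    using simple[OF a(1)] unfolding simple_zero_def by blast
  obtain z where "f z = 0" "z \<noteq> a" "dist z a < r"
    using a(2) *(3) unfolding islimpt_approachable by auto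
  then show False using *(4)[of z] *(2) by (simp add: dist_norm)
qed

text \<open>Dividing out a zero modifies the quotient near that zero, so the factorisation survives
  only for large \<open>norm z\<close>. This is enough for a count on a large circle.\<close>

lemma divide_out_simple_zeros:
  assumes "finite A" "continuous_on UNIV f" "{z. f z = 0} = A" "\<And>a. a \<in> A \<Longrightarrow> simple_zero f a"
  shows "\<exists>g R. continuous_on UNIV g \<and> (\<forall>z. g z \<noteq> 0) \<and> (\<forall>z. R \<le> norm z \<longrightarrow> f z = g z * (\<Prod>a\<in>A. z - a))"
  using assms
proof (induction A arbitrary: f rule: finite_induct)
  case empty
  then show ?case by (intro exI[of _ f] exI[of _ 0]) auto
next
  case (insert a A)
  \<comment> \<open>Half the distance to the other zeros: around each of them the new function is
    exactly \<open>f z / (z - a)\<close>, so \<open>simple_zero_divide\<close> applies.\<close>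
  obtain e where e: "0 < e" "\<And>c. c \<in> A \<Longrightarrow> 2 * e \<le> norm (c - a)"
  proof -
    obtain d where "0 < d" "\<forall>x\<in>A. x \<noteq> a \<longrightarrow> d \<le> dist a x"
      using finite_set_avoid[OF insert.hyps(1), of a] by blast
    then show ?thesis using that[of "d / 2"] insert.hyps(2) by (force simp: dist_norm norm_minus_commute)
  qed
  obtain g where g: "continuous_on UNIV g" "g a \<noteq> 0" "\<And>z. z \<noteq> a \<Longrightarrow> g z = 0 \<longleftrightarrow> f z = 0"
    "\<And>z. e \<le> norm (z - a) \<Longrightarrow> g z = f z / (z - a)"
    using divide_out_simple_zero[OF insert.prems(1) insert.prems(3)[of a] e(1)] by blast
  have "simple_zero g c" if "c \<in> A" for c
  proof (rule simple_zero_divide[of f c a e])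
    show "simple_zero f c" using insert.prems(3) that by blast
    show "c \<noteq> a" using that insert.hyps by blast
    fix z assume "norm (z - c) < e"
    then have "e \<le> norm (z - a)"
      using e(2)[OF that] norm_triangle_ineq4[of "z - a" "z - c"] by simp
    then show "g z = f z / (z - a)" by (rule g(4))
  qed (rule e)
  moreover have "{z. g z = 0} = A" 
    using g(2,3) insert.prems(2) insert.hyps(2) by (intro set_eqI) (metis (mono_tags) insert_iff mem_Collect_eq)
  ultimately obtain G R where G: "continuous_on UNIV G" "\<And>z. G z \<noteq> 0"
    "\<And>z. R \<le> norm z \<Longrightarrow> g z = G z * (\<Prod>c\<in>A. z - c)"
    using insert.IH[OF g(1)] by blast
  have "f z = G z * (\<Prod>c\<in>insert a A. z - c)" if "max R (norm a + e) \<le> norm z" for z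
  proof -
    have "e \<le> norm (z - a)" using that norm_triangle_ineq2[of z a] by simp
    moreover from this have "z \<noteq> a" using e by auto
    ultimately have "f z = (z - a) * (G z * (\<Prod>c\<in>A. z - c))"
      using g(4)[of z] G(3)[of z] that by simp
    then show ?thesis using insert.hyps by (simp add: mult_ac)
  qed
  then show ?case using G by blast
qed

lemma continuous_log_near_one:
  fixes u :: "complex \<Rightarrow> complex"
  assumes "continuous_on S u" "\<And>z. z \<in> S \<Longrightarrow> norm (u z - 1) < 1"
  shows "continuous_on S (\<lambda>z. Ln (u z))" "\<And>z. z \<in> S \<Longrightarrow> exp (Ln (u z)) = u z"
proof -
  have pos: "0 < Re (u z)" if "z \<in> S" for z
    using assms(2)[OF that] abs_Re_le_cmod[of "u z - 1"] by simp
  show "continuous_on S (\<lambda>z. Ln (u z))"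
    by (rule continuous_on_Ln'[OF assms(1)]) (use pos in \<open>force simp: complex_nonpos_Reals_iff\<close>)
  show "\<And>z. z \<in> S \<Longrightarrow> exp (Ln (u z)) = u z"
    using pos by (metis exp_Ln less_irrefl zero_complex.sel(1))
qed

text \<open>The zeros are counted by degree. Once all are divided out, \<open>g\<close> vanishes
  nowhere and has a continuous logarithm on the plane. On a large circle \<open>f z / z\<close> and
  all \<open>(z - a) / z\<close> have distance less than 1 from 1, hence logarithms as well.
  Together these give a logarithm of \<open>z ^ (card A - 1)\<close>, which is impossible for a
  positive exponent.\<close>

lemma at_most_one_simple_zero:
  assumes cont: "continuous_on UNIV f" and near: "\<And>z. norm (f z - z) \<le> K"
    and simple: "\<And>a. f a = 0 \<Longrightarrow> simple_zero f a"
    and "f a = 0" "f c = 0"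
  shows "a = c"
proof (rule ccontr)
  assume ne: "a \<noteq> c"
  define A where "A = {z. f z = 0}"
  have A_bound: "norm z \<le> K" if "z \<in> A" for z using near[of z] that by (simp add: A_def)
  then have "bounded A" by (auto simp: bounded_iff)
  then have fin: "finite A" unfolding A_def by (rule finite_simple_zeros[OF cont]) (rule simple)
  have "card {a, c} \<le> card A" using fin assms by (intro card_mono) (auto simp: A_def)
  then have card: "2 \<le> card A" using ne by simp
  obtain g R0 where g: "continuous_on UNIV g" "\<And>z. g z \<noteq> 0"
    "\<And>z. R0 \<le> norm z \<Longrightarrow> f z = g z * (\<Prod>a\<in>A. z - a)"
  proof -
    have "\<exists>g R. continuous_on UNIV g \<and> (\<forall>z. g z \<noteq> 0) \<and> (\<forall>z. R \<le> norm z \<longrightarrow> f z = g z * (\<Prod>a\<in>A. z - a))"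
      by (rule divide_out_simple_zeros[OF fin cont]) (auto simp: A_def simple)
    then show ?thesis by (elim exE conjE) (rule that, auto)
  qed
  obtain h where h: "continuous_on UNIV h" "\<And>z. g z = exp (h z)"
    by (rule continuous_logarithm_on_contractible[OF g(1) contractible_UNIV]) (auto simp: g(2))
  define R where "R = max R0 (K + 1)"
  have "0 \<le> K" by (rule order_trans[OF norm_ge_zero near[of 0]])
  then have R: "0 < R" "R0 \<le> R" "K < R" by (auto simp: R_def)
  let ?S = "sphere (0::complex) R"
  have f_log: "continuous_on ?S (\<lambda>z. Ln (f z / z))" "\<And>z. z \<in> ?S \<Longrightarrow> exp (Ln (f z / z)) = f z / z"
  proof -
    have "norm (f z / z - 1) < 1" if "z \<in> ?S" for z
    proof -
      have "f z / z - 1 = (f z - z) / z" using that R by (auto simp: field_simps)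
      then show ?thesis using near[of z] that R by (simp add: norm_divide divide_less_eq)
    qed
    moreover have "continuous_on ?S (\<lambda>z. f z / z)"
      using R by (intro continuous_intros continuous_on_subset[OF cont]) auto
    ultimately show "continuous_on ?S (\<lambda>z. Ln (f z / z))" "\<And>z. z \<in> ?S \<Longrightarrow> exp (Ln (f z / z)) = f z / z"
      using continuous_log_near_one[of ?S "\<lambda>z. f z / z"] by auto
  qed
  have a_log: "continuous_on ?S (\<lambda>z. Ln ((z - a) / z))" "\<And>z. z \<in> ?S \<Longrightarrow> exp (Ln ((z - a) / z)) = (z - a) / z"
    if aA: "a \<in> A" for a
  proof -
    have "norm ((z - a) / z - 1) < 1" if z: "z \<in> ?S" for z
    proof -
      have "(z - a) / z - 1 = (- a) / z" using z R by (auto simp: field_simps)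
      then show ?thesis using A_bound[OF aA] z R by (simp add: norm_divide divide_less_eq)
    qed
    moreover have "continuous_on ?S (\<lambda>z. (z - a) / z)"
      using R by (intro continuous_intros) auto
    ultimately show "continuous_on ?S (\<lambda>z. Ln ((z - a) / z))" "\<And>z. z \<in> ?S \<Longrightarrow> exp (Ln ((z - a) / z)) = (z - a) / z"
      using continuous_log_near_one[of ?S "\<lambda>z. (z - a) / z"] by auto
  qed
  show False
  proof (rule no_logarithm_of_power[OF R(1), of "card A - 1" "\<lambda>z. Ln (f z / z) - h z - (\<Sum>a\<in>A. Ln ((z - a) / z))"])
    show "0 < card A - 1" using card by simp
    show "continuous_on ?S (\<lambda>z. Ln (f z / z) - h z - (\<Sum>a\<in>A. Ln ((z - a) / z)))"
      by (intro continuous_intros f_log a_log continuous_on_subset[OF h(1)]) auto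
    fix z :: complex assume z: "norm z = R"
    then have zS: "z \<in> ?S" and z0: "z \<noteq> 0" using R by auto
    have fz: "f z = g z * (\<Prod>a\<in>A. z - a)" using g(3)[of z] z R by simp
    have fz0: "(\<Prod>a\<in>A. z - a) \<noteq> 0"
      using A_bound z R fin by force
    have "exp (Ln (f z / z) - h z - (\<Sum>a\<in>A. Ln ((z - a) / z))) = f z / z / g z / (\<Prod>a\<in>A. (z - a) / z)"
      using f_log(2)[OF zS] a_log(2)[OF _ zS] by (simp add: exp_diff exp_sum[OF fin] h(2))
    also have "(\<Prod>a\<in>A. (z - a) / z) = (\<Prod>a\<in>A. z - a) / z ^ card A"
      by (simp add: prod_dividef)
    also have "f z / z / g z / ((\<Prod>a\<in>A. z - a) / z ^ card A) = z ^ card A / z"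
      using fz fz0 g(2)[of z] z0 by (simp add: divide_simps)
    also have "\<dots> = z ^ (card A - 1)"
      using z0 card by (simp add: power_diff)
    finally show "z ^ (card A - 1) = exp (Ln (f z / z) - h z - (\<Sum>a\<in>A. Ln ((z - a) / z)))" ..
  qed
qed

section \<open>Maps of the plane in complex notation\<close>

definition vec_to_complex :: "real^2 \<Rightarrow> complex" where "vec_to_complex v = Complex (v$1) (v$2)"

definition complex_to_vec :: "complex \<Rightarrow> real^2" where "complex_to_vec z = vector [Re z, Im z]"

lemma vec_to_complex_inverse [simp]: "vec_to_complex (complex_to_vec z) = z"
  by (simp add: vec_to_complex_def complex_to_vec_def)

lemma complex_to_vec_inverse [simp]: "complex_to_vec (vec_to_complex v) = v"
  by (simp add: vec_to_complex_def complex_to_vec_def vec_eq_iff forall_2)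

lemma vec_to_complex_diff: "vec_to_complex (v - w) = vec_to_complex v - vec_to_complex w"
  by (simp add: vec_to_complex_def complex_eq_iff)

lemma complex_to_vec_diff: "complex_to_vec (z - w) = complex_to_vec z - complex_to_vec w"
  by (simp add: complex_to_vec_def vec_eq_iff forall_2)

lemma norm_vec_to_complex [simp]: "norm (vec_to_complex v) = norm v"
  by (simp add: vec_to_complex_def cmod_def norm_vec_def L2_set_def sum_2)

lemma norm_complex_to_vec [simp]: "norm (complex_to_vec z) = norm z"
  by (metis vec_to_complex_inverse norm_vec_to_complex)

lemma vec_to_complex_eq_0_iff [simp]: "vec_to_complex v = 0 \<longleftrightarrow> v = 0"
  by (metis norm_vec_to_complex norm_eq_zero)

lemma vec_to_complex_cont: "continuous_on UNIV vec_to_complex"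
  by (rule continuous_onI) (metis vec_to_complex_diff dist_norm norm_vec_to_complex order_less_imp_le)

lemma complex_to_vec_cont: "continuous_on UNIV complex_to_vec"
  by (rule continuous_onI) (metis complex_to_vec_diff dist_norm norm_complex_to_vec order_less_imp_le)

text \<open>In complex notation a real-linear map is \<open>z \<mapsto> \<alpha> * z + \<beta> * cnj z\<close>, and its determinant is
  \<open>(norm \<alpha>)\<^sup>2 - (norm \<beta>)\<^sup>2\<close>.\<close>

lemma simple_zero_if_det_pos:
  fixes f :: "real^2 \<Rightarrow> real^2"
  assumes der: "(f has_derivative f') (at a)" and det: "0 < det (matrix f')" and w: "f a = w"
  shows "simple_zero (\<lambda>z. vec_to_complex (f (complex_to_vec z) - w)) (vec_to_complex a)"
proof -
  define A where "A = matrix f'"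
  define \<alpha> where "\<alpha> = Complex ((A$1$1 + A$2$2) / 2) ((A$2$1 - A$1$2) / 2)"
  define \<beta> where "\<beta> = Complex ((A$1$1 - A$2$2) / 2) ((A$2$1 + A$1$2) / 2)"
  have lin: "vec_to_complex (f' (complex_to_vec v)) = \<alpha> * v + \<beta> * cnj v" for v
  proof -
    have "f' (complex_to_vec v) = A *v complex_to_vec v"
      using matrix_vector_mul[of f'] bounded_linear.linear[OF has_derivative_bounded_linear[OF der]]
      unfolding A_def by metis
    then show ?thesis
      by (simp add: vec_to_complex_def complex_to_vec_def matrix_vector_mult_def sum_2 \<alpha>_def \<beta>_def complex_eq_iff field_simps)
  qed
  have "(norm \<alpha>)\<^sup>2 - (norm \<beta>)\<^sup>2 = det A"
    unfolding cmod_power2 det_2 by (simp add: \<alpha>_def \<beta>_def power2_eq_square field_simps)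
  then have "(norm \<beta>)\<^sup>2 < (norm \<alpha>)\<^sup>2" using det by (simp add: A_def)
  then have ba: "norm \<beta> < norm \<alpha>" by (simp add: power2_less_imp_less)
  then have \<alpha>: "0 < norm \<alpha>" using norm_ge_zero le_less_trans by blast
  \<comment> \<open>Half of the available gap, so that
    \<open>(norm \<beta> + e) / norm \<alpha>\<close>, which serves as \<open>\<kappa>\<close>,
    stays below 1.\<close>
  define e where "e = (norm \<alpha> - norm \<beta>) / 2"
  have e: "0 < e" using ba by (simp add: e_def)
  obtain d where d: "0 < d" "\<And>y. norm (y - a) < d \<Longrightarrow> norm (f y - f a - f' (y - a)) \<le> e * norm (y - a)"
    using der e unfolding has_derivative_at_alt by blast
  have "norm (vec_to_complex (f (complex_to_vec z) - w) / (\<alpha> * (z - vec_to_complex a)) - 1) \<le> (norm \<beta> + e) / norm \<alpha>"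
    if z: "z \<noteq> vec_to_complex a" "norm (z - vec_to_complex a) < d" for z
  proof -
    define v where "v = z - vec_to_complex a"
    have v: "v \<noteq> 0" using z by (simp add: v_def)
    have vz: "complex_to_vec z - a = complex_to_vec v" by (simp add: v_def complex_to_vec_diff)
    have "norm (f (complex_to_vec z) - f a - f' (complex_to_vec z - a)) \<le> e * norm (complex_to_vec z - a)"
      by (rule d(2)) (use z in \<open>simp add: vz\<close>, simp add: v_def)
    then have "norm (vec_to_complex (f (complex_to_vec z) - w) - vec_to_complex (f' (complex_to_vec v))) \<le> e * norm v"
      unfolding vz w by (metis vec_to_complex_diff norm_vec_to_complex norm_complex_to_vec)
    then have 1: "norm (vec_to_complex (f (complex_to_vec z) - w) - \<alpha> * v) \<le> (norm \<beta> + e) * norm v"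
      using norm_triangle_ineq[of "vec_to_complex (f (complex_to_vec z) - w) - vec_to_complex (f' (complex_to_vec v))" "\<beta> * cnj v"]
      by (simp add: lin norm_mult algebra_simps)
    have "vec_to_complex (f (complex_to_vec z) - w) / (\<alpha> * v) - 1 = (vec_to_complex (f (complex_to_vec z) - w) - \<alpha> * v) / (\<alpha> * v)"
      using \<alpha> v by (auto simp: field_simps)
    also have "norm \<dots> = norm (vec_to_complex (f (complex_to_vec z) - w) - \<alpha> * v) / (norm \<alpha> * norm v)"
      by (simp add: norm_divide norm_mult)
    also have "\<dots> \<le> (norm \<beta> + e) * norm v / (norm \<alpha> * norm v)"
      by (rule divide_right_mono[OF 1]) simp
    also have "\<dots> = (norm \<beta> + e) / norm \<alpha>" using v by simp
    finally show ?thesis by (simp add: v_def)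
  qed
  moreover have "(norm \<beta> + e) / norm \<alpha> < 1" using \<alpha> ba by (simp add: e_def field_simps)
  moreover have "vec_to_complex (f (complex_to_vec (vec_to_complex a)) - w) = 0" using w by simp
  moreover have "\<alpha> \<noteq> 0" using \<alpha> by auto
  ultimately show ?thesis unfolding simple_zero_def using d(1) by blast
qed

theorem inj_if_det_pos:
  fixes f :: "real^2 \<Rightarrow> real^2"
  assumes der: "\<And>x. (f has_derivative f' x) (at x)" and det: "\<And>x. 0 < det (matrix (f' x))"
    and near: "\<And>x. norm (f x - x) \<le> K"
  shows "inj f"
proof (rule injI)
  fix x y assume eq: "f x = f y"
  define g where "g z = vec_to_complex (f (complex_to_vec z) - f x)" for z
  have f_cont: "continuous_on UNIV f"
    using has_derivative_continuous[OF der] by (auto intro: continuous_at_imp_continuous_on)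
  have "vec_to_complex x = vec_to_complex y"
  proof (rule at_most_one_simple_zero[of g "K + norm (f x)"])
    show "continuous_on UNIV g" unfolding g_def
      by (intro continuous_on_compose2[OF vec_to_complex_cont] continuous_intros
          continuous_on_compose2[OF f_cont complex_to_vec_cont]) auto
    show "norm (g z - z) \<le> K + norm (f x)" for z
    proof -
      have "g z - z = vec_to_complex (f (complex_to_vec z) - f x - complex_to_vec z)" by (simp add: g_def vec_to_complex_diff)
      also have "norm \<dots> = norm ((f (complex_to_vec z) - complex_to_vec z) - f x)" by (simp add: algebra_simps)
      also have "\<dots> \<le> K + norm (f x)"
        using norm_triangle_ineq4[of "f (complex_to_vec z) - complex_to_vec z" "f x"] near[of "complex_to_vec z"] by simp
      finally show ?thesis .
    qed
    show "simple_zero g c" if "g c = 0" for c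
    proof -
      have "f (complex_to_vec c) = f x" using that by (simp add: g_def)
      from simple_zero_if_det_pos[OF der det this] show ?thesis by (simp add: g_def[abs_def])
    qed
    show "g (vec_to_complex x) = 0" "g (vec_to_complex y) = 0" using eq by (simp_all add: g_def)
  qed
  then show "x = y" by (metis complex_to_vec_inverse)
qed

section \<open>Null sets and trajectories\<close>

lemma measure_image_lower_bound:
  fixes f :: "real^2 \<Rightarrow> real^2"
  assumes S: "S \<in> lmeasurable" and der: "\<And>x. (f has_derivative f' x) (at x)"
    and inj: "inj_on f S" and det: "\<And>x. c \<le> \<bar>det (matrix (f' x))\<bar>"
    and B: "B \<in> lmeasurable" "f ` S \<subseteq> B"
  shows "c * measure lebesgue S \<le> measure lebesgue B"
proof -
  have der_S: "(f has_derivative f' x) (at x within S)" for x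
    by (rule has_derivative_at_withinI[OF der])
  then have "f differentiable_on S" unfolding differentiable_on_def differentiable_def by blast
  then have "f ` S \<in> sets lebesgue"
    using S by (intro differentiable_image_in_sets_lebesgue) (auto simp: fmeasurableD)
  then have fS: "f ` S \<in> lmeasurable" using B by (meson fmeasurableI2)
  then have I: "((\<lambda>x. \<bar>det (matrix (f' x))\<bar>) has_integral measure lebesgue (f ` S)) S"
    using has_measure_differentiable_image[OF fmeasurableD[OF S] der_S inj] by blast
  have "((\<lambda>x. c * 1) has_integral c * measure lebesgue S) S"
    using integrable_integral[OF S[unfolded lmeasurable_iff_integrable_on]]
    unfolding lmeasure_integral[OF S] by (rule has_integral_mult_right)
  then have "c * measure lebesgue S \<le> measure lebesgue (f ` S)"
    by (rule has_integral_le[OF _ I]) (simp add: det)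
  also have "\<dots> \<le> measure lebesgue B"
    by (rule measure_mono_fmeasurable[OF B(2) fmeasurableD[OF fS] B(1)])
  finally show ?thesis .
qed

text \<open>Every point lies in one of the closed sets \<open>E n\<close> on which \<open>f\<close> is expanding at scale
  \<open>1 / (n + 1)\<close>, hence locally injective.\<close>

lemma null_sets_vimage:
  fixes f :: "real^2 \<Rightarrow> real^2"
  assumes der: "\<And>x. (f has_derivative f' x) (at x)" and c: "0 < c"
    and det: "\<And>x. c \<le> \<bar>det (matrix (f' x))\<bar>" and N: "N \<in> null_sets lborel"
  shows "f -` N \<in> null_sets lborel"
proof -
  have f_cont: "continuous_on UNIV f"
    using has_derivative_continuous[OF der] by (auto intro: continuous_at_imp_continuous_on)
  have fN: "f -` N \<in> sets borel"
    using measurable_sets_borel[OF borel_measurable_continuous_onI[OF f_cont], of N] N by (auto simp: null_sets_def)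
  have N0: "N \<in> lmeasurable" "measure lebesgue N = 0"
    using null_sets_completionI[OF N] by (simp_all add: fmeasurableI_null_sets measure_eq_0_null_sets)
  define E where "E n = (\<Inter>h\<in>cball 0 (1 / real (Suc n)). {x. norm h / real (Suc n) \<le> norm (f (x + h) - f x)})" for n
  have E_closed: "closed (E n)" for n
    unfolding E_def by (intro closed_INT ballI closed_Collect_le continuous_intros continuous_on_compose2[OF f_cont]) auto
  have E_cover: "\<exists>n. x \<in> E n" for x
  proof -
    have lin: "linear (f' x)" using has_derivative_bounded_linear[OF der] bounded_linear.linear by blast
    have "det (matrix (f' x)) \<noteq> 0" using det[of x] c by auto
    then have "inj (f' x)" using det_nz_iff_inj[OF lin] by simp
    then obtain B where B: "0 < B" "\<And>h. B * norm h \<le> norm (f' x h)"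
      using linear_inj_bounded_below_pos[OF lin] by blast
    obtain d where d: "0 < d" "\<And>y. norm (y - x) < d \<Longrightarrow> norm (f y - f x - f' x (y - x)) \<le> (B / 2) * norm (y - x)"
    proof -
      have "\<exists>d>0. \<forall>y. norm (y - x) < d \<longrightarrow> norm (f y - f x - f' x (y - x)) \<le> (B / 2) * norm (y - x)"
        using der[of x, unfolded has_derivative_at_alt, THEN conjunct2, rule_format, of "B / 2"] B(1) by simp
      then show ?thesis using that by blast
    qed
    obtain n where n: "1 / real (Suc n) < min d (B / 2)"
      using nat_approx_posE[of "min d (B / 2)"] d B by auto
    have "norm h / real (Suc n) \<le> norm (f (x + h) - f x)" if h: "norm h \<le> 1 / real (Suc n)" for h
    proof -
      have "norm (f (x + h) - f x - f' x h) \<le> (B / 2) * norm h" using d(2)[of "x + h"] h n by simp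
      then have "(B / 2) * norm h \<le> norm (f (x + h) - f x)"
        using B(2)[of h] norm_triangle_ineq2[of "f' x h" "f' x h - (f (x + h) - f x)"]
        by (simp add: norm_minus_commute algebra_simps)
      moreover have "(1 / real (Suc n)) * norm h \<le> (B / 2) * norm h" using n by (intro mult_right_mono) auto
      ultimately have "(1 / real (Suc n)) * norm h \<le> norm (f (x + h) - f x)" by (rule order_trans[rotated])
      then show ?thesis by simp
    qed
    then show ?thesis by (intro exI[of _ n]) (auto simp: E_def)
  qed
  \<comment> \<open>It suffices to work locally: two points of \<open>E n\<close> in a ball of
    radius \<open>1 / (2 * (n + 1))\<close> are close enough for the expansion property, so
    \<open>f\<close> is injective there, and the change of variables bounds the measure of the piece
    by that of \<open>N\<close>.\<close>
  have "negligible (f -` N \<inter> E n)" for n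
    unfolding locally_negligible_alt[of "f -` N \<inter> E n"]
  proof
    fix x assume x: "x \<in> f -` N \<inter> E n"
    define U where "U = (f -` N \<inter> E n) \<inter> ball x (1 / (2 * real (Suc n)))"
    have inj: "inj_on f U"
    proof (rule inj_onI)
      fix y z assume yz: "y \<in> U" "z \<in> U" "f y = f z"
      have "norm (z - y) \<le> dist x z + dist x y"
        using norm_triangle_ineq4[of "x - y" "x - z"] by (simp add: dist_norm)
      also have "\<dots> \<le> 1 / (2 * real (Suc n)) + 1 / (2 * real (Suc n))"
        using yz by (intro add_mono) (auto simp: U_def)
      also have "\<dots> = 1 / real (Suc n)" by (simp add: field_simps)
      finally have "z - y \<in> cball 0 (1 / real (Suc n))" by (simp del: of_nat_Suc)
      moreover have "\<forall>h\<in>cball 0 (1 / real (Suc n)). norm h / real (Suc n) \<le> norm (f (y + h) - f y)"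
        using yz(1) by (simp add: U_def E_def del: of_nat_Suc)
      ultimately have "norm (z - y) / real (Suc n) \<le> norm (f (y + (z - y)) - f y)" by blast
      then show "y = z" using yz(3) by (simp add: divide_le_0_iff)
    qed
    have "U \<in> lmeasurable"
      unfolding U_def using fN E_closed[of n]
      by (intro bounded_set_imp_lmeasurable bounded_Int) (auto intro!: sets.Int)
    from measure_image_lower_bound[OF this der inj det N0(1)]
    have "c * measure lebesgue U \<le> 0" using N0 by (auto simp: U_def)
    then have "measure lebesgue U = 0" using c by (simp add: mult_le_0_iff measure_le_0_iff)
    then have "negligible U" using \<open>U \<in> lmeasurable\<close> by (simp add: negligible_iff_measure)
    moreover have "openin (top_of_set (f -` N \<inter> E n)) U"
      unfolding U_def by (rule openin_open_Int) simp
    moreover have "x \<in> U" using x by (simp add: U_def)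
    ultimately show "\<exists>U. openin (top_of_set (f -` N \<inter> E n)) U \<and> x \<in> U \<and> negligible U" by blast
  qed
  then have "negligible (\<Union>n. f -` N \<inter> E n)" by (intro negligible_countable_Union) auto
  also have "(\<Union>n. f -` N \<inter> E n) = f -` N" using E_cover by auto
  finally show ?thesis using fN by (simp add: negligible_iff_null_sets null_sets_def)
qed

text \<open>The preimage is exhausted by bounded pieces, because the change of variables is
  available for sets of finite measure.\<close>

lemma emeasure_vimage_le:
  fixes f :: "real^2 \<Rightarrow> real^2"
  assumes der: "\<And>x. (f has_derivative f' x) (at x)" and inj: "inj f" and c: "0 < c"
    and det: "\<And>x. c \<le> \<bar>det (matrix (f' x))\<bar>" and A: "A \<in> sets borel"
  shows "emeasure lborel (f -` A) \<le> ennreal (1 / c) * emeasure lborel A"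
proof (cases "emeasure lborel A = \<infinity>")
  case True
  then show ?thesis using c by (simp add: ennreal_mult_top)
next
  case False
  have f_cont: "continuous_on UNIV f"
    using has_derivative_continuous[OF der] by (auto intro: continuous_at_imp_continuous_on)
  have fA: "f -` A \<in> sets borel"
    using measurable_sets_borel[OF borel_measurable_continuous_onI[OF f_cont] A] by simp
  have Al: "A \<in> lmeasurable"
    using A False by (intro fmeasurableI) (auto simp: top.not_eq_extremum)
  define S where "S n = f -` A \<inter> cball 0 (real n)" for n
  have S_borel: "S n \<in> sets borel" for n using fA by (simp add: S_def)
  have "emeasure lborel (S n) \<le> ennreal (1 / c) * emeasure lborel A" for n
  proof -
    have Sl: "S n \<in> lmeasurable"
      using S_borel by (intro bounded_set_imp_lmeasurable) (auto simp: S_def)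
    have "c * measure lebesgue (S n) \<le> measure lebesgue A"
      by (rule measure_image_lower_bound[OF Sl der inj_on_subset[OF inj subset_UNIV] det Al]) (auto simp: S_def)
    then have "measure lborel (S n) \<le> (1 / c) * measure lborel A"
      using c A S_borel by (simp add: field_simps measure_completion)
    moreover have "emeasure lborel (S n) \<noteq> \<infinity>"
      using emeasure_bounded_finite[of "S n"] bounded_Int[of "f -` A" "cball 0 (real n)"] by (auto simp: S_def)
    ultimately show ?thesis
      using False c by (simp add: emeasure_eq_ennreal_measure ennreal_leI flip: ennreal_mult)
  qed
  moreover have "(SUP n. emeasure lborel (S n)) = emeasure lborel (\<Union>n. S n)"
    using S_borel by (intro SUP_emeasure_incseq) (auto simp: incseq_def S_def)
  moreover have "(\<Union>n. S n) = f -` A"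
    using real_arch_simple by (auto simp: S_def)
  ultimately show ?thesis by (metis SUP_least)
qed

section \<open>Trajectories as Lebesgue integrals\<close>

text \<open>Rounding the time down to a multiple of \<open>1 / (n + 1)\<close> leaves countably many
  times, so the rounded functions are jointly measurable; they converge by continuity in
  time.\<close>

lemma caratheodory_measurable:
  fixes X :: "real \<Rightarrow> 'a::second_countable_topology \<Rightarrow> 'b::metric_space"
  assumes t: "\<And>x. continuous_on UNIV (\<lambda>t. X t x)" and x: "\<And>t. X t \<in> borel_measurable borel"
  shows "(\<lambda>p. X (fst p) (snd p)) \<in> borel_measurable (borel \<Otimes>\<^sub>M borel)"
proof (rule borel_measurable_LIMSEQ_metric)
  fix n :: nat
  show "(\<lambda>p. X (real_of_int \<lfloor>real (Suc n) * fst p\<rfloor> / real (Suc n)) (snd p)) \<in> borel_measurable (borel \<Otimes>\<^sub>M borel)"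
    by (rule measurable_compose_countable[where f="\<lambda>k p. X (real_of_int k / real (Suc n)) (snd p)" and g="\<lambda>p. \<lfloor>real (Suc n) * fst p\<rfloor>"])
       (use x in \<open>auto intro: measurable_compose[OF measurable_snd]\<close>)
next
  fix p :: "real \<times> 'a"
  have "(\<lambda>n. real_of_int \<lfloor>real (Suc n) * fst p\<rfloor> / real (Suc n)) \<longlonglongrightarrow> fst p"
  proof (rule real_tendsto_sandwich)
    show "(\<lambda>n. fst p - 1 / real (Suc n)) \<longlonglongrightarrow> fst p"
      using tendsto_diff[OF tendsto_const LIMSEQ_inverse_real_of_nat, of "fst p"] by (simp add: field_simps)
    show "\<forall>\<^sub>F n in sequentially. fst p - 1 / real (Suc n) \<le> real_of_int \<lfloor>real (Suc n) * fst p\<rfloor> / real (Suc n)"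
    proof (intro always_eventually allI)
      fix n
      have "real (Suc n) * fst p - 1 \<le> real_of_int \<lfloor>real (Suc n) * fst p\<rfloor>" by linarith
      from divide_right_mono[OF this, of "real (Suc n)"]
      show "fst p - 1 / real (Suc n) \<le> real_of_int \<lfloor>real (Suc n) * fst p\<rfloor> / real (Suc n)"
        by (simp add: diff_divide_distrib del: of_nat_Suc)
    qed
    show "\<forall>\<^sub>F n in sequentially. real_of_int \<lfloor>real (Suc n) * fst p\<rfloor> / real (Suc n) \<le> fst p"
      by (intro always_eventually allI) (simp add: divide_le_eq mult.commute del: of_nat_Suc)
  qed simp
  then show "(\<lambda>n. X (real_of_int \<lfloor>real (Suc n) * fst p\<rfloor> / real (Suc n)) (snd p)) \<longlonglongrightarrow> X (fst p) (snd p)"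
    using t[of "snd p"] by (intro continuous_on_tendsto_compose[OF t]) auto
qed

text \<open>Almost every trajectory spends almost no time in a null set, so there the field may be
  modified on a null set, and then the Henstock--Kurzweil integral is a Lebesgue integral.\<close>

lemma AE_trajectory_lebesgue:
  fixes X :: "real \<Rightarrow> real^2 \<Rightarrow> real^2" and b b' :: "real^2 \<Rightarrow> real^2"
  assumes T: "0 \<le> T"
    and cont: "\<And>t. t \<in> {0..T} \<Longrightarrow> continuous_on UNIV (X t)"
    and null: "\<And>t. t \<in> {0..T} \<Longrightarrow> X t -` N \<in> null_sets lborel" and N: "N \<in> null_sets lborel"
    and ode: "\<And>t x. t \<in> {0..T} \<Longrightarrow> ((\<lambda>s. b (X s x)) has_integral (X t x - x)) {0..t}"
    and b'[measurable]: "b' \<in> borel_measurable borel" and bd: "\<And>z. norm (b' z) \<le> K"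
    and eq: "\<And>z. z \<notin> N \<Longrightarrow> b z = b' z"
  shows "AE x in lborel. \<forall>t\<in>{0..T}. set_integrable lborel {0..t} (\<lambda>s. b' (X s x)) \<and> X t x - x = (LINT s:{0..t}|lborel. b' (X s x))"
proof -
  define cl where "cl t = max 0 (min T t)" for t
  define Z where "Z t x = X (cl t) x" for t x
  have cl_in: "cl t \<in> {0..T}" for t using T by (auto simp: cl_def)
  have cl_eq: "cl t = t" if "t \<in> {0..T}" for t using that by (auto simp: cl_def)
  have X_cont: "continuous_on {0..T} (\<lambda>t. X t x)" for x
  proof -
    have int: "(\<lambda>s. b (X s x)) integrable_on {0..T}" using ode[of T x] T by (auto simp: integrable_on_def)
    have "continuous_on {0..T} (\<lambda>t. x + integral {0..t} (\<lambda>s. b (X s x)))"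
      by (intro continuous_intros indefinite_integral_continuous_1[OF int])
    moreover have "x + integral {0..t} (\<lambda>s. b (X s x)) = X t x" if "t \<in> {0..T}" for t
      using integral_unique[OF ode[OF that]] by simp
    ultimately show ?thesis by (rule continuous_on_eq) auto
  qed
  have Z_cont: "continuous_on UNIV (\<lambda>t. Z t x)" for x
    unfolding Z_def cl_def using T
    by (intro continuous_on_compose2[OF X_cont] continuous_intros) auto
  have Z_meas: "Z t \<in> borel_measurable borel" for t
    unfolding Z_def by (intro borel_measurable_continuous_onI cont cl_in)
  have Zm: "(\<lambda>p. Z (fst p) (snd p)) \<in> borel_measurable (borel \<Otimes>\<^sub>M borel)"
    by (rule caratheodory_measurable[OF Z_cont Z_meas])
  have Nb [measurable]: "N \<in> sets borel" using N by (auto simp: null_sets_def)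
  have "(\<lambda>p. indicator N (Z (fst p) (snd p)) :: ennreal) \<in> borel_measurable (borel \<Otimes>\<^sub>M borel)"
    by (rule measurable_compose[OF Zm]) measurable
  then have ind: "(\<lambda>(s, x). indicator N (Z s x) :: ennreal) \<in> borel_measurable (lborel \<Otimes>\<^sub>M lborel)"
    by (simp add: case_prod_unfold cong: measurable_cong_sets sets_pair_measure_cong)
  have "(\<integral>\<^sup>+x. (\<integral>\<^sup>+s. indicator N (Z s x) \<partial>lborel) \<partial>lborel) = (\<integral>\<^sup>+s. (\<integral>\<^sup>+x. indicator N (Z s x) \<partial>lborel) \<partial>lborel)"
    by (rule pair_sigma_finite.Fubini'[OF _ ind]) (simp add: pair_sigma_finite_def sigma_finite_lborel)
  also have "\<dots> = (\<integral>\<^sup>+s. 0 \<partial>(lborel::real measure))"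
  proof (rule nn_integral_cong)
    fix s
    have "(\<integral>\<^sup>+x. indicator N (Z s x) \<partial>lborel) = (\<integral>\<^sup>+x. indicator (X (cl s) -` N) x \<partial>lborel)"
      by (intro nn_integral_cong) (simp add: Z_def indicator_def)
    also have "\<dots> = 0" using null[OF cl_in[of s]] by (subst nn_integral_indicator) (auto simp: null_sets_def)
    finally show "(\<integral>\<^sup>+x. indicator N (Z s x) \<partial>lborel) = 0" .
  qed
  finally have "(\<integral>\<^sup>+x. (\<integral>\<^sup>+s. indicator N (Z s x) \<partial>lborel) \<partial>lborel) = 0" by simp
  moreover have "(\<lambda>x. \<integral>\<^sup>+s. indicator N (Z s x) \<partial>lborel) \<in> borel_measurable lborel"
    using lborel.borel_measurable_nn_integral[of "\<lambda>x s. indicator N (Z s x)" lborel]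
      measurable_pair_swap[OF ind] by (simp add: case_prod_unfold)
  ultimately have "AE x in lborel. (\<integral>\<^sup>+s. indicator N (Z s x) \<partial>lborel) = 0"
    by (subst (asm) nn_integral_0_iff_AE) auto
  then show ?thesis
  proof eventually_elim
    case (elim x)
    have [measurable]: "(\<lambda>s. Z s x) \<in> borel_measurable borel"
      by (rule borel_measurable_continuous_onI[OF Z_cont])
    have "AE s in lborel. Z s x \<notin> N"
      using elim by (subst (asm) nn_integral_0_iff_AE) (auto simp: indicator_def elim: eventually_mono split: if_splits)
    then have "{s. Z s x \<in> N} \<in> null_sets lborel"
      by (subst (asm) AE_iff_null) (auto simp: Collect_neg_eq)
    then have neg: "negligible {s. Z s x \<in> N}"
      by (simp add: negligible_iff_null_sets null_sets_completionI)
    show ?case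
    proof
      fix t assume t: "t \<in> {0..T}"
      have int: "set_integrable lborel {0..t} (\<lambda>s. b' (Z s x))"
        unfolding set_integrable_def
        by (rule integrableI_bounded_set_indicator[where B = K])
           (use bd emeasure_compact_finite[of "{0..t}"] in auto)
      have ZX: "Z s x = X s x" if "s \<in> {0..t}" for s using that t by (simp add: Z_def cl_eq)
      have "((\<lambda>s. b' (Z s x)) has_integral (X t x - x)) {0..t}"
        by (rule has_integral_spike[OF neg _ ode[OF t, of x]]) (use ZX eq in force)
      then have "X t x - x = (LINT s:{0..t}|lborel. b' (Z s x))"
        using set_borel_integral_eq_integral[OF int] by (simp add: integral_unique)
      moreover have "(LINT s:{0..t}|lborel. b' (Z s x)) = (LINT s:{0..t}|lborel. b' (X s x))"
        using ZX by (intro set_lebesgue_integral_cong) auto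
      moreover have "set_integrable lborel {0..t} (\<lambda>s. b' (X s x))"
        using int ZX unfolding set_integrable_def
        by (subst Bochner_Integration.integrable_cong[OF refl, of _ _ "\<lambda>s. indicator {0..t} s *\<^sub>R b' (Z s x)"])
           (auto simp: indicator_def)
      ultimately show "set_integrable lborel {0..t} (\<lambda>s. b' (X s x)) \<and> X t x - x = (LINT s:{0..t}|lborel. b' (X s x))"
        by simp
    qed
  qed
qed

section \<open>Total variation\<close>

text \<open>Scalar test functions suffice for bounding increments of one component. The derivative
  is carried along as an argument, so that sums, products and shifts need not recover it from
  \<open>frechet_derivative\<close>.\<close>

definition test_fun :: "(real^2 \<Rightarrow> real) \<Rightarrow> (real^2 \<Rightarrow> real^2 \<Rightarrow> real) \<Rightarrow> (real^2) set \<Rightarrow> bool" where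
  "test_fun \<psi> \<psi>' U \<longleftrightarrow> (\<forall>x. (\<psi> has_derivative \<psi>' x) (at x)) \<and> (\<forall>v. continuous_on UNIV (\<lambda>x. \<psi>' x v)) \<and>
     compact (closure {x. \<psi> x \<noteq> 0}) \<and> closure {x. \<psi> x \<noteq> 0} \<subseteq> U"

text \<open>A scalar test function placed at the entry \<open>(i, j)\<close> of a matrix field tests
  one partial derivative of one component; the matrix unit has norm 1, so the field stays
  admissible.\<close>

lemma dvar_test_fun:
  assumes \<psi>: "test_fun \<psi> \<psi>' U" and bd: "\<And>x. \<bar>\<psi> x\<bar> \<le> 1"
  shows "ereal (\<integral>x. b x $ i * \<psi>' x (axis j 1) \<partial>lborel) \<le> dvar b U"
proof -
  define E :: "real^2^2" where "E = axis i (axis j 1)"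
  have E: "E $ k $ l = (if k = i \<and> l = j then 1 else 0)" for k l by (simp add: E_def axis_def)
  have nE: "norm E = 1"
    using exhaust_2[of i] exhaust_2[of j] by (auto simp: norm_vec_def L2_set_def sum_2 E)
  define \<phi> where "\<phi> x = \<psi> x *\<^sub>R E" for x
  have der: "(\<phi> has_derivative (\<lambda>v. \<psi>' x v *\<^sub>R E)) (at x)" for x
    unfolding \<phi>_def using \<psi> by (intro has_derivative_scaleR_left) (simp add: test_fun_def)
  have fd: "frechet_derivative \<phi> (at x) = (\<lambda>v. \<psi>' x v *\<^sub>R E)" for x
    using frechet_derivative_at[OF der] by simp
  have supp: "{x. \<phi> x \<noteq> 0} = {x. \<psi> x \<noteq> 0}" using nE by (auto simp: \<phi>_def)
  have "\<phi> \<in> dtest U"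
    unfolding dtest_def mem_Collect_eq supp
  proof (intro conjI allI)
    fix x j
    show "\<phi> differentiable (at x)" using der by (auto simp: differentiable_def)
    show "norm (\<phi> x) \<le> 1" using bd[of x] nE by (simp add: \<phi>_def)
    show "continuous_on UNIV (\<lambda>x. frechet_derivative \<phi> (at x) (axis j 1))"
      unfolding fd using \<psi> by (intro continuous_intros) (simp add: test_fun_def)
  qed (use \<psi> in \<open>auto simp: test_fun_def\<close>)
  moreover have "(\<Sum>k\<in>UNIV. \<integral>x. b x $ k * mdiv \<phi> x k \<partial>lborel) = (\<integral>x. b x $ i * \<psi>' x (axis j 1) \<partial>lborel)"
  proof -
    have "mdiv \<phi> x k = (if k = i then \<psi>' x (axis j 1) else 0)" for x k
      unfolding mdiv_def fd by (cases "k = i") (auto simp: E if_distrib cong: if_cong)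
    then have "(\<Sum>k\<in>UNIV. \<integral>x. b x $ k * mdiv \<phi> x k \<partial>lborel)
      = (\<Sum>k\<in>UNIV. if k = i then \<integral>x. b x $ i * \<psi>' x (axis j 1) \<partial>lborel else 0)"
      by (intro sum.cong) auto
    then show ?thesis by simp
  qed
  ultimately show ?thesis
    unfolding dvar_def by (intro Sup_upper) (auto intro!: exI[of _ \<phi>])
qed

lemma test_fun_deriv_zero:
  assumes "test_fun \<psi> \<psi>' U" "z \<notin> closure {x. \<psi> x \<noteq> 0}"
  shows "\<psi>' z v = 0"
proof -
  have "((\<lambda>x. 0) has_derivative (\<lambda>v. 0)) (at z)" by simp
  then have "(\<psi> has_derivative (\<lambda>v. 0)) (at z)"
    by (rule has_derivative_transform_within_open[of _ _ _ _ "- closure {x. \<psi> x \<noteq> 0}"])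
       (use assms closure_subset[of "{x. \<psi> x \<noteq> 0}"] in auto)
  then have "\<psi>' z = (\<lambda>v. 0)"
    using assms(1) has_derivative_unique unfolding test_fun_def by blast
  then show ?thesis by simp
qed

lemma test_fun_shift:
  assumes \<psi>: "test_fun \<psi> \<psi>' U" and U: "\<And>z. z \<in> closure {x. \<psi> x \<noteq> 0} \<Longrightarrow> z + w \<in> U'"
  shows "test_fun (\<lambda>z. - \<psi> (z - w)) (\<lambda>z v. - \<psi>' (z - w) v) U'"
proof -
  let ?S = "{x. \<psi> x \<noteq> 0}"
  have "{x. - \<psi> (x - w) \<noteq> 0} = (+) w ` ?S"
    by (auto intro!: image_eqI[of _ _ "_ - w"])
  then have supp: "closure {x. - \<psi> (x - w) \<noteq> 0} = (+) w ` closure ?S"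
    using closure_translation[of w ?S] by simp
  show ?thesis
    unfolding test_fun_def supp
  proof (intro conjI allI)
    fix x v
    have 1: "((\<lambda>z. z - w) has_derivative (\<lambda>v. v)) (at x)" by (auto intro!: derivative_eq_intros)
    have 2: "(\<psi> has_derivative \<psi>' (x - w)) (at (x - w))" using \<psi> by (simp add: test_fun_def)
    show "((\<lambda>z. - \<psi> (z - w)) has_derivative (\<lambda>v. - \<psi>' (x - w) v)) (at x)"
      by (rule has_derivative_minus[OF has_derivative_compose[OF 1 2]])
    have "continuous_on UNIV (\<lambda>z. \<psi>' z v)" using \<psi> by (simp add: test_fun_def)
    then have "continuous_on UNIV (\<lambda>z. \<psi>' (z - w) v)"
      by (rule continuous_on_compose2[of UNIV "\<lambda>z. \<psi>' z v"]) (auto intro: continuous_intros)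
    then show "continuous_on UNIV (\<lambda>z. - \<psi>' (z - w) v)" by (rule continuous_on_minus)
    show "compact ((+) w ` closure ?S)"
      using \<psi> by (intro compact_translation) (simp add: test_fun_def)
    show "(+) w ` closure ?S \<subseteq> U'"
      using U by (auto simp: add.commute[of w])
  qed
qed

text \<open>The shift is moved onto \<open>\<psi>\<close>, and
  \<open>\<psi> (z - \<epsilon> *\<^sub>R e) - \<psi> z\<close> is written as an integral over
  \<open>\<sigma>\<close> in \<open>[0, \<epsilon>]\<close>. After Fubini each inner integral tests
  \<open>f\<close> against the derivative of \<open>- \<psi> (z - \<sigma> *\<^sub>R e)\<close>,
  which is again admissible, so it is at most \<open>V\<close>.\<close>

lemma integral_increment_test_fun:
  assumes f [measurable]: "f \<in> borel_measurable borel" and K: "\<And>z. \<bar>f z\<bar> \<le> K"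
    and H: "\<And>\<psi> \<psi>'. test_fun \<psi> \<psi>' U \<Longrightarrow> (\<And>x. \<bar>\<psi> x\<bar> \<le> 1) \<Longrightarrow> (\<integral>z. f z * \<psi>' z e \<partial>lborel) \<le> V"
    and \<psi>: "test_fun \<psi> \<psi>' S" and bd: "\<And>x. \<bar>\<psi> x\<bar> \<le> 1"
    and \<epsilon>: "0 \<le> \<epsilon>" and sub: "\<And>z \<sigma>. z \<in> S \<Longrightarrow> 0 \<le> \<sigma> \<Longrightarrow> \<sigma> \<le> \<epsilon> \<Longrightarrow> z + \<sigma> *\<^sub>R e \<in> U"
  shows "(\<integral>z. (f (z + \<epsilon> *\<^sub>R e) - f z) * \<psi> z \<partial>lborel) \<le> \<epsilon> * V"
proof -
  define g where "g z = \<psi>' z e" for z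
  have der: "\<And>x. (\<psi> has_derivative \<psi>' x) (at x)" and g_cont: "continuous_on UNIV g"
    and cpt: "compact (closure {x. \<psi> x \<noteq> 0})" and cS: "closure {x. \<psi> x \<noteq> 0} \<subseteq> S"
    using \<psi> by (auto simp: test_fun_def g_def)
  define Q where "Q = closure {x. \<psi> x \<noteq> 0}"
  have g0: "g z = 0" if "z \<notin> Q" for z using test_fun_deriv_zero[OF \<psi>] that by (simp add: g_def Q_def)
  have p0: "\<psi> z = 0" if "z \<notin> Q" for z using that closure_subset[of "{x. \<psi> x \<noteq> 0}"] by (auto simp: Q_def)
  have \<psi>_cont: "continuous_on UNIV \<psi>"
    using has_derivative_continuous[OF der] by (auto intro: continuous_at_imp_continuous_on)
  have [measurable]: "g \<in> borel_measurable borel" "\<psi> \<in> borel_measurable borel"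
    using g_cont \<psi>_cont by (auto intro: borel_measurable_continuous_onI)
  obtain G where G: "\<And>z. \<bar>g z\<bar> \<le> G"
  proof -
    have "compact (g ` Q)"
      unfolding Q_def by (rule compact_continuous_image[OF continuous_on_subset[OF g_cont subset_UNIV] cpt])
    then have "bounded (g ` Q)" by (rule compact_imp_bounded)
    then obtain G where "\<forall>z\<in>Q. \<bar>g z\<bar> \<le> G" "0 < G" by (auto simp: bounded_pos)
    then show ?thesis using that[of G] g0 by (metis abs_zero less_imp_le)
  qed
  have "0 \<le> K" using K[of 0] by simp
  have "0 \<le> G" using G[of 0] by simp
  obtain r where r: "0 < r" "Q \<subseteq> cball 0 r"
    using compact_imp_bounded[OF cpt] unfolding Q_def bounded_pos by (auto simp: subset_iff)
  define R where "R = r + \<epsilon> * norm e"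
  have shifted: "z \<in> cball 0 R" if "z - \<sigma> *\<^sub>R e \<in> Q" "\<sigma> \<in> {0..\<epsilon>}" for z \<sigma>
  proof -
    have "norm z \<le> norm (z - \<sigma> *\<^sub>R e) + norm (\<sigma> *\<^sub>R e)" by (metis diff_add_cancel norm_triangle_ineq)
    also have "\<dots> \<le> r + \<epsilon> * norm e"
      using that r by (intro add_mono) (auto intro!: mult_right_mono)
    finally show ?thesis by (simp add: R_def)
  qed
  define k where "k \<sigma> z = indicator {0..\<epsilon>} \<sigma> * (f z * g (z - \<sigma> *\<^sub>R e))" for \<sigma> z
  have "integrable lborel (\<lambda>p. k (fst p) (snd p))"
  proof (rule integrable_bounded_support[where S="{0..\<epsilon>} \<times> cball 0 R" and B="K * G"])
    show "(\<lambda>p. k (fst p) (snd p)) \<in> borel_measurable borel"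
      unfolding k_def borel_prod[symmetric] by measurable
    show "\<bar>k (fst p) (snd p)\<bar> \<le> K * G" for p
      using K[of "snd p"] G[of "snd p - fst p *\<^sub>R e"] \<open>0 \<le> K\<close> \<open>0 \<le> G\<close>
      by (auto simp: k_def abs_mult indicator_def intro!: mult_mono)
    show "bounded ({0..\<epsilon>} \<times> cball (0::real^2) R)" by (intro bounded_Times) auto
    show "k (fst p) (snd p) = 0" if "p \<notin> {0..\<epsilon>} \<times> cball 0 R" for p
    proof (cases "fst p \<in> {0..\<epsilon>} \<and> snd p - fst p *\<^sub>R e \<in> Q")
      case True
      then show ?thesis using shifted[of "snd p" "fst p"] that by (auto simp: mem_Times_iff)
    next
      case False
      then show ?thesis using g0 by (auto simp: k_def)
    qed
  qed
  then have k_int: "integrable (lborel \<Otimes>\<^sub>M lborel) (\<lambda>(\<sigma>, z). k \<sigma> z)"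
    by (simp add: lborel_prod case_prod_unfold)
  have inner: "(\<integral>\<sigma>. k \<sigma> z \<partial>lborel) = f z * (\<psi> z - \<psi> (z - \<epsilon> *\<^sub>R e))" for z
  proof -
    have ftc: "(\<integral>\<sigma>. indicator {0..\<epsilon>} \<sigma> *\<^sub>R (- g (z - \<sigma> *\<^sub>R e)) \<partial>lborel) = \<psi> (z - \<epsilon> *\<^sub>R e) - \<psi> (z - 0 *\<^sub>R e)"
    proof (rule integral_FTC_Icc[OF \<epsilon>])
      fix \<sigma> :: real
      have "((\<lambda>\<sigma>. z - \<sigma> *\<^sub>R e) has_derivative (\<lambda>s. - (s *\<^sub>R e))) (at \<sigma> within {0..\<epsilon>})"
        by (auto intro!: derivative_eq_intros)
      from has_derivative_compose[OF this der]
      have "((\<lambda>\<sigma>. \<psi> (z - \<sigma> *\<^sub>R e)) has_derivative (\<lambda>s. \<psi>' (z - \<sigma> *\<^sub>R e) (- (s *\<^sub>R e)))) (at \<sigma> within {0..\<epsilon>})" .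
      moreover have "\<psi>' (z - \<sigma> *\<^sub>R e) (- (s *\<^sub>R e)) = s *\<^sub>R (- g (z - \<sigma> *\<^sub>R e))" for s
        using has_derivative_linear[OF der[of "z - \<sigma> *\<^sub>R e"]] by (simp add: g_def linear_neg linear_cmul)
      ultimately show "((\<lambda>\<sigma>. \<psi> (z - \<sigma> *\<^sub>R e)) has_vector_derivative - g (z - \<sigma> *\<^sub>R e)) (at \<sigma> within {0..\<epsilon>})"
        by (simp add: has_vector_derivative_def)
    next
      show "continuous_on {0..\<epsilon>} (\<lambda>\<sigma>. - g (z - \<sigma> *\<^sub>R e))"
        by (intro continuous_intros continuous_on_compose2[OF g_cont]) auto
    qed
    have "(\<integral>\<sigma>. k \<sigma> z \<partial>lborel) = (\<integral>\<sigma>. - f z * (indicator {0..\<epsilon>} \<sigma> *\<^sub>R (- g (z - \<sigma> *\<^sub>R e))) \<partial>lborel)"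
      by (intro Bochner_Integration.integral_cong) (auto simp: k_def)
    also have "\<dots> = - f z * (\<integral>\<sigma>. indicator {0..\<epsilon>} \<sigma> *\<^sub>R (- g (z - \<sigma> *\<^sub>R e)) \<partial>lborel)"
      by (rule integral_mult_right_zero)
    also have "\<dots> = - f z * (\<psi> (z - \<epsilon> *\<^sub>R e) - \<psi> z)"
      unfolding ftc by simp
    finally show ?thesis by (simp add: algebra_simps)
  qed
  have fp: "integrable lborel (\<lambda>z. f (z + w) * \<psi> z)" for w
  proof (rule integrable_bounded_support[where S=Q and B="K * 1"])
    show "bounded Q" unfolding Q_def by (rule compact_imp_bounded[OF cpt])
    show "\<bar>f (z + w) * \<psi> z\<bar> \<le> K * 1" for z
      unfolding abs_mult by (intro mult_mono K bd \<open>0 \<le> K\<close>) simp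
  qed (use p0 in simp_all)
  have fp': "integrable lborel (\<lambda>z. f z * \<psi> (z - w))" for w
  proof (rule integrable_bounded_support[where S="(\<lambda>z. z + w) ` Q" and B="K * 1"])
    show "bounded ((\<lambda>z. z + w) ` Q)"
      using bounded_translation[OF compact_imp_bounded[OF cpt], of w] by (simp add: Q_def add.commute)
    show "f z * \<psi> (z - w) = 0" if "z \<notin> (\<lambda>z. z + w) ` Q" for z
      using p0[of "z - w"] that by (force simp: image_iff)
    show "\<bar>f z * \<psi> (z - w)\<bar> \<le> K * 1" for z
      unfolding abs_mult by (intro mult_mono K bd \<open>0 \<le> K\<close>) simp
  qed simp
  have "(\<integral>z. (f (z + \<epsilon> *\<^sub>R e) - f z) * \<psi> z \<partial>lborel)
      = (\<integral>z. f (z + \<epsilon> *\<^sub>R e) * \<psi> z \<partial>lborel) - (\<integral>z. f z * \<psi> z \<partial>lborel)"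
    using fp[of "\<epsilon> *\<^sub>R e"] fp[of 0] by (simp add: left_diff_distrib)
  also have "(\<integral>z. f (z + \<epsilon> *\<^sub>R e) * \<psi> z \<partial>lborel) = (\<integral>z. f z * \<psi> (z - \<epsilon> *\<^sub>R e) \<partial>lborel)"
    using lborel_integral_translate[of "\<lambda>z. f z * \<psi> (z - \<epsilon> *\<^sub>R e)" "\<epsilon> *\<^sub>R e"] by simp
  also have "\<dots> - (\<integral>z. f z * \<psi> z \<partial>lborel) = (\<integral>z. - (\<integral>\<sigma>. k \<sigma> z \<partial>lborel) \<partial>lborel)"
    unfolding inner using fp'[of "\<epsilon> *\<^sub>R e"] fp'[of 0] by (simp add: right_diff_distrib flip: Bochner_Integration.integral_minus)
  also have "\<dots> = - (\<integral>\<sigma>. (\<integral>z. k \<sigma> z \<partial>lborel) \<partial>lborel)"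
    using lborel_pair.Fubini_integral[OF k_int] by simp
  also have "\<dots> = (\<integral>\<sigma>. - (\<integral>z. k \<sigma> z \<partial>lborel) \<partial>lborel)" by simp
  also have "\<dots> \<le> (\<integral>\<sigma>. indicator {0..\<epsilon>} \<sigma> * V \<partial>lborel)"
  proof (rule integral_mono)
    show "integrable lborel (\<lambda>\<sigma>. - (\<integral>z. k \<sigma> z \<partial>lborel))"
      using lborel_pair.integrable_fst'[OF k_int] by simp
    show "integrable lborel (\<lambda>\<sigma>. indicator {0..\<epsilon>} \<sigma> * V)"
      using emeasure_compact_finite[of "{0..\<epsilon>}"] by (intro integrable_mult_left integrable_real_indicator) auto
    fix \<sigma> :: real
    show "- (\<integral>z. k \<sigma> z \<partial>lborel) \<le> indicator {0..\<epsilon>} \<sigma> * V"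
    proof (cases "\<sigma> \<in> {0..\<epsilon>}")
      case True
      have "test_fun (\<lambda>z. - \<psi> (z - \<sigma> *\<^sub>R e)) (\<lambda>z v. - \<psi>' (z - \<sigma> *\<^sub>R e) v) U"
        by (rule test_fun_shift[OF \<psi>], rule sub) (use True cS in auto)
      from H[OF this] bd have "(\<integral>z. f z * - \<psi>' (z - \<sigma> *\<^sub>R e) e \<partial>lborel) \<le> V" by simp
      then show ?thesis using True by (simp add: k_def g_def)
    qed (simp add: k_def)
  qed
  also have "\<dots> = \<epsilon> * V" using \<epsilon> by simp
  finally show ?thesis .
qed

section \<open>A differentiable cutoff and duality\<close>

text \<open>Squaring the truncated paraboloid makes it continuously differentiable; for
  \<open>c = 1 / R ^ 2\<close> it is positive exactly on the open ball of radius
  \<open>R\<close>.\<close>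

definition bump :: "real^2 \<Rightarrow> real \<Rightarrow> real^2 \<Rightarrow> real" where
  "bump a c x = (max 0 (1 - c * ((x - a) \<bullet> (x - a))))\<^sup>2"

definition bump_deriv :: "real^2 \<Rightarrow> real \<Rightarrow> real^2 \<Rightarrow> real^2 \<Rightarrow> real" where
  "bump_deriv a c x v = 2 * max 0 (1 - c * ((x - a) \<bullet> (x - a))) * (- (c * (2 * ((x - a) \<bullet> v))))"

definition cutoff :: "real^2 \<Rightarrow> real \<Rightarrow> real^2 \<Rightarrow> real" where
  "cutoff a R = bump a (1 / R\<^sup>2)"

lemma max_0_square_deriv: "((\<lambda>u::real. (max 0 u)\<^sup>2) has_real_derivative 2 * max 0 u) (at u)"
proof -
  consider "u < 0" | "0 < u" | "u = 0" by linarith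
  then show ?thesis
  proof cases
    case 1
    have "((\<lambda>u::real. 0) has_real_derivative 2 * max 0 u) (at u)" using 1 by simp
    then show ?thesis
      by (rule DERIV_cong_ev[OF refl _ refl, THEN iffD1, rotated])
         (use 1 in \<open>auto simp: eventually_nhds intro!: exI[of _ "{..<0}"]\<close>)
  next
    case 2
    have "((\<lambda>u::real. u\<^sup>2) has_real_derivative 2 * max 0 u) (at u)"
      using 2 by (auto intro!: derivative_eq_intros)
    then show ?thesis
      by (rule DERIV_cong_ev[OF refl _ refl, THEN iffD1, rotated])
         (use 2 in \<open>auto simp: eventually_nhds intro!: exI[of _ "{0<..}"]\<close>)
  next
    case 3
    have "((\<lambda>h::real. (max 0 h)\<^sup>2 / h) \<longlongrightarrow> 0) (at 0)"
    proof (rule Lim_null_comparison)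
      show "\<forall>\<^sub>F h::real in at 0. norm ((max 0 h)\<^sup>2 / h) \<le> \<bar>h\<bar>"
        by (intro always_eventually allI) (auto simp: max_def power2_eq_square)
      show "((\<lambda>h::real. \<bar>h\<bar>) \<longlongrightarrow> 0) (at 0)" by (auto intro!: tendsto_eq_intros)
    qed
    then show ?thesis using 3 by (simp add: has_field_derivative_iff)
  qed
qed

lemma bump_has_derivative: "(bump a c has_derivative bump_deriv a c x) (at x)"
proof -
  have inner: "((\<lambda>x. 1 - c * ((x - a) \<bullet> (x - a))) has_derivative (\<lambda>v. - (c * (2 * ((x - a) \<bullet> v))))) (at x)"
    by (auto intro!: derivative_eq_intros simp: inner_commute)
  show ?thesis
    unfolding bump_def[abs_def] bump_deriv_def[abs_def]
    by (rule has_derivative_compose[OF inner max_0_square_deriv[unfolded has_field_derivative_def]])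
qed

lemma bump_deriv_cont: "continuous_on UNIV (\<lambda>x. bump_deriv a c x v)"
  unfolding bump_deriv_def by (intro continuous_intros continuous_on_max)

lemma cutoff_cont: "continuous_on UNIV (cutoff a R)"
  unfolding cutoff_def using has_derivative_continuous[OF bump_has_derivative]
  by (auto intro: continuous_at_imp_continuous_on)

lemma cutoff_bounds: "0 \<le> cutoff a R x" "cutoff a R x \<le> 1"
proof -
  show "0 \<le> cutoff a R x" by (simp add: cutoff_def bump_def)
  have "max 0 (1 - 1 / R\<^sup>2 * ((x - a) \<bullet> (x - a))) \<le> 1" by simp
  then show "cutoff a R x \<le> 1" unfolding cutoff_def bump_def by (simp add: power_le_one)
qed

lemma cutoff_pos_iff:
  assumes R: "0 < R" shows "0 < cutoff a R x \<longleftrightarrow> x \<in> ball a R"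
proof -
  have "0 < cutoff a R x \<longleftrightarrow> (norm (x - a))\<^sup>2 < R\<^sup>2"
    using R by (auto simp: cutoff_def bump_def max_def field_simps power2_norm_eq_inner)
  also have "\<dots> \<longleftrightarrow> norm (x - a) < R"
    using R by (metis norm_ge_zero order_less_imp_le power2_less_imp_less power_strict_mono zero_less_numeral)
  finally show ?thesis by (simp add: dist_norm norm_minus_commute)
qed

lemma real_polynomial_continuous:
  fixes p :: "real^2 \<Rightarrow> real"
  assumes "real_polynomial_function p" shows "continuous_on UNIV p"
  using continuous_real_polymonial_function[OF assms] by (auto intro: continuous_at_imp_continuous_on)

lemma real_polynomial_C1:
  fixes p :: "real^2 \<Rightarrow> real"
  assumes "real_polynomial_function p"
  shows "\<exists>p'. (\<forall>x. (p has_derivative p' x) (at x)) \<and> (\<forall>v. continuous_on UNIV (\<lambda>x. p' x v))"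
  using assms
proof induction
  case (linear f)
  then show ?case
    by (intro exI[of _ "\<lambda>_. f"]) (auto intro: bounded_linear_imp_has_derivative)
next
  case (const c)
  show ?case by (intro exI[of _ "\<lambda>_ _. 0"]) auto
next
  case (add f g)
  then obtain f' g' where
    "\<forall>x. (f has_derivative f' x) (at x)" "\<forall>v. continuous_on UNIV (\<lambda>x. f' x v)"
    "\<forall>x. (g has_derivative g' x) (at x)" "\<forall>v. continuous_on UNIV (\<lambda>x. g' x v)" by blast
  then show ?case
    by (intro exI[of _ "\<lambda>x v. f' x v + g' x v"]) (auto intro!: has_derivative_add continuous_intros)
next
  case (mult f g)
  then obtain f' g' where *:
    "\<forall>x. (f has_derivative f' x) (at x)" "\<forall>v. continuous_on UNIV (\<lambda>x. f' x v)"
    "\<forall>x. (g has_derivative g' x) (at x)" "\<forall>v. continuous_on UNIV (\<lambda>x. g' x v)" by blast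
  have "continuous_on UNIV f" "continuous_on UNIV g"
    using mult.hyps by (auto intro: real_polynomial_continuous)
  then show ?case using *
    by (intro exI[of _ "\<lambda>x v. f x * g' x v + f' x v * g x"]) (auto intro!: has_derivative_mult continuous_intros)
qed

lemma test_fun_cutoff_polynomial:
  assumes R: "0 < R" and p: "real_polynomial_function p"
  shows "\<exists>\<psi>'. test_fun (\<lambda>x. cutoff a R x * p x) \<psi>' (cball a R)"
proof -
  obtain p' where p': "\<forall>x. (p has_derivative p' x) (at x)" "\<forall>v. continuous_on UNIV (\<lambda>x. p' x v)"
    using real_polynomial_C1[OF p] by blast
  have pc: "continuous_on UNIV p" using p by (rule real_polynomial_continuous)
  have "{x. cutoff a R x * p x \<noteq> 0} \<subseteq> cball a R"
    using cutoff_pos_iff[OF R] cutoff_bounds(1)[of a R] by (force simp: less_le)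
  then have supp: "closure {x. cutoff a R x * p x \<noteq> 0} \<subseteq> cball a R"
    by (rule closure_minimal) simp
  then have "compact (closure {x. cutoff a R x * p x \<noteq> 0})"
    by (meson bounded_cball bounded_subset closed_closure compact_eq_bounded_closed)
  then have "test_fun (\<lambda>x. cutoff a R x * p x) (\<lambda>x v. cutoff a R x * p' x v + bump_deriv a (1 / R\<^sup>2) x v * p x) (cball a R)"
    unfolding test_fun_def using supp p' pc cutoff_cont bump_deriv_cont bump_has_derivative[of a "1 / R\<^sup>2"]
    by (auto intro!: has_derivative_mult continuous_intros simp: cutoff_def)
  then show ?thesis by blast
qed

text \<open>The extremal multiplier would be \<open>sgn (F z)\<close>. It is the limit almost
  everywhere of continuous functions, which are truncated to values in \<open>[-1, 1]\<close> and
  then approximated on the ball by polynomials. Multiplication with the cutoff turns these into test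
  functions, and the weight in the conclusion is the price of compact support.\<close>

lemma L1_by_duality:
  assumes F [measurable]: "F \<in> borel_measurable borel" and K: "\<And>z. \<bar>F z\<bar> \<le> K" and R: "0 < R"
    and H: "\<And>\<psi> \<psi>'. test_fun \<psi> \<psi>' (cball a R) \<Longrightarrow> (\<And>x. \<bar>\<psi> x\<bar> \<le> 1) \<Longrightarrow> (\<integral>z. F z * \<psi> z \<partial>lborel) \<le> c"
  shows "(\<integral>\<^sup>+z. ennreal (cutoff a R z * \<bar>F z\<bar>) \<partial>lborel) \<le> ennreal c"
proof -
  have [measurable]: "cutoff a R \<in> borel_measurable borel" by (rule borel_measurable_continuous_onI[OF cutoff_cont])
  have out: "cutoff a R z = 0" if "z \<notin> cball a R" for z
    using cutoff_pos_iff[OF R, of a z] cutoff_bounds(1)[of a R z] that by (auto simp: less_le)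
  have "(\<lambda>z. sgn (F z)) \<in> borel_measurable lebesgue"
    by (intro measurable_completion) measurable
  then have "(\<lambda>z. sgn (F z)) measurable_on UNIV" by (rule lebesgue_measurable_imp_measurable_on) simp
  then obtain N g where N: "negligible N" and g: "\<And>n. continuous_on UNIV (g n)"
    "\<And>x. x \<notin> N \<Longrightarrow> (\<lambda>n. g n x) \<longlonglongrightarrow> sgn (F x)"
    unfolding measurable_on_def by auto
  define h where "h n x = max (-1) (min 1 (g n x :: real))" for n x
  have h_cont: "continuous_on UNIV (h n)" for n
    unfolding h_def by (intro continuous_on_max continuous_on_min continuous_intros g)
  have h_lim: "(\<lambda>n. h n x) \<longlonglongrightarrow> sgn (F x)" if "x \<notin> N" for x
  proof -
    have "(\<lambda>n. h n x) \<longlonglongrightarrow> max (-1) (min 1 (sgn (F x)))"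
      unfolding h_def by (intro tendsto_max tendsto_min tendsto_const g(2) that)
    then show ?thesis by (simp add: sgn_if split: if_splits)
  qed
  have poly_ex: "\<exists>p. real_polynomial_function p \<and> (\<forall>x\<in>cball a R. \<bar>h n x - p x\<bar> < 1 / real (Suc n))" for n
  proof -
    have "continuous_on (cball a R) (h n)" "0 < 1 / real (Suc n)"
      by (rule continuous_on_subset[OF h_cont subset_UNIV]) simp
    then obtain p where "real_polynomial_function p" "\<And>x. x \<in> cball a R \<Longrightarrow> \<bar>h n x - p x\<bar> < 1 / real (Suc n)"
      using Stone_Weierstrass_real_polynomial_function[OF compact_cball, of a R "h n" "1 / real (Suc n)"] by metis
    then show ?thesis by (intro exI[of _ p]) simp
  qed
  define p where "p n = (SOME p. real_polynomial_function p \<and> (\<forall>x\<in>cball a R. \<bar>h n x - p x\<bar> < 1 / real (Suc n)))" for n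
  have p: "real_polynomial_function (p n)" "x \<in> cball a R \<Longrightarrow> \<bar>h n x - p n x\<bar> < 1 / real (Suc n)" for n x
    using someI_ex[OF poly_ex[of n]] unfolding p_def by blast+
  \<comment> \<open>The polynomial may exceed the truncated function by \<open>1 / (n + 1)\<close>;
    the division restores the bound 1 on the ball without affecting the limit.\<close>
  define q where "q n x = 1 / (1 + 1 / real (Suc n)) * p n x" for n x
  have q_poly: "real_polynomial_function (q n)" for n
    unfolding q_def by (intro real_polynomial_function.intros p)
  have q_le: "\<bar>q n x\<bar> \<le> 1" if "x \<in> cball a R" for n x
  proof -
    have "\<bar>h n x\<bar> \<le> 1" unfolding h_def by (simp add: abs_le_iff)
    then have le: "\<bar>p n x\<bar> \<le> 1 + 1 / real (Suc n)"
      using p(2)[OF that, of n] by linarith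
    have pos: "0 < 1 + 1 / real (Suc n)" by (simp add: add_pos_nonneg)
    have "\<bar>q n x\<bar> = \<bar>p n x\<bar> / (1 + 1 / real (Suc n))"
      unfolding q_def abs_mult using pos by (simp only: abs_divide abs_of_pos abs_one) simp
    also have "\<dots> \<le> 1" using le pos by (simp only: divide_le_eq_1_pos)
    finally show ?thesis .
  qed
  define \<psi> where "\<psi> n x = cutoff a R x * q n x" for n x
  have \<psi>_le: "\<bar>\<psi> n x\<bar> \<le> 1" for n x
  proof (cases "x \<in> cball a R")
    case True
    then show ?thesis using q_le[OF True, of n] cutoff_bounds[of a R x]
      by (simp add: \<psi>_def abs_mult mult_le_one)
  qed (simp add: \<psi>_def out)
  have \<psi>_int: "(\<integral>z. F z * \<psi> n z \<partial>lborel) \<le> c" for n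
  proof -
    obtain \<psi>' where "test_fun (\<psi> n) \<psi>' (cball a R)"
      using test_fun_cutoff_polynomial[OF R q_poly, of a n] unfolding \<psi>_def[abs_def] by blast
    then show ?thesis by (rule H) (rule \<psi>_le)
  qed
  have p_lim: "(\<lambda>n. q n x) \<longlonglongrightarrow> sgn (F x)" if "x \<notin> N" "x \<in> cball a R" for x
  proof -
    have inv: "(\<lambda>n. 1 / real (Suc n)) \<longlonglongrightarrow> 0" using LIMSEQ_inverse_real_of_nat by (simp add: inverse_eq_divide)
    have "(\<lambda>n. h n x - p n x) \<longlonglongrightarrow> 0"
    proof (rule Lim_null_comparison[OF _ inv], intro always_eventually allI)
      show "norm (h n x - p n x) \<le> 1 / real (Suc n)" for n
        using p(2)[OF that(2), of n] by (simp del: of_nat_Suc)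
    qed
    from tendsto_diff[OF h_lim[OF that(1)] this] have "(\<lambda>n. p n x) \<longlonglongrightarrow> sgn (F x)" by simp
    then have "(\<lambda>n. 1 / (1 + 1 / real (Suc n)) * p n x) \<longlonglongrightarrow> 1 / (1 + 0) * sgn (F x)"
      by (intro tendsto_intros inv) auto
    then show ?thesis by (simp add: q_def)
  qed
  have q_meas [measurable]: "q n \<in> borel_measurable borel" for n
    by (rule borel_measurable_continuous_onI[OF real_polynomial_continuous[OF q_poly]])
  have \<psi>_meas [measurable]: "\<psi> n \<in> borel_measurable borel" for n unfolding \<psi>_def by measurable
  have K0: "0 \<le> K" using K[of a] by simp
  have dom: "integrable lborel (\<lambda>z. K * indicator (cball a R) z)"
    using emeasure_compact_finite[of "cball a R"] by (intro integrable_mult_right integrable_real_indicator) simp_all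
  have lim: "(\<lambda>n. \<integral>z. F z * \<psi> n z \<partial>lborel) \<longlonglongrightarrow> (\<integral>z. cutoff a R z * \<bar>F z\<bar> \<partial>lborel)"
  proof (rule integral_dominated_convergence[OF _ _ dom])
    have "AE z in lebesgue. z \<notin> N"
      using N by (simp add: AE_not_in negligible_iff_null_sets)
    then have "AE z in lborel. z \<notin> N" by (simp add: AE_completion_iff)
    then show "AE z in lborel. (\<lambda>n. F z * \<psi> n z) \<longlonglongrightarrow> cutoff a R z * \<bar>F z\<bar>"
    proof eventually_elim
      case (elim z)
      show ?case
      proof (cases "z \<in> cball a R")
        case True
        have "(\<lambda>n. F z * (cutoff a R z * q n z)) \<longlonglongrightarrow> F z * (cutoff a R z * sgn (F z))"
          by (intro tendsto_intros p_lim elim True)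
        also have "F z * (cutoff a R z * sgn (F z)) = cutoff a R z * \<bar>F z\<bar>" by (simp add: abs_sgn mult_ac)
        finally show ?thesis by (simp add: \<psi>_def)
      qed (simp add: \<psi>_def out)
    qed
    show "AE z in lborel. norm (F z * \<psi> n z) \<le> K * indicator (cball a R) z" for n
    proof (intro AE_I2)
      fix z
      show "norm (F z * \<psi> n z) \<le> K * indicator (cball a R) z"
      proof (cases "z \<in> cball a R")
        case True
        have "\<bar>F z\<bar> * \<bar>\<psi> n z\<bar> \<le> K * 1" by (intro mult_mono K \<psi>_le K0) auto
        then show ?thesis using True by (simp add: abs_mult)
      qed (simp add: \<psi>_def out)
    qed
  qed measurable
  have le: "(\<integral>z. cutoff a R z * \<bar>F z\<bar> \<partial>lborel) \<le> c"
    by (rule LIMSEQ_le_const2[OF lim]) (use \<psi>_int in auto)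
  have int: "integrable lborel (\<lambda>z. cutoff a R z * \<bar>F z\<bar>)"
  proof (rule integrable_bounded_support[where S="cball a R" and B="1 * K"])
    show "\<bar>cutoff a R z * \<bar>F z\<bar>\<bar> \<le> 1 * K" for z
      unfolding abs_mult using cutoff_bounds[of a R z] K[of z] by (intro mult_mono) auto
  qed (auto simp: out)
  have "(\<integral>\<^sup>+z. ennreal (cutoff a R z * \<bar>F z\<bar>) \<partial>lborel) = ennreal (\<integral>z. cutoff a R z * \<bar>F z\<bar> \<partial>lborel)"
    by (rule nn_integral_eq_integral[OF int]) (simp add: cutoff_bounds)
  then show ?thesis using le by (simp add: ennreal_leI)
qed

lemma nn_integral_increment_cutoff:
  assumes f [measurable]: "f \<in> borel_measurable borel" and K: "\<And>z. \<bar>f z\<bar> \<le> K" and R: "0 < R"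
    and H: "\<And>\<psi> \<psi>'. test_fun \<psi> \<psi>' U \<Longrightarrow> (\<And>x. \<bar>\<psi> x\<bar> \<le> 1) \<Longrightarrow> (\<integral>z. f z * \<psi>' z e \<partial>lborel) \<le> V"
    and \<epsilon>: "0 \<le> \<epsilon>" and sub: "\<And>z \<sigma>. z \<in> cball a R \<Longrightarrow> 0 \<le> \<sigma> \<Longrightarrow> \<sigma> \<le> \<epsilon> \<Longrightarrow> z + \<sigma> *\<^sub>R e \<in> U"
  shows "(\<integral>\<^sup>+z. ennreal (cutoff a R z * \<bar>f (z + \<epsilon> *\<^sub>R e) - f z\<bar>) \<partial>lborel) \<le> ennreal (\<epsilon> * V)"
proof (rule L1_by_duality[OF _ _ R])
  show "\<bar>f (z + \<epsilon> *\<^sub>R e) - f z\<bar> \<le> K + K" for z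
    using K[of "z + \<epsilon> *\<^sub>R e"] K[of z] by linarith
  show "(\<integral>z. (f (z + \<epsilon> *\<^sub>R e) - f z) * \<psi> z \<partial>lborel) \<le> \<epsilon> * V"
    if "test_fun \<psi> \<psi>' (cball a R)" "\<And>x. \<bar>\<psi> x\<bar> \<le> 1" for \<psi> \<psi>'
  proof (rule integral_increment_test_fun[where f=f and K=K and U=U and V=V and e=e and \<psi>'=\<psi>' and S="cball a R"])
    show "(\<integral>z. f z * \<psi>' z e \<partial>lborel) \<le> V" if "test_fun \<psi> \<psi>' U" "\<And>x. \<bar>\<psi> x\<bar> \<le> 1" for \<psi> \<psi>'
      by (rule H[OF that])
    show "z + \<sigma> *\<^sub>R e \<in> U" if "z \<in> cball a R" "0 \<le> \<sigma>" "\<sigma> \<le> \<epsilon>" for z \<sigma>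
      by (rule sub[OF that])
  qed (rule f K that \<epsilon>)+
qed measurable

text \<open>As the radius grows the cutoffs tend to 1 pointwise while the bound stays the same, so
  Fatou's lemma removes the weight.\<close>

lemma nn_integral_increment_UNIV:
  assumes f [measurable]: "f \<in> borel_measurable borel" and K: "\<And>z. \<bar>f z\<bar> \<le> K"
    and H: "\<And>\<psi> \<psi>'. test_fun \<psi> \<psi>' UNIV \<Longrightarrow> (\<And>x. \<bar>\<psi> x\<bar> \<le> 1) \<Longrightarrow> (\<integral>z. f z * \<psi>' z e \<partial>lborel) \<le> V"
    and \<epsilon>: "0 \<le> \<epsilon>"
  shows "(\<integral>\<^sup>+z. ennreal \<bar>f (z + \<epsilon> *\<^sub>R e) - f z\<bar> \<partial>lborel) \<le> ennreal (\<epsilon> * V)"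
proof -
  let ?F = "\<lambda>z. \<bar>f (z + \<epsilon> *\<^sub>R e) - f z\<bar>"
  have [measurable]: "cutoff 0 R \<in> borel_measurable borel" for R by (rule borel_measurable_continuous_onI[OF cutoff_cont])
  have inv: "(\<lambda>n. 1 / (real (Suc n))\<^sup>2) \<longlonglongrightarrow> 0"
    using tendsto_power[OF LIMSEQ_inverse_real_of_nat, of 2] by (simp add: inverse_eq_divide power_divide)
  have lim: "(\<lambda>n. ennreal (cutoff 0 (real (Suc n)) z * ?F z)) \<longlonglongrightarrow> ennreal (?F z)" for z
  proof -
    have "(\<lambda>n. cutoff 0 (real (Suc n)) z * ?F z) \<longlonglongrightarrow> (max 0 (1 - 0 * ((z - 0) \<bullet> (z - 0))))\<^sup>2 * ?F z"
      unfolding cutoff_def bump_def by (intro tendsto_intros tendsto_max inv)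
    then show ?thesis by simp
  qed
  have "(\<integral>\<^sup>+z. ennreal (?F z) \<partial>lborel) = (\<integral>\<^sup>+z. liminf (\<lambda>n. ennreal (cutoff 0 (real (Suc n)) z * ?F z)) \<partial>lborel)"
    using lim_imp_Liminf[OF _ lim] by simp
  also have "\<dots> \<le> liminf (\<lambda>n. \<integral>\<^sup>+z. ennreal (cutoff 0 (real (Suc n)) z * ?F z) \<partial>lborel)"
    by (rule nn_integral_liminf) measurable
  also have "\<dots> \<le> liminf (\<lambda>n. ennreal (\<epsilon> * V))"
    by (intro Liminf_mono always_eventually allI nn_integral_increment_cutoff[where U=UNIV and K=K] f K H \<epsilon>) auto
  also have "\<dots> = ennreal (\<epsilon> * V)" by (simp add: Liminf_const)
  finally show ?thesis .
qed

section \<open>From total variation to translations and local constancy\<close>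

text \<open>The shift is split into two axis-parallel ones and each is estimated in both components;
  the four scalar bounds account for the factor 4.\<close>

lemma nn_integral_translate_dvar:
  fixes b :: "real^2 \<Rightarrow> real^2"
  assumes b [measurable]: "b \<in> borel_measurable borel" and bd: "\<And>z. norm (b z) \<le> 2" and fin: "dvar b UNIV < \<infinity>"
  shows "(\<integral>\<^sup>+z. ennreal (norm (b (z + w) - b z)) \<partial>lborel) \<le> ennreal (norm w * (4 * real_of_ereal (dvar b UNIV)))"
proof -
  define V where "V = real_of_ereal (dvar b UNIV)"
  have H: "(\<integral>z. b z $ i * \<psi>' z (axis j 1) \<partial>lborel) \<le> V"
    if "test_fun \<psi> \<psi>' UNIV" "\<And>x. \<bar>\<psi> x\<bar> \<le> 1" for \<psi> \<psi>' i j
    using dvar_test_fun[OF that, where b=b and i=i and j=j] fin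
    unfolding V_def by (cases "dvar b UNIV") auto
  have "test_fun (\<lambda>_. 0) (\<lambda>_ _. 0) UNIV" by (simp add: test_fun_def)
  from H[OF this] have V0: "0 \<le> V" by simp
  have bi: "(\<lambda>z. b z $ i) \<in> borel_measurable borel" for i by measurable
  have bK: "\<bar>b z $ i\<bar> \<le> 2" for z i using component_le_norm_cart[of "b z" i] bd[of z] by simp
  have pos: "(\<integral>\<^sup>+z. ennreal \<bar>b (z + \<epsilon> *\<^sub>R axis j 1) $ i - b z $ i\<bar> \<partial>lborel) \<le> ennreal (\<epsilon> * V)" if "0 \<le> \<epsilon>" for \<epsilon> i j
    by (rule nn_integral_increment_UNIV[where K=2]) (use bi bK H that in auto)
  have dir: "(\<integral>\<^sup>+z. ennreal \<bar>b (z + \<epsilon> *\<^sub>R axis j 1) $ i - b z $ i\<bar> \<partial>lborel) \<le> ennreal (\<bar>\<epsilon>\<bar> * V)" for \<epsilon> i j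
  proof (cases "0 \<le> \<epsilon>")
    case False
    have "(\<integral>\<^sup>+z. ennreal \<bar>b (z + \<epsilon> *\<^sub>R axis j 1) $ i - b z $ i\<bar> \<partial>lborel)
      = (\<integral>\<^sup>+z. ennreal \<bar>b ((z + (- \<epsilon>) *\<^sub>R axis j 1) + \<epsilon> *\<^sub>R axis j 1) $ i - b (z + (- \<epsilon>) *\<^sub>R axis j 1) $ i\<bar> \<partial>lborel)"
      by (rule nn_integral_translate[symmetric]) measurable
    also have "\<dots> = (\<integral>\<^sup>+z. ennreal \<bar>b (z + (- \<epsilon>) *\<^sub>R axis j 1) $ i - b z $ i\<bar> \<partial>lborel)"
      by (simp add: abs_minus_commute)
    also have "\<dots> \<le> ennreal ((- \<epsilon>) * V)" using False by (intro pos) simp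
    finally show ?thesis using False by simp
  qed (use pos in simp)
  define u :: "real^2" where "u = (w $ 1) *\<^sub>R axis 1 1"
  define v :: "real^2" where "v = (w $ 2) *\<^sub>R axis 2 1"
  have w: "w = u + v" by (simp add: u_def v_def vec_eq_iff forall_2 axis_def)
  have "(\<integral>\<^sup>+z. ennreal (norm (b (z + w) - b z)) \<partial>lborel) \<le>
    (\<integral>\<^sup>+z. (ennreal \<bar>b ((z + u) + v) $ 1 - b (z + u) $ 1\<bar> + ennreal \<bar>b ((z + u) + v) $ 2 - b (z + u) $ 2\<bar>)
      + (ennreal \<bar>b (z + u) $ 1 - b z $ 1\<bar> + ennreal \<bar>b (z + u) $ 2 - b z $ 2\<bar>) \<partial>lborel)"
  proof (rule nn_integral_mono)
    fix z
    have "norm (b (z + w) - b z) \<le> \<bar>b (z + w) $ 1 - b z $ 1\<bar> + \<bar>b (z + w) $ 2 - b z $ 2\<bar>"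
      using norm_le_l1_cart[of "b (z + w) - b z"] by (simp add: sum_2)
    also have "\<dots> \<le> (\<bar>b ((z + u) + v) $ 1 - b (z + u) $ 1\<bar> + \<bar>b ((z + u) + v) $ 2 - b (z + u) $ 2\<bar>)
      + (\<bar>b (z + u) $ 1 - b z $ 1\<bar> + \<bar>b (z + u) $ 2 - b z $ 2\<bar>)"
      unfolding w add.assoc[symmetric] by linarith
    finally show "ennreal (norm (b (z + w) - b z)) \<le> (ennreal \<bar>b ((z + u) + v) $ 1 - b (z + u) $ 1\<bar> + ennreal \<bar>b ((z + u) + v) $ 2 - b (z + u) $ 2\<bar>)
      + (ennreal \<bar>b (z + u) $ 1 - b z $ 1\<bar> + ennreal \<bar>b (z + u) $ 2 - b z $ 2\<bar>)"
      by (simp add: ennreal_leI flip: ennreal_plus)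
  qed
  also have "\<dots> = ((\<integral>\<^sup>+z. ennreal \<bar>b ((z + u) + v) $ 1 - b (z + u) $ 1\<bar> \<partial>lborel) + (\<integral>\<^sup>+z. ennreal \<bar>b ((z + u) + v) $ 2 - b (z + u) $ 2\<bar> \<partial>lborel))
      + ((\<integral>\<^sup>+z. ennreal \<bar>b (z + u) $ 1 - b z $ 1\<bar> \<partial>lborel) + (\<integral>\<^sup>+z. ennreal \<bar>b (z + u) $ 2 - b z $ 2\<bar> \<partial>lborel))"
    by (simp add: nn_integral_add)
  also have "\<dots> = ((\<integral>\<^sup>+z. ennreal \<bar>b (z + v) $ 1 - b z $ 1\<bar> \<partial>lborel) + (\<integral>\<^sup>+z. ennreal \<bar>b (z + v) $ 2 - b z $ 2\<bar> \<partial>lborel))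
      + ((\<integral>\<^sup>+z. ennreal \<bar>b (z + u) $ 1 - b z $ 1\<bar> \<partial>lborel) + (\<integral>\<^sup>+z. ennreal \<bar>b (z + u) $ 2 - b z $ 2\<bar> \<partial>lborel))"
    using nn_integral_translate[of "\<lambda>z. ennreal \<bar>b (z + v) $ 1 - b z $ 1\<bar>" u]
      nn_integral_translate[of "\<lambda>z. ennreal \<bar>b (z + v) $ 2 - b z $ 2\<bar>" u] by simp
  also have "\<dots> \<le> (ennreal (\<bar>w $ 2\<bar> * V) + ennreal (\<bar>w $ 2\<bar> * V)) + (ennreal (\<bar>w $ 1\<bar> * V) + ennreal (\<bar>w $ 1\<bar> * V))"
    unfolding u_def v_def by (intro add_mono dir)
  also have "\<dots> = ennreal (2 * \<bar>w $ 1\<bar> * V + 2 * \<bar>w $ 2\<bar> * V)"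
    using V0 by (simp add: ennreal_plus[symmetric] del: ennreal_plus)
  also have "\<dots> \<le> ennreal (norm w * (4 * V))"
  proof (rule ennreal_leI)
    have "\<bar>w $ 1\<bar> * V \<le> norm w * V" "\<bar>w $ 2\<bar> * V \<le> norm w * V"
      using component_le_norm_cart[of w] V0 by (auto intro!: mult_right_mono)
    then show "2 * \<bar>w $ 1\<bar> * V + 2 * \<bar>w $ 2\<bar> * V \<le> norm w * (4 * V)" by simp
  qed
  finally show ?thesis by (simp add: V_def)
qed

lemma dvar_zero_translate:
  fixes b :: "real^2 \<Rightarrow> real^2"
  assumes b [measurable]: "b \<in> borel_measurable borel" and bd: "\<And>z. norm (b z) \<le> 2" and zero: "dvar b U = 0"
    and R: "0 < R" and \<epsilon>: "0 \<le> \<epsilon>" and sub: "cball a (R + \<epsilon>) \<subseteq> U"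
  shows "AE z in lborel. z \<in> ball a R \<longrightarrow> b (z + \<epsilon> *\<^sub>R axis j 1) = b z"
proof -
  have [measurable]: "cutoff a R \<in> borel_measurable borel" by (rule borel_measurable_continuous_onI[OF cutoff_cont])
  have comp: "AE z in lborel. z \<in> ball a R \<longrightarrow> b (z + \<epsilon> *\<^sub>R axis j 1) $ i = b z $ i" for i
  proof -
    have "(\<integral>\<^sup>+z. ennreal (cutoff a R z * \<bar>b (z + \<epsilon> *\<^sub>R axis j 1) $ i - b z $ i\<bar>) \<partial>lborel) \<le> ennreal (\<epsilon> * 0)"
    proof (rule nn_integral_increment_cutoff[where U=U and K=2, OF _ _ R _ \<epsilon>])
      show "(\<integral>z. b z $ i * \<psi>' z (axis j 1) \<partial>lborel) \<le> 0"
        if "test_fun \<psi> \<psi>' U" "\<And>x. \<bar>\<psi> x\<bar> \<le> 1" for \<psi> \<psi>'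
        using dvar_test_fun[OF that, where b=b and i=i and j=j] zero by simp
      show "\<bar>b z $ i\<bar> \<le> 2" for z using component_le_norm_cart[of "b z" i] bd[of z] by simp
      show "z + \<sigma> *\<^sub>R axis j 1 \<in> U" if "z \<in> cball a R" "0 \<le> \<sigma>" "\<sigma> \<le> \<epsilon>" for z \<sigma>
      proof -
        have "norm (z + \<sigma> *\<^sub>R axis j 1 - a) \<le> norm (z - a) + norm (\<sigma> *\<^sub>R axis j (1::real))"
          using norm_triangle_ineq[of "z - a" "\<sigma> *\<^sub>R axis j (1::real)"] by (simp add: algebra_simps)
        also have "\<dots> \<le> R + \<epsilon>" using that by (simp add: dist_norm norm_minus_commute norm_axis_1)
        finally show ?thesis using sub by (auto simp: dist_norm norm_minus_commute)
      qed
    qed measurable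
    then have "AE z in lborel. ennreal (cutoff a R z * \<bar>b (z + \<epsilon> *\<^sub>R axis j 1) $ i - b z $ i\<bar>) = 0"
      by (subst nn_integral_0_iff_AE[symmetric]) auto
    then show ?thesis
    proof eventually_elim
      case (elim z)
      then show ?case
        using cutoff_pos_iff[OF R, of a z] by (auto simp: ennreal_eq_0_iff mult_le_0_iff)
    qed
  qed
  show ?thesis using comp[of 1] comp[of 2] by eventually_elim (auto simp: vec_eq_iff forall_2)
qed

text \<open>For each small shift \<open>w\<close> the identity \<open>b (z + w) = b z\<close> fails
  only on a null set of \<open>z\<close>, but this set depends on \<open>w\<close>. Tonelli provides
  a single \<open>z0\<close> for which it holds for almost every \<open>w\<close>, so
  \<open>b\<close> has the value \<open>b z0\<close> almost everywhere on a square with corner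
  \<open>z0\<close>.\<close>

lemma locally_constant_if_dvar_zero:
  fixes b :: "real^2 \<Rightarrow> real^2"
  assumes b [measurable]: "b \<in> borel_measurable borel" and bd: "\<And>z. norm (b z) \<le> 2" and zero: "dvar b U = 0"
    and U: "open U" "x \<in> U"
  shows "\<exists>c. \<exists>\<rho>>0. AE y in lborel. y \<in> ball x \<rho> \<longrightarrow> b y = c"
proof -
  obtain r0 where r0: "0 < r0" "cball x r0 \<subseteq> U" using U open_contains_cball by blast
  define r where "r = r0 / 4"
  have r: "0 < r" "cball x (4 * r) \<subseteq> U" using r0 by (auto simp: r_def)
  \<comment> \<open>Only shifts with nonnegative coordinates are used. So the base point
    \<open>a\<close> is placed diagonally below \<open>x\<close>, which makes \<open>x\<close> the
    centre of the square swept out by the shifts in \<open>Q\<close>.\<close>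
  define h :: "real^2" where "h = (\<chi> i. r / 2)"
  define a where "a = x - h"
  have norm_le: "norm v \<le> \<bar>v$1\<bar> + \<bar>v$2\<bar>" for v :: "real^2" using norm_le_l1_cart[of v] by (simp add: sum_2)
  have "norm (x - a) \<le> r" using norm_le[of h] r by (simp add: a_def h_def)
  have cb: "cball a t \<subseteq> U" if "t \<le> 3 * r" for t
  proof
    fix y assume "y \<in> cball a t"
    then have "dist x y \<le> 4 * r"
      using dist_triangle[of x y a] \<open>norm (x - a) \<le> r\<close> that by (simp add: dist_norm)
    then show "y \<in> U" using r(2) by auto
  qed
  define Q :: "(real^2) set" where "Q = cbox 0 (\<chi> i. r)"
  have shift: "AE z in lborel. z \<in> ball a r \<longrightarrow> b (z + w) = b z" if w: "w \<in> Q" for w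
  proof -
    have w01: "0 \<le> w$1" "w$1 \<le> r" "0 \<le> w$2" "w$2 \<le> r"
      using w by (auto simp: Q_def mem_box_cart)
    define u :: "real^2" where "u = (w$1) *\<^sub>R axis 1 1"
    define v :: "real^2" where "v = (w$2) *\<^sub>R axis 2 1"
    have ww: "w = u + v" by (simp add: u_def v_def vec_eq_iff forall_2 axis_def)
    have "norm u \<le> r" using w01 by (simp add: u_def norm_axis_1)
    have 1: "AE z in lborel. z \<in> ball a (2 * r) \<longrightarrow> b (z + u) = b z"
      unfolding u_def by (rule dvar_zero_translate[OF b bd zero]) (use r w01 cb in auto)
    have 2: "AE z in lborel. z \<in> ball a (2 * r) \<longrightarrow> b (z + v) = b z"
      unfolding v_def by (rule dvar_zero_translate[OF b bd zero]) (use r w01 cb in auto)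
    show ?thesis using 1 AE_translate_lborel[OF 2, of u]
    proof eventually_elim
      case (elim z)
      show ?case
      proof
        assume z: "z \<in> ball a r"
        have "norm (z + u - a) \<le> norm (z - a) + norm u"
          using norm_triangle_ineq[of "z - a" u] by (simp add: algebra_simps)
        then have "z + u \<in> ball a (2 * r)" "z \<in> ball a (2 * r)"
          using z \<open>norm u \<le> r\<close> r by (simp_all add: dist_norm norm_minus_commute)
        then show "b (z + w) = b z" using elim by (simp add: ww add.assoc)
      qed
    qed
  qed
  have [measurable]: "Q \<in> sets borel" by (simp add: Q_def)
  define A where "A = (Q \<times> ball a r) \<inter> {p. 0 < norm (b (snd p + fst p) - b (snd p))}"
  have "{p. 0 < norm (b (snd p + fst p) - b (snd p))} \<in> sets borel" by measurable
  then have [measurable]: "A \<in> sets borel" unfolding A_def by (intro sets.Int borel_Times) auto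
  have "(\<integral>\<^sup>+z. (\<integral>\<^sup>+w. indicator A (w, z) \<partial>lborel) \<partial>lborel) = (\<integral>\<^sup>+w. (\<integral>\<^sup>+z. indicator A (w, z) \<partial>lborel) \<partial>lborel)"
    by (rule nn_integral_swap_lborel[symmetric]) measurable
  also have "\<dots> = (\<integral>\<^sup>+w. 0 \<partial>(lborel :: (real^2) measure))"
  proof (rule nn_integral_cong)
    fix w
    have "(\<integral>\<^sup>+z. indicator A (w, z) \<partial>lborel) = (\<integral>\<^sup>+z. 0 \<partial>(lborel :: (real^2) measure))"
    proof (rule nn_integral_cong_AE)
      show "AE z in lborel. indicator A (w, z) = (0::ennreal)"
      proof (cases "w \<in> Q")
        case True
        show ?thesis using shift[OF True] by eventually_elim (auto simp: A_def)
      qed (simp add: A_def)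
    qed
    then show "(\<integral>\<^sup>+z. indicator A (w, z) \<partial>lborel) = 0" by simp
  qed
  finally have "(\<integral>\<^sup>+z. (\<integral>\<^sup>+w. indicator A (w, z) \<partial>lborel) \<partial>lborel) = 0" by simp
  then have "AE z in lborel. (\<integral>\<^sup>+w. indicator A (w, z) \<partial>lborel) = 0"
    by (subst (asm) nn_integral_0_iff_AE) auto
  from AE_witness_open[OF this, of "ball a (r / 8)"] r obtain z0 where
    z0: "z0 \<in> ball a (r / 8)" "(\<integral>\<^sup>+w. indicator A (w, z0) \<partial>lborel) = 0" by auto
  have "AE w in lborel. indicator A (w, z0) = (0::ennreal)"
    using z0(2) by (subst (asm) nn_integral_0_iff_AE) auto
  then have "AE y in lborel. indicator A (y + - z0, z0) = (0::ennreal)" by (rule AE_translate_lborel)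
  then have "AE y in lborel. y \<in> ball x (r / 4) \<longrightarrow> b y = b z0"
  proof eventually_elim
    case (elim y)
    show ?case
    proof
      assume y: "y \<in> ball x (r / 4)"
      have "0 \<le> (y - z0) $ i \<and> (y - z0) $ i \<le> r" for i
      proof -
        have "\<bar>(y - x) $ i\<bar> \<le> r / 4" "\<bar>(a - z0) $ i\<bar> \<le> r / 8"
          using component_le_norm_cart[of "y - x" i] component_le_norm_cart[of "a - z0" i] y z0(1)
          by (auto simp: dist_norm norm_minus_commute)
        moreover have "(y - z0) $ i = (y - x) $ i + r / 2 + (a - z0) $ i" by (simp add: a_def h_def)
        ultimately show ?thesis using r by linarith
      qed
      then have "y + - z0 \<in> Q" by (auto simp: Q_def mem_box_cart)
      moreover have "z0 \<in> ball a r" using z0(1) r by auto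
      ultimately show "b y = b z0" using elim by (auto simp: A_def indicator_def split: if_splits)
    qed
  qed
  then show ?thesis using r by (intro exI[of _ "b z0"] exI[of _ "r / 4"]) auto
qed

text \<open>Off the support of its derivative the field is locally constant. Every component of the
  complement of a nonempty support meets \<open>\<Omega>\<close>, since its frontier lies in the support.\<close>

lemma constant_or_first_component_ge_1:
  fixes b :: "real^2 \<Rightarrow> real^2"
  assumes b: "b \<in> borel_measurable borel" and bd: "\<And>z. norm (b z) \<le> 2"
    and \<Omega>: "open \<Omega>" "dvar_support b \<subseteq> \<Omega>" and ge: "AE x in lborel. x \<in> \<Omega> \<longrightarrow> 1 \<le> b x $ 1"
  shows "(\<exists>c. AE x in lborel. b x = c) \<or> (AE x in lborel. 1 \<le> b x $ 1)"
proof -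
  define W where "W = - dvar_support b"
  have W_open: "open W" unfolding W_def dvar_support_def double_complement by (rule open_Union) blast
  define S where "S v = {x. x \<in> W \<and> (\<exists>\<rho>>0. AE y in lborel. y \<in> ball x \<rho> \<longrightarrow> b y = v)}" for v
  have cover: "\<exists>v. x \<in> S v" if "x \<in> W" for x
  proof -
    have "x \<in> \<Union>{U. open U \<and> dvar b U = 0}"
      using that unfolding W_def dvar_support_def double_complement .
    then obtain U where U: "U \<in> {U. open U \<and> dvar b U = 0}" "x \<in> U" by (rule UnionE)
    then have "open U" "dvar b U = 0" by simp_all
    from locally_constant_if_dvar_zero[OF b bd this(2,1) U(2)]
    obtain c where "\<exists>\<rho>>0. AE y in lborel. y \<in> ball x \<rho> \<longrightarrow> b y = c" by (rule exE)
    then have "x \<in> S c" using that by (simp add: S_def)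
    then show ?thesis by (rule exI)
  qed
  have S_open: "open (S v)" for v
    unfolding open_contains_ball
  proof
    fix x assume "x \<in> S v"
    then obtain \<rho> where \<rho>: "0 < \<rho>" "AE y in lborel. y \<in> ball x \<rho> \<longrightarrow> b y = v" and xW: "x \<in> W" by (auto simp: S_def)
    obtain e where e: "0 < e" "ball x e \<subseteq> W" using W_open xW open_contains_ball by blast
    have "ball x (min e (\<rho> / 2)) \<subseteq> S v"
    proof
      fix y assume y: "y \<in> ball x (min e (\<rho> / 2))"
      have "ball y (\<rho> / 2) \<subseteq> ball x \<rho>"
      proof
        fix z assume "z \<in> ball y (\<rho> / 2)"
        then show "z \<in> ball x \<rho>" using y dist_triangle[of x z y] by auto
      qed
      then have "AE z in lborel. z \<in> ball y (\<rho> / 2) \<longrightarrow> b z = v"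
        using \<rho>(2) by (auto elim!: eventually_mono)
      then show "y \<in> S v" using y e \<rho>(1) by (auto simp: S_def intro!: exI[of _ "\<rho> / 2"])
    qed
    then show "\<exists>e>0. ball x e \<subseteq> S v" using e \<rho>(1) by (intro exI[of _ "min e (\<rho> / 2)"]) auto
  qed
  have unique: "u = v" if xS: "x \<in> S u" "x \<in> S v" for x u v
  proof -
    obtain \<rho> \<rho>' where "0 < \<rho>" "0 < \<rho>'" and
      ae: "AE y in lborel. y \<in> ball x \<rho> \<longrightarrow> b y = u" "AE y in lborel. y \<in> ball x \<rho>' \<longrightarrow> b y = v"
      using xS by (auto simp: S_def)
    have "AE y in lborel. y \<in> ball x (min \<rho> \<rho>') \<longrightarrow> u = v" using ae by eventually_elim auto
    from AE_witness_open[OF this, of "ball x (min \<rho> \<rho>')"] show ?thesis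
      using \<open>0 < \<rho>\<close> \<open>0 < \<rho>'\<close> by auto
  qed
  have conn: "D \<subseteq> S v" if D: "connected D" "D \<subseteq> W" "x \<in> D" "x \<in> S v" for D x v
  proof (rule ccontr)
    assume "\<not> D \<subseteq> S v"
    then obtain y where y: "y \<in> D" "y \<notin> S v" by blast
    let ?O = "\<Union>u\<in>-{v}. S u"
    have O: "open ?O" using S_open by auto
    have "D \<subseteq> S v \<union> ?O"
    proof
      fix z assume "z \<in> D"
      then obtain u where "z \<in> S u" using D(2) cover[of z] by auto
      then show "z \<in> S v \<union> ?O" by (cases "u = v") auto
    qed
    moreover have "S v \<inter> ?O \<inter> D = {}" by (auto dest: unique)
    ultimately have "S v \<inter> D = {} \<or> ?O \<inter> D = {}" using connectedD[OF D(1) S_open[of v] O] by simp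
    moreover have "S v \<inter> D \<noteq> {}" using D(3,4) by auto
    moreover have "?O \<inter> D \<noteq> {}"
    proof -
      obtain u where "y \<in> S u" using y(1) D(2) cover[of y] by auto
      then show ?thesis using y by (cases "u = v") auto
    qed
    ultimately show False by simp
  qed
  have S_AE: "AE y in lborel. y \<in> S v \<longrightarrow> b y = v" for v
    by (rule AE_local) (auto simp: S_def)
  show ?thesis
  \<comment> \<open>With empty support the frontier argument has nothing to start from, and
    \<open>\<Omega>\<close> may even be empty; but then the connected plane carries a single value
    of \<open>b\<close>.\<close>
  proof (cases "dvar_support b = {}")
    case True
    then have "W = UNIV" by (simp add: W_def)
    obtain v where v: "0 \<in> S v" using cover[of 0] unfolding \<open>W = UNIV\<close> by blast
    have "UNIV \<subseteq> S v"
      by (rule conn[OF connected_UNIV, of 0 v]) (simp_all add: v \<open>W = UNIV\<close>)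
    then have "y \<in> S v" for y by blast
    then have "AE y in lborel. b y = v" using S_AE[of v] by simp
    then show ?thesis by blast
  next
    case False
    have first: "1 \<le> v $ 1" if x: "x \<in> S v" for x v
    proof -
      have xW: "x \<in> W" using x by (simp add: S_def)
      define D where "D = connected_component_set W x"
      have D: "connected D" "D \<subseteq> W" "x \<in> D" "open D"
        using xW W_open unfolding D_def
        by (simp_all add: connected_component_subset open_connected_component connected_component_refl)
      have "D \<noteq> UNIV" using D(2) False by (auto simp: W_def)
      then have "frontier D \<noteq> {}" using D(3) frontier_eq_empty by blast
      then obtain p where p: "p \<in> frontier D" by blast
      have "frontier D \<subseteq> frontier W"
        unfolding D_def by (rule frontier_of_connected_component_subset)
      then have "p \<notin> W" using p W_open by (auto simp: frontier_def interior_open)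
      then have "p \<in> \<Omega>" using \<Omega> by (auto simp: W_def)
      moreover have "p \<in> closure D" using p by (simp add: frontier_def)
      ultimately have "\<Omega> \<inter> D \<noteq> {}" using open_Int_closure_eq_empty[OF \<Omega>(1), of D] by auto
      then have ne: "\<Omega> \<inter> D \<noteq> {}" "open (\<Omega> \<inter> D)" using \<Omega>(1) D(4) by auto
      have "AE y in lborel. (y \<in> \<Omega> \<longrightarrow> 1 \<le> b y $ 1) \<and> (y \<in> S v \<longrightarrow> b y = v)"
        using ge S_AE[of v] by eventually_elim auto
      from AE_witness_open[OF this ne(2) ne(1)]
      obtain y where "y \<in> \<Omega>" "y \<in> D" "1 \<le> b y $ 1" "y \<in> S v \<longrightarrow> b y = v" by blast
      moreover have "y \<in> S v" using conn[OF D(1,2,3) x] \<open>y \<in> D\<close> by blast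
      ultimately show ?thesis by simp
    qed
    have "AE y in lborel. y \<in> W \<longrightarrow> 1 \<le> b y $ 1"
    proof (rule AE_local)
      fix x assume "x \<in> W"
      then obtain v where v: "x \<in> S v" using cover by blast
      then obtain \<rho> where \<rho>: "0 < \<rho>" "AE y in lborel. y \<in> ball x \<rho> \<longrightarrow> b y = v" by (auto simp: S_def)
      have "AE y in lborel. y \<in> ball x \<rho> \<longrightarrow> 1 \<le> b y $ 1"
        using \<rho>(2) first[OF v] by (auto elim!: eventually_mono)
      then show "\<exists>\<rho>>0. AE y in lborel. y \<in> ball x \<rho> \<longrightarrow> 1 \<le> b y $ 1" using \<rho>(1) by blast
    qed
    then have "AE x in lborel. 1 \<le> b x $ 1"
      using ge by eventually_elim (use \<Omega>(2) in \<open>auto simp: W_def\<close>)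
    then show ?thesis ..
  qed
qed

section \<open>The logarithmic estimate\<close>

text \<open>The flow is studied on pairs because there Lebesgue measure is a product measure, and
  integrals over the plane become iterated integrals over vertical lines.\<close>

definition to_pair :: "real^2 \<Rightarrow> real \<times> real" where "to_pair v = (v $ 1, v $ 2)"

definition of_pair :: "real \<times> real \<Rightarrow> real^2" where "of_pair z = vector [fst z, snd z]"

lemma of_pair_to_pair [simp]: "of_pair (to_pair v) = v" by (simp add: of_pair_def to_pair_def vec_eq_iff forall_2)

lemma to_pair_of_pair [simp]: "to_pair (of_pair z) = z" by (simp add: of_pair_def to_pair_def)

lemma to_pair_add: "to_pair (v + w) = to_pair v + to_pair w" by (simp add: to_pair_def)

lemma to_pair_diff: "to_pair (v - w) = to_pair v - to_pair w" by (simp add: to_pair_def)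

lemma to_pair_scaleR: "to_pair (c *\<^sub>R v) = c *\<^sub>R to_pair v" by (simp add: to_pair_def)

lemma of_pair_add: "of_pair (v + w) = of_pair v + of_pair w" by (simp add: of_pair_def vec_eq_iff forall_2)

lemma norm_to_pair [simp]: "norm (to_pair v) = norm v"
  by (simp add: to_pair_def norm_Pair norm_vec_def L2_set_def sum_2)

lemma norm_of_pair [simp]: "norm (of_pair z) = norm z"
  by (metis norm_to_pair to_pair_of_pair)

lemma bounded_linear_to_pair: "bounded_linear to_pair"
  by (rule bounded_linear_intro[where K=1]) (simp_all add: to_pair_add to_pair_scaleR)

lemma to_pair_cont: "continuous_on UNIV to_pair"
  by (rule linear_continuous_on[OF bounded_linear_to_pair])

lemma bounded_linear_of_pair: "bounded_linear of_pair"
proof (rule bounded_linear_intro[where K=1])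
  show "of_pair (c *\<^sub>R z) = c *\<^sub>R of_pair z" for c z by (simp add: of_pair_def vec_eq_iff forall_2)
qed (simp_all add: of_pair_add)

lemma of_pair_cont: "continuous_on UNIV of_pair"
  by (rule linear_continuous_on[OF bounded_linear_of_pair])

lemma to_pair_meas [measurable]: "to_pair \<in> borel_measurable borel"
  by (rule borel_measurable_continuous_onI[OF to_pair_cont])

lemma of_pair_meas [measurable]: "of_pair \<in> borel_measurable borel"
  by (rule borel_measurable_continuous_onI[OF of_pair_cont])

lemma prod_Basis_vec2: "(\<Prod>e\<in>Basis. f e) = f (axis 1 1) * f (axis 2 1)" for f :: "real^2 \<Rightarrow> real"
proof -
  have B: "(Basis :: (real^2) set) = {axis 1 1, axis 2 1}"
    by (auto simp: Basis_vec_def UNIV_2)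
  show ?thesis unfolding B by (simp add: axis_eq_axis)
qed

lemma prod_Basis_pair: "(\<Prod>e\<in>Basis. f e) = f (1, 0) * f (0, 1)" for f :: "real \<times> real \<Rightarrow> real"
proof -
  have B: "(Basis :: (real \<times> real) set) = {(1, 0), (0, 1)}"
    by (auto simp: Basis_prod_def)
  show ?thesis unfolding B by simp
qed

lemma distr_to_pair: "distr lborel borel to_pair = lborel"
proof (rule lborel_eqI[symmetric])
  fix l u :: "real \<times> real" assume lu: "\<And>e. e \<in> Basis \<Longrightarrow> l \<bullet> e \<le> u \<bullet> e"
  have le: "fst l \<le> fst u" "snd l \<le> snd u"
    using lu[of "(1, 0)"] lu[of "(0, 1)"] by (auto simp: Basis_prod_def inner_prod_def)
  have "z \<in> box l u \<longleftrightarrow> fst l < fst z \<and> fst z < fst u \<and> snd l < snd z \<and> snd z < snd u" for z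
    by (auto simp: mem_box Basis_prod_def inner_prod_def)
  then have "to_pair -` box l u = box (of_pair l) (of_pair u)"
    by (auto simp: to_pair_def of_pair_def mem_box_cart forall_2)
  then have "emeasure (distr lborel borel to_pair) (box l u) = emeasure lborel (box (of_pair l) (of_pair u))"
    by (subst emeasure_distr) auto
  also have "\<dots> = ennreal (\<Prod>e\<in>Basis. (of_pair u - of_pair l) \<bullet> e)"
    using le exhaust_2 by (subst emeasure_lborel_box) (auto simp: Basis_vec_def inner_axis of_pair_def forall_2 UNIV_2)
  also have "\<dots> = ennreal (\<Prod>e\<in>Basis. (u - l) \<bullet> e)"
    by (simp add: prod_Basis_vec2 prod_Basis_pair inner_axis of_pair_def inner_prod_def)
  finally show "emeasure (distr lborel borel to_pair) (box l u) = ennreal (\<Prod>e\<in>Basis. (u - l) \<bullet> e)" .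
qed simp

lemma distr_of_pair: "distr lborel borel of_pair = lborel"
proof -
  have "distr lborel borel of_pair = distr (distr lborel borel to_pair) borel of_pair" by (simp only: distr_to_pair)
  also have "\<dots> = distr lborel borel (\<lambda>x. x)" by (subst distr_distr) (auto simp: o_def)
  also have "\<dots> = lborel" by (rule distr_id2) simp
  finally show ?thesis .
qed

lemma nn_integral_of_pair: "f \<in> borel_measurable borel \<Longrightarrow> (\<integral>\<^sup>+z. f (of_pair z) \<partial>lborel) = (\<integral>\<^sup>+x. f x \<partial>lborel)"
  using nn_integral_distr[of of_pair lborel borel f] by (simp add: distr_of_pair)

lemma AE_of_pair:
  assumes "AE x in lborel. P x" shows "AE z in lborel. P (of_pair z)"
proof -
  have "AE x in distr lborel borel of_pair. P x" using assms by (simp only: distr_of_pair)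
  from AE_distrD[OF _ this] show ?thesis by simp
qed

lemma emeasure_vimage_of_pair: "A \<in> sets borel \<Longrightarrow> emeasure lborel (of_pair -` A) = emeasure lborel A"
  using emeasure_distr[of of_pair lborel borel A] by (simp add: distr_of_pair)

lemma emeasure_vimage_to_pair: "A \<in> sets borel \<Longrightarrow> emeasure lborel (to_pair -` A) = emeasure lborel A"
  using emeasure_distr[of to_pair lborel borel A] by (simp add: distr_to_pair)

lemma displacement_bound:
  fixes b :: "real^2 \<Rightarrow> real^2" and X :: "real \<Rightarrow> real^2 \<Rightarrow> real^2"
  assumes T: "0 < T" and C: "0 < C" and M: "0 \<le> M"
    and b [measurable]: "b \<in> borel_measurable borel" and bd: "\<And>z. norm (b z) \<le> 2" and b1: "\<And>z. 1 \<le> b z $ 1"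
    and BV: "\<And>w. (\<integral>\<^sup>+z. norm (b (z + w) - b z) \<partial>lborel) \<le> ennreal (norm w * M)"
    and X0: "\<And>x. X 0 x = x" and cont: "\<And>s. s \<in> {0..T} \<Longrightarrow> continuous_on UNIV (X s)"
    and ode: "AE x in lborel. \<forall>t\<in>{0..T}. set_integrable lborel {0..t} (\<lambda>s. b (X s x)) \<and> X t x - x = (LINT s:{0..t}|lborel. b (X s x))"
    and area: "\<And>s A. s \<in> {0..T} \<Longrightarrow> A \<in> sets borel \<Longrightarrow> emeasure lborel (X s -` A) \<le> ennreal C * emeasure lborel A"
    and lip: "\<And>s t x. 0 \<le> s \<Longrightarrow> s \<le> t \<Longrightarrow> t \<le> T \<Longrightarrow> norm (X t x - X s x) \<le> 2 * (t - s)"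
    and first: "\<And>s t x. 0 \<le> s \<Longrightarrow> s \<le> t \<Longrightarrow> t \<le> T \<Longrightarrow> t - s \<le> X t x $ 1 - X s x $ 1"
  shows "(\<integral>\<^sup>+x. norm (X T (x + d) - X T x - d) \<partial>lborel) \<le> ennreal ((401 + 64 * C) * norm d * (T + norm d) * M)"
proof -
  interpret planar_flow "\<lambda>z. to_pair (b (of_pair z))" "\<lambda>s z. to_pair (X s (of_pair z))" T C M
  proof
    show "(\<lambda>z. to_pair (b (of_pair z))) \<in> borel_measurable borel" by measurable
    show "norm (to_pair (b (of_pair z))) \<le> 2" for z using bd by simp
    show "1 \<le> fst (to_pair (b (of_pair z)))" for z using b1 by (simp add: to_pair_def)
    show "(\<integral>\<^sup>+z. ennreal (norm (to_pair (b (of_pair (z + w))) - to_pair (b (of_pair z)))) \<partial>lborel) \<le> ennreal (norm w * M)" for w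
    proof -
      have "(\<integral>\<^sup>+z. ennreal (norm (to_pair (b (of_pair (z + w))) - to_pair (b (of_pair z)))) \<partial>lborel)
        = (\<integral>\<^sup>+z. ennreal (norm (b (of_pair z + of_pair w) - b (of_pair z))) \<partial>lborel)"
        by (simp add: of_pair_add flip: to_pair_diff)
      also have "\<dots> = (\<integral>\<^sup>+x. ennreal (norm (b (x + of_pair w) - b x)) \<partial>lborel)"
        by (rule nn_integral_of_pair[where f="\<lambda>x. ennreal (norm (b (x + of_pair w) - b x))"]) measurable
      also have "\<dots> \<le> ennreal (norm w * M)" using BV[of "of_pair w"] by simp
      finally show ?thesis .
    qed
    show "continuous_on UNIV (\<lambda>z. to_pair (X s (of_pair z)))" if "s \<in> {0..T}" for s
      by (intro continuous_on_compose2[OF to_pair_cont] continuous_on_compose2[OF cont[OF that] of_pair_cont]) auto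
    show "norm (to_pair (X t (of_pair x)) - to_pair (X s (of_pair x))) \<le> 2 * \<bar>t - s\<bar>" if "s \<in> {0..T}" "t \<in> {0..T}" for s t x
      using lip[of s t "of_pair x"] lip[of t s "of_pair x"] that
      by (cases "s \<le> t") (auto simp: norm_minus_commute simp flip: to_pair_diff)
    show "t - s \<le> fst (to_pair (X t (of_pair x))) - fst (to_pair (X s (of_pair x)))" if "0 \<le> s" "s \<le> t" "t \<le> T" for s t x
      using first[OF that] by (simp add: to_pair_def)
    show "AE x in lborel. \<forall>t\<in>{0..T}. to_pair (X t (of_pair x)) - x = (LINT s:{0..t}|lborel. to_pair (b (of_pair (to_pair (X s (of_pair x))))))"
      using AE_of_pair[OF ode]
    proof eventually_elim
      case (elim z)
      show ?case
      proof
        fix t assume "t \<in> {0..T}"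
        then have *: "set_integrable lborel {0..t} (\<lambda>s. b (X s (of_pair z)))" "X t (of_pair z) - of_pair z = (LINT s:{0..t}|lborel. b (X s (of_pair z)))"
          using elim by auto
        have "to_pair (X t (of_pair z)) - z = to_pair (X t (of_pair z) - of_pair z)" by (simp add: to_pair_diff)
        also have "\<dots> = (LINT s:{0..t}|lborel. to_pair (b (X s (of_pair z))))"
          unfolding *(2) set_lebesgue_integral_def
          using integral_bounded_linear[OF bounded_linear_to_pair *(1)[unfolded set_integrable_def]] by (simp add: to_pair_scaleR)
        finally show "to_pair (X t (of_pair z)) - z = (LINT s:{0..t}|lborel. to_pair (b (of_pair (to_pair (X s (of_pair z))))))" by simp
      qed
    qed
    show "emeasure lborel ((\<lambda>z. to_pair (X s (of_pair z))) -` A) \<le> ennreal C * emeasure lborel A"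
      if s: "s \<in> {0..T}" and A: "A \<in> sets borel" for s A
    proof -
      have A': "to_pair -` A \<in> sets borel" using measurable_sets_borel[OF to_pair_meas A] by simp
      have XA: "X s -` to_pair -` A \<in> sets borel"
        using measurable_sets_borel[OF borel_measurable_continuous_onI[OF cont[OF s]] A'] by simp
      have "emeasure lborel ((\<lambda>z. to_pair (X s (of_pair z))) -` A) = emeasure lborel (of_pair -` (X s -` (to_pair -` A)))"
        by (intro arg_cong[where f="emeasure lborel"]) auto
      also have "\<dots> = emeasure lborel (X s -` (to_pair -` A))" by (rule emeasure_vimage_of_pair[OF XA])
      also have "\<dots> \<le> ennreal C * emeasure lborel (to_pair -` A)" by (rule area[OF s A'])
      also have "\<dots> = ennreal C * emeasure lborel A" by (simp add: emeasure_vimage_to_pair A)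
      finally show ?thesis .
    qed
  qed (use T C M X0 in auto)
  have XT [measurable]: "X T \<in> borel_measurable borel" using T by (intro borel_measurable_continuous_onI cont) auto
  have "(\<integral>\<^sup>+x. ennreal (norm (X T (x + d) - X T x - d)) \<partial>lborel) = (\<integral>\<^sup>+z. ennreal (norm (X T (of_pair z + d) - X T (of_pair z) - d)) \<partial>lborel)"
    by (rule nn_integral_of_pair[where f="\<lambda>x. ennreal (norm (X T (x + d) - X T x - d))", symmetric]) measurable
  also have "\<dots> = (\<integral>\<^sup>+z. ennreal (norm (to_pair (X T (of_pair (z + to_pair d))) - to_pair (X T (of_pair z)) - to_pair d)) \<partial>lborel)"
    by (simp add: of_pair_add flip: to_pair_diff)
  also have "\<dots> \<le> ennreal ((401 + 64 * C) * norm (to_pair d) * (T + norm (to_pair d)) * M)"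
    by (rule nn_integral_displacement)
  finally show ?thesis by simp
qed

section \<open>The estimate for the given field\<close>

text \<open>The variation sees \<open>b\<close> only through integrals, so correcting the field on a
  null set is harmless.\<close>

lemma dvar_cong_AE:
  assumes ae: "AE x in lborel. b x = b' x" and [measurable]: "b \<in> borel_measurable borel" "b' \<in> borel_measurable borel"
  shows "dvar b U = dvar b' U"
proof -
  have "(\<integral>x. b x $ i * mdiv \<phi> x i \<partial>lborel) = (\<integral>x. b' x $ i * mdiv \<phi> x i \<partial>lborel)" if "\<phi> \<in> dtest U" for \<phi> i
  proof -
    have "continuous_on UNIV (\<lambda>x. mdiv \<phi> x i)"
      unfolding mdiv_def using that by (intro continuous_intros) (auto simp: dtest_def)
    then have [measurable]: "(\<lambda>x. mdiv \<phi> x i) \<in> borel_measurable borel" by (rule borel_measurable_continuous_onI)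
    show ?thesis
      by (rule integral_cong_AE) (use ae in \<open>auto elim!: eventually_mono\<close>)
  qed
  then have "{ereal (\<Sum>i\<in>UNIV. \<integral>x. b x $ i * mdiv \<phi> x i \<partial>lborel) | \<phi>. \<phi> \<in> dtest U}
    = {ereal (\<Sum>i\<in>UNIV. \<integral>x. b' x $ i * mdiv \<phi> x i \<partial>lborel) | \<phi>. \<phi> \<in> dtest U}"
    by (metis (no_types, lifting) sum.cong)
  then show ?thesis unfolding dvar_def by simp
qed

lemma dvar_nonneg: "0 \<le> dvar b U"
proof -
  have "test_fun (\<lambda>_. 0) (\<lambda>_ _. 0) U" by (simp add: test_fun_def)
  from dvar_test_fun[OF this, where b=b and i=1] show ?thesis by (simp add: zero_ereal_def)
qed

lemma integral_log_le:
  fixes f :: "real^2 \<Rightarrow> real^2"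
  assumes \<Omega>: "\<Omega> \<in> sets borel" "emeasure lborel \<Omega> < \<infinity>" and f [measurable]: "f \<in> borel_measurable borel"
    and d: "d \<noteq> 0" and B: "0 \<le> B" "(\<integral>\<^sup>+x. norm (f (x + d) - f x - d) \<partial>lborel) \<le> ennreal B"
  shows "(LINT x:\<Omega>|lborel. ln (1 + norm (f x - f (x + d)) / norm d)) \<le> measure lborel \<Omega> * ln 2 + B / (2 * norm d)"
proof -
  define E where "E x = norm (f (x + d) - f x - d)" for x
  have [measurable]: "E \<in> borel_measurable borel" unfolding E_def by measurable
  have E_int: "integrable lborel E"
  proof (rule integrableI_bounded)
    show "(\<integral>\<^sup>+x. ennreal (norm (E x)) \<partial>lborel) < \<infinity>"
      using B(2) by (simp add: E_def) (meson ennreal_less_top le_less_trans)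
  qed measurable
  have "(\<integral>\<^sup>+x. ennreal (E x) \<partial>lborel) = ennreal (\<integral>x. E x \<partial>lborel)"
    by (rule nn_integral_eq_integral[OF E_int]) (simp add: E_def)
  moreover have "(\<integral>\<^sup>+x. ennreal (E x) \<partial>lborel) \<le> ennreal B" using B(2) by (simp add: E_def)
  ultimately have "ennreal (\<integral>x. E x \<partial>lborel) \<le> ennreal B" by simp
  then have E_le: "(\<integral>x. E x \<partial>lborel) \<le> B" using B(1) by (simp add: ennreal_le_iff)
  have log_le: "ln (1 + norm (f x - f (x + d)) / norm d) \<le> ln 2 + E x / (2 * norm d)" for x
  proof -
    have "norm (f x - f (x + d)) \<le> norm d + E x"
      unfolding E_def using norm_triangle_ineq[of d "f (x + d) - f x - d"] by (simp add: norm_minus_commute)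
    from divide_right_mono[OF this, of "norm d"]
    have "1 + norm (f x - f (x + d)) / norm d \<le> 2 * (1 + E x / (2 * norm d))"
      using d by (simp add: add_divide_distrib)
    then have "ln (1 + norm (f x - f (x + d)) / norm d) \<le> ln (2 * (1 + E x / (2 * norm d)))"
      by (subst ln_le_cancel_iff) (auto simp: E_def intro!: add_pos_nonneg)
    also have "\<dots> = ln 2 + ln (1 + E x / (2 * norm d))"
      by (rule ln_mult_pos) (auto simp: E_def intro!: add_pos_nonneg)
    also have "\<dots> \<le> ln 2 + E x / (2 * norm d)"
      using ln_add_one_self_le_self[of "E x / (2 * norm d)"] by (simp add: E_def)
    finally show ?thesis .
  qed
  have int: "integrable lborel (\<lambda>x. indicator \<Omega> x * ln 2 + E x / (2 * norm d))"
    using E_int \<Omega> by (intro Bochner_Integration.integrable_add integrable_mult_left integrable_divide integrable_real_indicator) auto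
  have "(LINT x:\<Omega>|lborel. ln (1 + norm (f x - f (x + d)) / norm d)) \<le> (\<integral>x. indicator \<Omega> x * ln 2 + E x / (2 * norm d) \<partial>lborel)"
    unfolding set_lebesgue_integral_def
  proof (rule integral_mono'[OF int])
    fix x
    have E0: "0 \<le> E x" by (simp add: E_def)
    show "indicator \<Omega> x *\<^sub>R ln (1 + norm (f x - f (x + d)) / norm d) \<le> indicator \<Omega> x * ln 2 + E x / (2 * norm d)"
      using log_le[of x] E0 by (auto split: split_indicator)
    show "0 \<le> indicator \<Omega> x * ln 2 + E x / (2 * norm d)" using E0 by simp
  qed
  also have "\<dots> = measure lborel \<Omega> * ln 2 + (\<integral>x. E x \<partial>lborel) / (2 * norm d)"
    using E_int \<Omega> by (subst Bochner_Integration.integral_add) auto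
  also have "\<dots> \<le> measure lborel \<Omega> * ln 2 + B / (2 * norm d)"
    using E_le by (intro add_left_mono divide_right_mono) auto
  finally show ?thesis .
qed

lemma displacement_estimate:
  fixes b :: "real^2 \<Rightarrow> real^2" and X :: "real \<Rightarrow> real^2 \<Rightarrow> real^2"
  assumes C0: "0 < C0" and \<Omega>: "open \<Omega>"
    and b [measurable]: "b \<in> borel_measurable borel" and fin: "dvar b UNIV < \<infinity>" and supp: "dvar_support b \<subseteq> \<Omega>"
    and bd: "AE x in lborel. norm (b x) \<le> 2" and b1: "\<And>x. x \<in> \<Omega> \<Longrightarrow> 1 \<le> b x $ 1"
    and T: "0 \<le> T"
    and diff: "\<And>t x. t \<in> {0..T} \<Longrightarrow> X t differentiable (at x)"
    and ode: "\<And>t x. t \<in> {0..T} \<Longrightarrow> ((\<lambda>s. b (X s x)) has_integral (X t x - x)) {0..t}"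
    and det: "\<And>t x. t \<in> {0..T} \<Longrightarrow> 1 / C0 \<le> det (matrix (frechet_derivative (X t) (at x)))"
  shows "(\<integral>\<^sup>+x. norm (X T (x + d) - X T x - d) \<partial>lborel)
    \<le> ennreal ((401 + 64 * C0) * norm d * (T + norm d) * (4 * real_of_ereal (dvar b UNIV)))"
proof -
  define M where "M = real_of_ereal (dvar b UNIV)"
  have M: "0 \<le> M" unfolding M_def using dvar_nonneg by (rule real_of_ereal_pos)
  have X0: "X 0 x = x" for x
  proof -
    have "0 \<in> {0..T}" using T by simp
    from has_integral_unique[OF ode[OF this, of x, unfolded atLeastAtMost_singleton] has_integral_refl(2)]
    show ?thesis by simp
  qed
  have der: "(X t has_derivative frechet_derivative (X t) (at x)) (at x)" if "t \<in> {0..T}" for t x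
    using diff[OF that] frechet_derivative_works by blast
  have cont: "continuous_on UNIV (X t)" if "t \<in> {0..T}" for t
    using has_derivative_continuous[OF der[OF that]] by (auto intro: continuous_at_imp_continuous_on)
  have det_abs: "1 / C0 \<le> \<bar>det (matrix (frechet_derivative (X t) (at x)))\<bar>" if "t \<in> {0..T}" for t x
    using det[OF that, of x] by linarith
  \<comment> \<open>This must precede injectivity: it allows the field to be corrected along
    trajectories, and the displacement bound in the injectivity proof comes from the corrected
    field.\<close>
  have null: "X t -` N \<in> null_sets lborel" if "t \<in> {0..T}" "N \<in> null_sets lborel" for t N
    by (rule null_sets_vimage[OF der[OF that(1)] _ det_abs[OF that(1)] that(2)]) (use C0 in simp)
  define N1 where "N1 = {x. \<not> norm (b x) \<le> 2}"
  have [measurable]: "N1 \<in> sets borel" unfolding N1_def by measurable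
  have N1: "AE x in lborel. x \<notin> N1" using bd by (simp add: N1_def)
  \<comment> \<open>The field is corrected in two rounds: first its norm, so that the dichotomy can
    be applied, and later also its first component. The substitute \<open>axis 1 1\<close> has norm
    and first component 1, which suits both bounds.\<close>
  define c1 where "c1 x = (if x \<in> N1 then axis 1 1 else b x)" for x
  have [measurable]: "c1 \<in> borel_measurable borel" unfolding c1_def by measurable
  have c1_eq: "AE x in lborel. b x = c1 x" using N1 by eventually_elim (simp add: c1_def)
  have dvar_c1: "dvar b U = dvar c1 U" for U by (rule dvar_cong_AE[OF c1_eq]) measurable
  have "(\<exists>c. AE x in lborel. c1 x = c) \<or> (AE x in lborel. 1 \<le> c1 x $ 1)"
  proof (rule constant_or_first_component_ge_1[OF _ _ \<Omega>])
    show "norm (c1 x) \<le> 2" for x by (auto simp: c1_def N1_def norm_axis_1)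
    show "dvar_support c1 \<subseteq> \<Omega>" using supp by (simp add: dvar_support_def dvar_c1)
    show "AE x in lborel. x \<in> \<Omega> \<longrightarrow> 1 \<le> c1 x $ 1" using c1_eq
    proof eventually_elim
      case (elim x)
      then show ?case using b1[of x] by simp
    qed
  qed measurable
  then show ?thesis
  proof
    assume "\<exists>c. AE x in lborel. c1 x = c"
    then obtain c where c: "AE x in lborel. c1 x = c" by blast
    define N where "N = {x. b x \<noteq> c}"
    have "AE x in lborel. x \<notin> N" using c c1_eq by eventually_elim (simp add: N_def)
    moreover have "N \<in> sets lborel" unfolding N_def by measurable
    ultimately have N: "N \<in> null_sets lborel" by (subst AE_iff_null_sets)
    have "AE x in lborel. \<forall>t\<in>{0..T}. set_integrable lborel {0..t} (\<lambda>s. c) \<and> X t x - x = (LINT s:{0..t}|lborel. c)"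
      using AE_trajectory_lebesgue[OF T cont null[OF _ N] N ode, of "\<lambda>_. c" "norm c"] by (simp add: N_def)
    then have AE_T: "AE x in lborel. X T x - x = (LINT s:{0..T}|lborel. c)"
      by eventually_elim (use T in auto)
    \<comment> \<open>A constant field moves almost every point by the same vector, so this case is
      settled without a lower bound on the first component.\<close>
    have "AE x in lborel. norm (X T (x + d) - X T x - d) = 0"
      using AE_T AE_translate_lborel[OF AE_T, of d]
    proof eventually_elim
      case (elim x)
      then have "X T (x + d) - (x + d) = X T x - x" by simp
      then show ?case by (simp add: algebra_simps)
    qed
    then have "(\<integral>\<^sup>+x. norm (X T (x + d) - X T x - d) \<partial>lborel) = (\<integral>\<^sup>+x. 0 \<partial>(lborel :: (real^2) measure))"
      by (intro nn_integral_cong_AE) (auto elim: eventually_mono)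
    then show ?thesis by simp
  next
    assume ge: "AE x in lborel. 1 \<le> c1 x $ 1"
    define N where "N = {x. \<not> (norm (b x) \<le> 2 \<and> 1 \<le> b x $ 1)}"
    have [measurable]: "N \<in> sets borel" unfolding N_def by measurable
    have AE_N: "AE x in lborel. x \<notin> N" using ge c1_eq bd by eventually_elim (simp add: N_def)
    then have N: "N \<in> null_sets lborel" by (subst AE_iff_null_sets) auto
    define c where "c x = (if x \<in> N then axis 1 1 else b x)" for x
    have [measurable]: "c \<in> borel_measurable borel" unfolding c_def by measurable
    have cbd: "norm (c x) \<le> 2" and c_first: "1 \<le> c x $ 1" for x by (auto simp: c_def N_def norm_axis_1)
    have "AE x in lborel. b x = c x" using AE_N by eventually_elim (simp add: c_def)
    then have dvar_c: "dvar c UNIV = dvar b UNIV" by (intro dvar_cong_AE[symmetric]) auto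
    have traj: "AE x in lborel. \<forall>t\<in>{0..T}. set_integrable lborel {0..t} (\<lambda>s. c (X s x)) \<and> X t x - x = (LINT s:{0..t}|lborel. c (X s x))"
      by (rule AE_trajectory_lebesgue[OF T cont null[OF _ N] N ode _ cbd]) (auto simp: c_def)
    have incr: "AE x in lborel. \<forall>s t. 0 \<le> s \<longrightarrow> s \<le> t \<longrightarrow> t \<le> T \<longrightarrow>
        norm (X t x - X s x) \<le> 2 * (t - s) \<and> t - s \<le> X t x $ 1 - X s x $ 1"
      using traj
    proof eventually_elim
      case (elim x)
      show ?case
      proof (intro allI impI)
        fix s t assume st: "0 \<le> s" "s \<le> t" "t \<le> T"
        have int_t: "set_integrable lborel {0..t} (\<lambda>r. c (X r x))" using elim st by auto
        have int: "set_integrable lborel {s..t} (\<lambda>r. c (X r x))"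
          by (rule set_integrable_subset[OF int_t]) (use st in auto)
        have const: "set_integrable lborel {s..t} (\<lambda>_. k)" for k :: real
          by (rule set_integrable_bounded_Icc[of _ "\<bar>k\<bar>"]) auto
        have const_val: "(LINT r:{s..t}|lborel. k) = k * (t - s)" for k :: real
          using st by (simp add: set_lebesgue_integral_def)
        have "X t x - X s x = (X t x - x) - (X s x - x)" by simp
        also have "\<dots> = (LINT r:{0..t}|lborel. c (X r x)) - (LINT r:{0..s}|lborel. c (X r x))"
          using elim st by simp
        also have "\<dots> = (LINT r:{s..t}|lborel. c (X r x))"
          by (rule set_integral_Icc_diff[OF int_t]) (use st in auto)
        finally have eq: "X t x - X s x = (LINT r:{s..t}|lborel. c (X r x))" .
        have "norm (X t x - X s x) \<le> (LINT r:{s..t}|lborel. norm (c (X r x)))"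
          unfolding eq by (rule set_integral_norm_bound[OF int])
        also have "\<dots> \<le> (LINT r:{s..t}|lborel. 2)"
          by (rule set_integral_mono[OF set_integrable_norm[OF int] const]) (rule cbd)
        finally have 1: "norm (X t x - X s x) \<le> 2 * (t - s)" by (simp add: const_val)
        have comp: "integrable lborel (\<lambda>r. (indicator {s..t} r *\<^sub>R c (X r x)) $ 1)"
          and comp_eq: "(\<integral>r. (indicator {s..t} r *\<^sub>R c (X r x)) $ 1 \<partial>lborel) = (X t x - X s x) $ 1"
          using integrable_bounded_linear[OF bounded_linear_vec_nth int[unfolded set_integrable_def]]
            integral_bounded_linear[OF bounded_linear_vec_nth int[unfolded set_integrable_def]]
          unfolding eq set_lebesgue_integral_def by auto
        have "1 * (t - s) \<le> (\<integral>r. (indicator {s..t} r *\<^sub>R c (X r x)) $ 1 \<partial>lborel)"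
          unfolding const_val[symmetric] set_lebesgue_integral_def
          by (rule integral_mono[OF const[unfolded set_integrable_def] comp]) (use c_first in \<open>auto split: split_indicator\<close>)
        then show "norm (X t x - X s x) \<le> 2 * (t - s) \<and> t - s \<le> X t x $ 1 - X s x $ 1"
          using 1 comp_eq by simp
      qed
    qed
    \<comment> \<open>For fixed times both bounds are closed conditions on \<open>x\<close>. The
      injectivity proof needs the displacement bound at every point.\<close>
    have both: "norm (X t x - X s x) \<le> 2 * (t - s) \<and> t - s \<le> X t x $ 1 - X s x $ 1"
      if st: "0 \<le> s" "s \<le> t" "t \<le> T" for s t x
    proof (rule AE_closed_imp_all[where x=x])
      show "AE x in lborel. norm (X t x - X s x) \<le> 2 * (t - s) \<and> t - s \<le> X t x $ 1 - X s x $ 1"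
        using incr by eventually_elim (use st in blast)
      show "closed {x. norm (X t x - X s x) \<le> 2 * (t - s) \<and> t - s \<le> X t x $ 1 - X s x $ 1}"
        using st by (intro closed_Collect_conj closed_Collect_le continuous_intros cont) auto
    qed
    have inj: "inj (X s)" if s: "s \<in> {0..T}" for s
    proof (rule inj_if_det_pos[OF der[OF s]])
      show "0 < det (matrix (frechet_derivative (X s) (at x)))" for x
        using det[OF s, of x] C0 by (meson less_le_trans zero_less_divide_1_iff)
      show "norm (X s x - x) \<le> 2 * s" for x using both[of 0 s x] s by (simp add: X0)
    qed
    have area: "emeasure lborel (X s -` A) \<le> ennreal C0 * emeasure lborel A"
      if "s \<in> {0..T}" "A \<in> sets borel" for s A
      using emeasure_vimage_le[OF der[OF that(1)] inj[OF that(1)] _ det_abs[OF that(1)] that(2)] C0 by simp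
    show ?thesis
    proof (cases "T = 0")
      case True
      then show ?thesis by (simp add: X0)
    next
      case False
      then have "0 < T" using T by simp
      then show ?thesis
        unfolding M_def[symmetric]
      proof (rule displacement_bound[OF _ C0 _ _ cbd c_first _ X0 cont traj area])
        show "(\<integral>\<^sup>+z. ennreal (norm (c (z + w) - c z)) \<partial>lborel) \<le> ennreal (norm w * (4 * M))" for w
          using nn_integral_translate_dvar[of c w] cbd fin by (simp add: dvar_c M_def)
      qed (use M both in auto)
    qed
  qed
qed

theorem theorem5:
  fixes C0 :: real
  assumes "C0 > 0"
  shows "\<exists>C::real. \<forall>(\<Omega>::(real^2) set) (b::real^2 \<Rightarrow> real^2) (T::real) (X::real \<Rightarrow> real^2 \<Rightarrow> real^2).
    bounded \<Omega> \<and> regular_open \<Omega> \<and>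
    b \<in> borel_measurable lborel \<and>
    dvar b UNIV < \<infinity> \<and>
    dvar_support b \<subseteq> \<Omega> \<and>
    (AE x in lborel. norm (b x) \<le> 2) \<and>
    (\<forall>x\<in>\<Omega>. b x $ 1 \<ge> 1) \<and>
    (\<forall>t\<in>{0..T}. \<forall>x. X t differentiable (at x)) \<and>
    (\<forall>t\<in>{0..T}. \<forall>x. ((\<lambda>s. b (X s x)) has_integral (X t x - x)) {0..t}) \<and>
    (\<forall>t\<in>{0..T}. \<forall>x. 1 / C0 \<le> det (matrix (frechet_derivative (X t) (at x)))
                    \<and> det (matrix (frechet_derivative (X t) (at x))) \<le> C0)
    \<longrightarrow> (\<forall>t\<in>{0..T}. \<forall>\<delta>::real^2. \<delta> \<noteq> 0 \<longrightarrow>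
          (LINT x:\<Omega>|lborel. ln (1 + norm (X t x - X t (x + \<delta>)) / norm \<delta>))
          \<le> measure lborel \<Omega> * ln 2 + C * (t + norm \<delta>) * real_of_ereal (dvar b UNIV))"
proof (intro exI[of _ "2 * (401 + 64 * C0)"] allI impI ballI, elim conjE)
  fix \<Omega> :: "(real^2) set" and b :: "real^2 \<Rightarrow> real^2" and T t :: real and X :: "real \<Rightarrow> real^2 \<Rightarrow> real^2" and \<delta> :: "real^2"
  assume t: "t \<in> {0..T}" and \<delta>: "\<delta> \<noteq> 0" and "bounded \<Omega>" "regular_open \<Omega>"
    and b: "b \<in> borel_measurable lborel" and fin: "dvar b UNIV < \<infinity>" and supp: "dvar_support b \<subseteq> \<Omega>"
    and bd: "AE x in lborel. norm (b x) \<le> 2" and b1: "\<forall>x\<in>\<Omega>. b x $ 1 \<ge> 1"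
    and diff: "\<forall>t\<in>{0..T}. \<forall>x. X t differentiable (at x)"
    and ode: "\<forall>t\<in>{0..T}. \<forall>x. ((\<lambda>s. b (X s x)) has_integral (X t x - x)) {0..t}"
    and det: "\<forall>t\<in>{0..T}. \<forall>x. 1 / C0 \<le> det (matrix (frechet_derivative (X t) (at x)))
                    \<and> det (matrix (frechet_derivative (X t) (at x))) \<le> C0"
  define M where "M = real_of_ereal (dvar b UNIV)"
  \<comment> \<open>The bound for the integral of displacements: 4 is the factor from variation to
    translations. The logarithmic estimate divides \<open>B\<close> by
    \<open>2 * norm \<delta>\<close>, which leaves the witness
    \<open>2 * (401 + 64 * C0)\<close>.\<close>
  define B where "B = (401 + 64 * C0) * norm \<delta> * (t + norm \<delta>) * (4 * M)"
  have "0 \<le> M" unfolding M_def using dvar_nonneg by (rule real_of_ereal_pos)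
  then have "0 \<le> B" using assms t by (simp add: B_def)
  have "open \<Omega>" using \<open>regular_open \<Omega>\<close> unfolding regular_open_def by (metis open_interior)
  have "(\<integral>\<^sup>+x. norm (X t (x + \<delta>) - X t x - \<delta>) \<partial>lborel) \<le> ennreal B"
    unfolding B_def M_def
    by (rule displacement_estimate[OF assms \<open>open \<Omega>\<close> _ fin supp bd]) (use t b b1 diff ode det in auto)
  moreover have "emeasure lborel \<Omega> < \<infinity>" by (rule emeasure_bounded_finite[OF \<open>bounded \<Omega>\<close>])
  moreover have "continuous_on UNIV (X t)"
    using diff t by (intro continuous_at_imp_continuous_on ballI differentiable_imp_continuous_within) auto
  ultimately have "(LINT x:\<Omega>|lborel. ln (1 + norm (X t x - X t (x + \<delta>)) / norm \<delta>)) \<le> measure lborel \<Omega> * ln 2 + B / (2 * norm \<delta>)"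
    using \<open>open \<Omega>\<close> \<open>0 \<le> B\<close> \<delta> by (intro integral_log_le borel_measurable_continuous_onI) auto
  also have "B / (2 * norm \<delta>) = 2 * (401 + 64 * C0) * (t + norm \<delta>) * M"
    using \<delta> by (simp add: B_def)
  finally show "(LINT x:\<Omega>|lborel. ln (1 + norm (X t x - X t (x + \<delta>)) / norm \<delta>))
    \<le> measure lborel \<Omega> * ln 2 + 2 * (401 + 64 * C0) * (t + norm \<delta>) * real_of_ereal (dvar b UNIV)"
    by (simp add: M_def)
qed

end
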